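(* In the setting described in the context, for any sequence $(\varepsilon_n)_{n\in\mathbb N}\subset(0,\infty)$ converging to zero and any sequence of functions $(u_n)_{n\in\mathbb N}\subset L^2(\mathcal M)$ satisfying $$\sup_{n\in\mathbb N}\mathcal E_{\varepsilon_n}(u_n)<\infty,\qquad\sup_{n\in\mathbb N}\|u_n\|_{L^2(\mathcal M)}<\infty,$$ there exists a subsequence of $(u_n)$ which converges in $L^2(\mathcal M)$.
   Context: Geometry. $\mathcal M^{(1)},\mathcal M^{(2)}\subset\mathbb R^N$ are compact smooth Riemannian manifolds without boundary embedded in $\mathbb R^N$ (with induced metric), of dimensions $1\le d^{(1)}\le d^{(2)}$; $\mathcal M=\mathcal M^{(1)}\cup\mathcal M^{(2)}$ and $\mathcal M^{(12)}=\mathcal M^{(1)}\cap\mathcal M^{(2)}$. They intersect nondegenerately: $\mathcal M^{(12)}$ is a manifold of dimension $d^{(12)}<d^{(1)}$ embedded in $\mathbb R^N$, and for every $x\in\mathcal M^{(12)}$ the dimension of $\mathrm{span}(T_x\mathcal M^{(1)}\cup T_x\mathcal M^{(2)})$ is $d^{(1)}+d^{(2)}-d^{(12)}$. $\mathrm{Vol}^{(i)}$ is the volume measure of $\mathcal M^{(i)}$, and $\mathrm{Vol}(A)=\sum_{i}\mathrm{Vol}^{(i)}(A\cap\mathcal M^{(i)})$; $L^2(\mathcal M)=L^2(\mathcal M,\mathrm{Vol})$. Measures. For $i=1,2$, $\mu^{(i)}=\rho^{(i)}\mathrm{Vol}^{(i)}$ is a probability measure on $\mathcal M^{(i)}$ with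 $\rho^{(i)}$ Lipschitz continuous and $1/C_\rho\le\rho^{(i)}\le C_\rho$ for some $C_\rho>0$. Numbers $\alpha^{(1)},\alpha^{(2)}>0$ with $\alpha^{(1)}+\alpha^{(2)}=1$ are fixed and $\mu(A)=\sum_{i}\alpha^{(i)}\mu^{(i)}(A\cap\mathcal M^{(i)})$. Kernel. $\eta:[0,\infty)\to[0,\infty)$ is non-increasing, $\eta(0)>0$, $\eta$ is continuous at $0$, and $\operatorname{supp}\eta=[0,1]$. $\eta_\varepsilon(t)=\eta(t/\varepsilon)$, $|\cdot|$ is the Euclidean norm of $\mathbb R^N$. Energy. With $\eta_\varepsilon(|x-\cdot|)\star\mu:=\int_{\mathcal M}\eta_\varepsilon(|x-z|)\,d\mu(z)$, for $u\in L^2(\mathcal M)$, $$\mathcal E_\varepsilon(u)=\frac1{\varepsilon^2}\int_{\mathcal M}\int_{\mathcal M}\eta_\varepsilon(|x-y|)\left|\frac{u(x)}{\sqrt{\eta_\varepsilon(|x-\cdot|)\star\mu}}-\frac{u(y)}{\sqrt{\eta_\varepsilon(|y-\cdot|)\star\mu}}\right|^2d\mu(x)\,d\mu(y).$$ *)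

theory Defs
  imports "HOL-Analysis.Analysis" "HOL-Probability.Probability_Measure"
begin

text \<open>Smooth maps and submanifolds of a Euclidean space.\<close>

text \<open>\<open>Ck_on k f S\<close> is only used for open \<open>S\<close> and finite-dimensional domains; there, \<open>f\<close> is
  of class \<open>C\<^sup>k\<close> iff it is differentiable with all directional derivatives of class
  \<open>C\<^sup>k\<^sup>-\<^sup>1\<close>.\<close>

primrec Ck_on :: "nat \<Rightarrow> ('a::real_normed_vector \<Rightarrow> 'b::real_normed_vector) \<Rightarrow> 'a set \<Rightarrow> bool" where
  "Ck_on 0 f S \<longleftrightarrow> continuous_on S f"
| "Ck_on (Suc k) f S \<longleftrightarrow>
     f differentiable_on S \<and> (\<forall>v. Ck_on k (\<lambda>x. frechet_derivative f (at x) v) S)"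

definition smooth_on :: "('a::real_normed_vector \<Rightarrow> 'b::real_normed_vector) \<Rightarrow> 'a set \<Rightarrow> bool" where
  "smooth_on f S \<longleftrightarrow> (\<forall>k. Ck_on k f S)"

definition smooth_diffeomorphism ::
    "'a::real_normed_vector set \<Rightarrow> 'b::real_normed_vector set \<Rightarrow> ('a \<Rightarrow> 'b) \<Rightarrow> ('b \<Rightarrow> 'a) \<Rightarrow> bool" where
  "smooth_diffeomorphism U V \<phi> \<psi> \<longleftrightarrow>
     open U \<and> open V \<and> smooth_on \<phi> U \<and> smooth_on \<psi> V \<and> \<phi> ` U = V \<and> \<psi> ` V = U \<and>
     (\<forall>x\<in>U. \<psi> (\<phi> x) = x) \<and> (\<forall>y\<in>V. \<phi> (\<psi> y) = y)"

text \<open>Embedded \<open>d\<close>-dimensional submanifold without boundary, by slice charts.  \<open>d = 0\<close>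
  (discrete sets) is allowed, and the empty set is a submanifold of every dimension.\<close>

definition smooth_submanifold :: "nat \<Rightarrow> 'a::euclidean_space set \<Rightarrow> bool" where
  "smooth_submanifold d M \<longleftrightarrow>
     (\<forall>x\<in>M. \<exists>U V \<phi> \<psi> W. x \<in> U \<and> smooth_diffeomorphism U V \<phi> \<psi> \<and>
        subspace (W :: 'a set) \<and> dim W = d \<and> \<phi> ` (U \<inter> M) = V \<inter> W)"

definition tangent_space :: "'a::euclidean_space set \<Rightarrow> 'a \<Rightarrow> 'a set" where
  "tangent_space M x =
     {v. \<exists>(\<gamma> :: real \<Rightarrow> 'a) \<delta>. 0 < \<delta> \<and> smooth_on \<gamma> {-\<delta><..<\<delta>} \<and> \<gamma> ` {-\<delta><..<\<delta>} \<subseteq> M \<and>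
         \<gamma> 0 = x \<and> (\<gamma> has_vector_derivative v) (at 0)}"

text \<open>Riemannian volume for the metric induced by the ambient inner product.\<close>

definition local_parametrization ::
    "'a::euclidean_space set \<Rightarrow> (real^'d::finite) set \<Rightarrow> (real^'d \<Rightarrow> 'a) \<Rightarrow> bool" where
  "local_parametrization M \<Omega> \<psi> \<longleftrightarrow>
     open \<Omega> \<and> smooth_on \<psi> \<Omega> \<and> (\<forall>x\<in>\<Omega>. inj (frechet_derivative \<psi> (at x))) \<and>
     openin (top_of_set M) (\<psi> ` \<Omega>) \<and> (\<exists>\<phi>. homeomorphism \<Omega> (\<psi> ` \<Omega>) \<psi> \<phi>)"

definition metric_matrix :: "(real^'d::finite \<Rightarrow> 'a::euclidean_space) \<Rightarrow> real^'d \<Rightarrow> real^'d^'d" where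
  "metric_matrix \<psi> x =
     (\<chi> i j. frechet_derivative \<psi> (at x) (axis i 1) \<bullet> frechet_derivative \<psi> (at x) (axis j 1))"

text \<open>\<open>V\<close> is the volume measure of the \<open>CARD('d)\<close>-dimensional compact submanifold \<open>M\<close>: the
  Borel measure on \<open>M\<close> which in local coordinates is \<open>sqrt (det g) dx\<close>.  Since \<open>M\<close> is covered
  by finitely many coordinate patches, this determines \<open>V\<close> uniquely; \<open>V\<close> exists because the
  coordinate expressions agree on overlaps, by the change of variables formula.\<close>

definition is_volume_measure ::
    "'d::finite itself \<Rightarrow> 'a::euclidean_space set \<Rightarrow> 'a measure \<Rightarrow> bool" where
  "is_volume_measure _ M V \<longleftrightarrow>
     space V = M \<and> sets V = sets (restrict_space borel M) \<and>
     (\<forall>\<Omega> (\<psi> :: real^'d \<Rightarrow> 'a). local_parametrization M \<Omega> \<psi> \<longrightarrow>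
        (\<forall>A\<in>sets borel. A \<subseteq> \<Omega> \<longrightarrow>
           emeasure V (\<psi> ` A) = (\<integral>\<^sup>+x\<in>A. ennreal (sqrt (det (metric_matrix \<psi> x))) \<partial>lborel)))"

text \<open>The Borel measure \<open>A \<mapsto> a N\<^sub>1(A \<inter> M\<^sub>1) + b N\<^sub>2(A \<inter> M\<^sub>2)\<close> on \<open>M\<^sub>1 \<union> M\<^sub>2\<close>, where \<open>N\<^sub>i\<close> is a
  Borel measure on \<open>M\<^sub>i\<close>.\<close>

definition union_measure ::
    "real \<Rightarrow> 'a::euclidean_space measure \<Rightarrow> real \<Rightarrow> 'a measure \<Rightarrow> 'a measure" where
  "union_measure a N1 b N2 =
     measure_of (space N1 \<union> space N2) (sets (restrict_space borel (space N1 \<union> space N2)))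
       (\<lambda>A. ennreal a * emeasure N1 (A \<inter> space N1) + ennreal b * emeasure N2 (A \<inter> space N2))"

lemma space_union_measure: "space (union_measure a N1 b N2) = space N1 \<union> space N2"
  unfolding union_measure_def
  by (rule space_measure_of) (use sets.space_closed[of "restrict_space borel (space N1 \<union> space N2)"] in
    \<open>simp add: space_restrict_space\<close>)

lemma sets_union_measure:
  "sets (union_measure a N1 b N2) = sets (restrict_space borel (space N1 \<union> space N2))"
  unfolding union_measure_def
  by (rule sigma_algebra.sets_measure_of_eq)
     (metis sets.sigma_algebra_axioms space_borel space_restrict_space2 space_restrict_space Int_UNIV_left
        Int_UNIV_right)

lemma emeasure_union_measure:
  assumes N1: "sets N1 = sets (restrict_space borel (space N1))"
    and N2: "sets N2 = sets (restrict_space borel (space N2))"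
    and A: "A \<in> sets (restrict_space borel (space N1 \<union> space N2))"
  shows "emeasure (union_measure a N1 b N2) A =
    ennreal a * emeasure N1 (A \<inter> space N1) + ennreal b * emeasure N2 (A \<inter> space N2)"
proof (rule emeasure_measure_of[OF union_measure_def])
  let ?R = "restrict_space borel (space N1 \<union> space N2)"
  have Int: "B \<inter> space N1 \<in> sets N1" "B \<inter> space N2 \<in> sets N2" if B: "B \<in> sets ?R" for B
  proof -
    obtain C where "C \<in> sets borel" "B = C \<inter> (space N1 \<union> space N2)"
      using B by (auto simp: sets_restrict_space)
    then have "B \<inter> space N1 = space N1 \<inter> C" "B \<inter> space N2 = space N2 \<inter> C" by auto
    then show "B \<inter> space N1 \<in> sets N1" "B \<inter> space N2 \<in> sets N2"
      using \<open>C \<in> sets borel\<close> by (subst N1 N2, simp add: sets_restrict_space)+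
  qed
  show "sets ?R \<subseteq> Pow (space N1 \<union> space N2)"
    using sets.space_closed[of ?R] by (simp add: space_restrict_space)
  show "A \<in> sets (union_measure a N1 b N2)" using A by (simp add: sets_union_measure)
  show "positive (sets (union_measure a N1 b N2))
     (\<lambda>A. ennreal a * emeasure N1 (A \<inter> space N1) + ennreal b * emeasure N2 (A \<inter> space N2))"
    by (simp add: positive_def)
  show "countably_additive (sets (union_measure a N1 b N2))
     (\<lambda>A. ennreal a * emeasure N1 (A \<inter> space N1) + ennreal b * emeasure N2 (A \<inter> space N2))"
  proof (rule countably_additiveI)
    fix F :: "nat \<Rightarrow> 'a set"
    assume F: "range F \<subseteq> sets (union_measure a N1 b N2)" "disjoint_family F"
    have 1: "(\<Sum>i. emeasure N1 (F i \<inter> space N1)) = emeasure N1 (\<Union> (range F) \<inter> space N1)"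
      using F Int by (subst suminf_emeasure)
        (auto simp: sets_union_measure disjoint_family_on_def intro!: arg_cong[of _ _ "emeasure N1"])
    have 2: "(\<Sum>i. emeasure N2 (F i \<inter> space N2)) = emeasure N2 (\<Union> (range F) \<inter> space N2)"
      using F Int by (subst suminf_emeasure)
        (auto simp: sets_union_measure disjoint_family_on_def intro!: arg_cong[of _ _ "emeasure N2"])
    show "(\<Sum>i. ennreal a * emeasure N1 (F i \<inter> space N1) + ennreal b * emeasure N2 (F i \<inter> space N2)) =
      ennreal a * emeasure N1 (\<Union> (range F) \<inter> space N1) + ennreal b * emeasure N2 (\<Union> (range F) \<inter> space N2)"
      by (subst suminf_add[symmetric]) (simp_all add: 1 2)
  qed
qed

text \<open>Square-integrable real functions (as functions, not classes) and their norm.\<close>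

definition L2 :: "'a measure \<Rightarrow> ('a \<Rightarrow> real) set" where
  "L2 M = {u \<in> borel_measurable M. integrable M (\<lambda>x. (u x)\<^sup>2)}"

definition L2_norm :: "'a measure \<Rightarrow> ('a \<Rightarrow> real) \<Rightarrow> real" where
  "L2_norm M u = sqrt (\<integral>x. (u x)\<^sup>2 \<partial>M)"

definition kernel_conv ::
    "(real \<Rightarrow> real) \<Rightarrow> 'a::euclidean_space measure \<Rightarrow> real \<Rightarrow> 'a \<Rightarrow> real" where
  "kernel_conv \<eta> \<mu> \<epsilon> x = (\<integral>z. \<eta> (norm (x - z) / \<epsilon>) \<partial>\<mu>)"

definition energy ::
    "(real \<Rightarrow> real) \<Rightarrow> 'a::euclidean_space measure \<Rightarrow> real \<Rightarrow> ('a \<Rightarrow> real) \<Rightarrow> ennreal" where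
  "energy \<eta> \<mu> \<epsilon> u = ennreal (1 / \<epsilon>\<^sup>2) *
     (\<integral>\<^sup>+y. (\<integral>\<^sup>+x. ennreal (\<eta> (norm (x - y) / \<epsilon>) *
        \<bar>u x / sqrt (kernel_conv \<eta> \<mu> \<epsilon> x) - u y / sqrt (kernel_conv \<eta> \<mu> \<epsilon> y)\<bar>\<^sup>2) \<partial>\<mu>) \<partial>\<mu>)"

end

theory Submission
  imports Defs "HOL-Library.Diagonal_Subsequence"
begin

text \<open>Let \<open>K = K\<^sub>1 + K\<^sub>2\<close> with \<open>K\<^sub>i\<close> the part of \<open>\<eta>\<^sub>\<epsilon> \<star> \<mu>\<close> coming from the \<open>i\<close>-th manifold, and \<open>w = u / sqrt K\<close>.
  On a manifold of dimension \<open>d\<close>, boundedness of the nonlocal Dirichlet energy of \<open>f = \<epsilon>\<^bsup>d/2\<^esup> w\<close> and of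
  its \<open>L\<^sup>2\<close> norm gives precompactness: halving the interaction range by passing to midpoints yields a
  nonlocal Poincare inequality on small cubes in a chart, so \<open>f\<close> is uniformly close to step functions.
  The functions \<open>\<epsilon>\<^sup>-\<^sup>d K\<^sub>i\<close> are bounded and converge at every point, by blow-up in a chart.

  On the first manifold, and on the second one if the dimensions agree, \<open>\<epsilon>\<^sup>-\<^sup>d K\<close> is bounded above and below
  and converges, hence \<open>u = sqrt (\<epsilon>\<^sup>-\<^sup>d K) f\<close> is precompact as well.  If \<open>d\<^sub>1 < d\<^sub>2\<close>, then \<open>\<epsilon>\<^bsup>-d\<^sub>2\<^esup> K\<close> is unbounded
  on the second manifold near the intersection, but there the interaction energy between the two
  manifolds shows \<open>\<integral> K\<^sub>1 w\<^sup>2 \<rightarrow> 0\<close>, so that \<open>u\<close> may be replaced by \<open>sqrt (\<epsilon>\<^bsup>-d\<^sub>2\<^esup> K\<^sub>2) f\<close>.\<close>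

section \<open>Completeness and precompactness in \<open>L\<^sup>2\<close>\<close>

text \<open>The exponent d + 2 governs the estimates. One halving of the range costs 2^(d+2): 2^d
  from the Jacobian of passing to the midpoint and 4 from squaring the triangle inequality.
  Descending from cubes of side s/m to range \<epsilon> thus costs a multiple of (s/(m
  \<epsilon>))^(d+2); division by the volume (s/m)^d of a cube leaves (s/m)^2 / \<epsilon>^(d+2),
  and the energy bound for f, of order \<epsilon>^(d+2), cancels the denominator. The error 1/m^2 is
  uniform in n. Pointwise convergence of the weights is enough because it is paired with strong
  convergence of f: multiplication by bounded functions that converge a.e. preserves strong
  convergence, by dominated convergence. The integral of K_1 w^2 over the second manifold vanishes
  in the limit because of the gap in dimension. Comparing w(x)^2 with w(y)^2 for y on the first
  manifold leaves the mixed energy, O(\<epsilon>^2), and a term of order \<epsilon>^d2 times the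
  squared norm of w on the first manifold. That norm is O(\<epsilon>^(-d1)), so the product is
  O(\<epsilon>).\<close>

definition sqnorm :: "'a measure \<Rightarrow> ('a \<Rightarrow> real) \<Rightarrow> ennreal" where
  "sqnorm M f = (\<integral>\<^sup>+x. ennreal ((f x)\<^sup>2) \<partial>M)"

text \<open>Stated without a limit, so that the property for two measures adds up to the property
  for their sum.\<close>

definition L2_cauchy :: "'a measure \<Rightarrow> (nat \<Rightarrow> 'a \<Rightarrow> real) \<Rightarrow> bool" where
  "L2_cauchy M f \<longleftrightarrow>
     (\<forall>e>0. \<exists>N. \<forall>i\<ge>N. \<forall>j\<ge>N. sqnorm M (\<lambda>x. f i x - f j x) \<le> ennreal e)"

lemma square_diff_le: "(a - c)\<^sup>2 \<le> 2 * (a - b)\<^sup>2 + 2 * (b - c)\<^sup>2" for a b c :: real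
proof -
  have "2 * (a - b)\<^sup>2 + 2 * (b - c)\<^sup>2 - (a - c)\<^sup>2 = (a - b - (b - c))\<^sup>2"
    by (simp add: power2_eq_square algebra_simps)
  then show ?thesis
    using zero_le_power2[of "a - b - (b - c)"] by linarith
qed

lemma ennreal_square_diff_le:
  "ennreal ((a - c)\<^sup>2) \<le> 2 * ennreal ((a - b)\<^sup>2) + 2 * ennreal ((b - c)\<^sup>2)"
proof -
  have "2 * ennreal ((a - b)\<^sup>2) + 2 * ennreal ((b - c)\<^sup>2) = ennreal (2 * (a - b)\<^sup>2 + 2 * (b - c)\<^sup>2)"
    by (simp add: ennreal_mult')
  then show ?thesis
    using ennreal_leI[OF square_diff_le[of a c b]] by (simp del: ennreal_plus)
qed

lemma sqnorm_diff_le: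
  assumes [measurable]: "f \<in> borel_measurable M" "g \<in> borel_measurable M" "h \<in> borel_measurable M"
  shows "sqnorm M (\<lambda>x. f x - h x) \<le> 2 * sqnorm M (\<lambda>x. f x - g x) + 2 * sqnorm M (\<lambda>x. g x - h x)"
proof -
  have "sqnorm M (\<lambda>x. f x - h x) \<le> (\<integral>\<^sup>+x. 2 * ennreal ((f x - g x)\<^sup>2) + 2 * ennreal ((g x - h x)\<^sup>2) \<partial>M)"
    unfolding sqnorm_def by (intro nn_integral_mono ennreal_square_diff_le)
  also have "\<dots> = 2 * sqnorm M (\<lambda>x. f x - g x) + 2 * sqnorm M (\<lambda>x. g x - h x)"
    unfolding sqnorm_def by (simp add: nn_integral_add nn_integral_cmult)
  finally show ?thesis .
qed

lemma sqnorm_le_diff: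
  assumes [measurable]: "f \<in> borel_measurable M" "g \<in> borel_measurable M"
  shows "sqnorm M f \<le> 2 * sqnorm M (\<lambda>x. f x - g x) + 2 * sqnorm M g"
  using sqnorm_diff_le[of f M g "\<lambda>_. 0"] by simp

lemma sqnorm_minus_commute: "sqnorm M (\<lambda>x. f x - g x) = sqnorm M (\<lambda>x. g x - f x)"
  by (simp add: sqnorm_def power2_commute)

lemma L2_cauchy_geometric_subseq:
  assumes "L2_cauchy M f"
  obtains r :: "nat \<Rightarrow> nat" where "strict_mono r"
    "\<And>k i j. r k \<le> i \<Longrightarrow> r k \<le> j \<Longrightarrow> sqnorm M (\<lambda>x. f i x - f j x) \<le> ennreal ((1/8) ^ k)"
proof -
  have "\<forall>k. \<exists>N. \<forall>i\<ge>N. \<forall>j\<ge>N. sqnorm M (\<lambda>x. f i x - f j x) \<le> ennreal ((1/8) ^ k)"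
    using assms unfolding L2_cauchy_def by simp
  then obtain N where N: "\<And>k i j. i \<ge> N k \<Longrightarrow> j \<ge> N k \<Longrightarrow> sqnorm M (\<lambda>x. f i x - f j x) \<le> ennreal ((1/8) ^ k)"
    by metis
  \<comment> \<open>The summand k makes \<open>r\<close> strictly increasing; the sum over all i
    \<le> k makes it dominate \<open>N k\<close>.\<close>
  define r where "r k = k + (\<Sum>i\<le>k. N i)" for k
  have "strict_mono r"
    unfolding r_def by (rule strict_monoI_Suc) simp
  moreover have "N k \<le> r k" for k
    unfolding r_def using member_le_sum[of k "{..k}" N] by simp
  ultimately show ?thesis
    by (intro that[of r] N) (auto intro: order_trans)
qed

text \<open>The weights \<open>2 ^ k\<close> balance two needs: 2^k 8^(-k) = 4^(-k) keeps the
  integrated series finite, and finiteness at a point bounds the k-th increment there by a multiple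
  of 2^(-k/2), so the telescoping series converges absolutely.\<close>

lemma AE_convergent_of_geometric:
  assumes [measurable]: "\<And>k. f k \<in> borel_measurable M"
    and f: "\<And>k. sqnorm M (\<lambda>x. f (Suc k) x - f k x) \<le> ennreal ((1/8) ^ k)"
  shows "AE x in M. convergent (\<lambda>k. f k x :: real)"
proof -
  define g where "g k x = ennreal (2 ^ k * (f (Suc k) x - f k x)\<^sup>2)" for k x
  have [measurable]: "g k \<in> borel_measurable M" for k
    unfolding g_def by measurable
  have "(\<integral>\<^sup>+x. (\<Sum>k. g k x) \<partial>M) = (\<Sum>k. \<integral>\<^sup>+x. g k x \<partial>M)"
    by (rule nn_integral_suminf) measurable
  also have "\<dots> \<le> (\<Sum>k. ennreal ((1/4) ^ k))"
  proof (intro suminf_le summableI)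
    fix k
    have "(\<integral>\<^sup>+x. g k x \<partial>M) = ennreal (2 ^ k) * sqnorm M (\<lambda>x. f (Suc k) x - f k x)"
      unfolding g_def sqnorm_def by (simp add: ennreal_mult nn_integral_cmult)
    also have "\<dots> \<le> ennreal (2 ^ k) * ennreal ((1/8) ^ k)"
      by (intro mult_left_mono f) simp
    also have "\<dots> = ennreal ((1/4) ^ k)"
      by (simp add: ennreal_mult[symmetric] power_mult_distrib[symmetric] del: ennreal_power)
    finally show "(\<integral>\<^sup>+x. g k x \<partial>M) \<le> ennreal ((1/4) ^ k)" .
  qed
  also have "\<dots> < \<infinity>"
    by (simp add: ennreal_suminf_neq_top summable_geometric less_top[symmetric] del: ennreal_power)
  finally have "AE x in M. (\<Sum>k. g k x) \<noteq> \<infinity>"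
    by (intro nn_integral_PInf_AE) auto
  then show ?thesis
  proof eventually_elim
    case (elim x)
    then obtain G where G: "G \<ge> 0" "(\<Sum>k. g k x) = ennreal G"
      by (cases "\<Sum>k. g k x") auto
    have "norm (f (Suc k) x - f k x) \<le> sqrt G * (sqrt (1/2)) ^ k" for k
    proof -
      have "g k x \<le> ennreal G"
        unfolding G(2)[symmetric] using sum_le_suminf[of "\<lambda>k. g k x" "{k}"] by (simp add: summableI)
      then have "2 ^ k * (f (Suc k) x - f k x)\<^sup>2 \<le> G"
        using G by (simp add: g_def)
      then have "(f (Suc k) x - f k x)\<^sup>2 \<le> G * (1/2) ^ k"
        by (simp add: field_simps)
      then have "sqrt ((f (Suc k) x - f k x)\<^sup>2) \<le> sqrt (G * (1/2) ^ k)"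
        by (rule real_sqrt_le_mono)
      then show ?thesis
        by (simp only: real_sqrt_mult real_sqrt_power[of "1/2"] real_sqrt_abs real_norm_def)
    qed
    then have "summable (\<lambda>k. f (Suc k) x - f k x)"
      by (intro summable_comparison_test[OF _ summable_mult[OF summable_geometric]])
        (auto simp: real_sqrt_divide)
    then have "convergent (\<lambda>n. \<Sum>k<n. f (Suc k) x - f k x)"
      by (simp add: summable_iff_convergent)
    then have "convergent (\<lambda>n. f n x - f 0 x)"
      by (simp only: sum_lessThan_telescope[of "\<lambda>k. f k x"])
    then have "convergent (\<lambda>n. (f n x - f 0 x) + f 0 x)"
      by (intro convergent_add convergent_const)
    then show ?case by simp
  qed
qed

text \<open>The limit is taken a.e. along a fast subsequence. Fatou's lemma then carries the Cauchy
  bound between \<open>f i\<close> and \<open>f (r k)\<close> over to \<open>f i\<close> and the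
  limit, for all large i and not only along the subsequence.\<close>

lemma L2_complete:
  assumes [measurable]: "\<And>n. f n \<in> borel_measurable M" and f: "L2_cauchy M f"
  obtains v where "v \<in> borel_measurable M" "(\<lambda>n. sqnorm M (\<lambda>x. f n x - v x)) \<longlonglongrightarrow> 0"
proof -
  obtain r where r: "strict_mono r"
    and r8: "\<And>k i j. r k \<le> i \<Longrightarrow> r k \<le> j \<Longrightarrow> sqnorm M (\<lambda>x. f i x - f j x) \<le> ennreal ((1/8) ^ k)"
    using L2_cauchy_geometric_subseq[OF f] by metis
  \<comment> \<open>\<open>lim\<close> is total, so \<open>v\<close> is a measurable function on the
    whole space; its values on the null set of divergence are immaterial.\<close>
  define v where "v x = lim (\<lambda>k. f (r k) x)" for x
  have [measurable]: "v \<in> borel_measurable M"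
    unfolding v_def by measurable
  have conv: "AE x in M. convergent (\<lambda>k. f (r k) x)"
  proof (rule AE_convergent_of_geometric)
    fix k
    have "r k \<le> r (Suc k)"
      using r by (simp add: strict_mono_less_eq)
    then show "sqnorm M (\<lambda>x. f (r (Suc k)) x - f (r k) x) \<le> ennreal ((1/8) ^ k)"
      by (intro r8) auto
  qed simp
  have bound: "sqnorm M (\<lambda>x. f i x - v x) \<le> ennreal e"
    if N: "\<And>i j. i \<ge> N \<Longrightarrow> j \<ge> N \<Longrightarrow> sqnorm M (\<lambda>x. f i x - f j x) \<le> ennreal e" and i: "i \<ge> N" for e N i
  proof -
    have "sqnorm M (\<lambda>x. f i x - v x) = (\<integral>\<^sup>+x. liminf (\<lambda>k. ennreal ((f i x - f (r k) x)\<^sup>2)) \<partial>M)"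
      unfolding sqnorm_def
    proof (rule nn_integral_cong_AE, use conv in eventually_elim)
      case (elim x)
      then have "(\<lambda>k. f (r k) x) \<longlonglongrightarrow> v x"
        unfolding v_def by (simp add: convergent_LIMSEQ_iff)
      then have "(\<lambda>k. ennreal ((f i x - f (r k) x)\<^sup>2)) \<longlonglongrightarrow> ennreal ((f i x - v x)\<^sup>2)"
        by (intro tendsto_intros tendsto_ennrealI)
      then show ?case
        by (metis lim_imp_Liminf trivial_limit_sequentially)
    qed
    also have "\<dots> \<le> liminf (\<lambda>k. sqnorm M (\<lambda>x. f i x - f (r k) x))"
      unfolding sqnorm_def by (rule nn_integral_liminf) measurable
    also have "\<dots> \<le> ennreal e"
    proof (rule Liminf_le)
      show "\<forall>\<^sub>F k in sequentially. sqnorm M (\<lambda>x. f i x - f (r k) x) \<le> ennreal e"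
        using eventually_ge_at_top[of N]
      proof eventually_elim
        case (elim k)
        then show ?case
          using seq_suble[OF r, of k] by (intro N i) simp
      qed
    qed simp
    finally show ?thesis .
  qed
  have "(\<lambda>n. sqnorm M (\<lambda>x. f n x - v x)) \<longlonglongrightarrow> 0"
  proof (rule order_tendstoI)
    fix a :: ennreal assume "0 < a"
    then obtain b where b: "0 < b" "b < a"
      using dense by blast
    then obtain e where e: "e > 0" "ennreal e < a"
      by (cases b) (auto simp: ennreal_less_zero_iff)
    then obtain N where "\<And>i j. i \<ge> N \<Longrightarrow> j \<ge> N \<Longrightarrow> sqnorm M (\<lambda>x. f i x - f j x) \<le> ennreal e"
      using f unfolding L2_cauchy_def by meson
    then show "\<forall>\<^sub>F n in sequentially. sqnorm M (\<lambda>x. f n x - v x) < a"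
      unfolding eventually_sequentially using bound e(2) by (meson le_less_trans)
  qed simp
  then show ?thesis
    using that[of v] by simp
qed

lemma L2_cauchy_of_tendsto:
  assumes [measurable]: "\<And>n. f n \<in> borel_measurable M" "v \<in> borel_measurable M"
    and lim: "(\<lambda>n. sqnorm M (\<lambda>x. f n x - v x)) \<longlonglongrightarrow> 0"
  shows "L2_cauchy M f"
  unfolding L2_cauchy_def
proof (intro allI impI)
  fix e :: real assume "0 < e"
  then have "\<forall>\<^sub>F n in sequentially. sqnorm M (\<lambda>x. f n x - v x) < ennreal (e / 4)"
    by (intro order_tendstoD(2)[OF lim]) simp
  then obtain N where N: "\<And>n. n \<ge> N \<Longrightarrow> sqnorm M (\<lambda>x. f n x - v x) < ennreal (e / 4)"
    unfolding eventually_sequentially by metis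
  show "\<exists>N. \<forall>i\<ge>N. \<forall>j\<ge>N. sqnorm M (\<lambda>x. f i x - f j x) \<le> ennreal e"
  proof (intro exI[of _ N] allI impI)
    fix i j assume ij: "N \<le> i" "N \<le> j"
    have "sqnorm M (\<lambda>x. f i x - f j x) \<le> 2 * sqnorm M (\<lambda>x. f i x - v x) + 2 * sqnorm M (\<lambda>x. v x - f j x)"
      by (rule sqnorm_diff_le) auto
    also have "\<dots> \<le> 2 * ennreal (e / 4) + 2 * ennreal (e / 4)"
      using N[OF ij(1)] N[OF ij(2)]
      by (intro add_mono mult_left_mono) (auto simp: sqnorm_minus_commute[of M v] less_imp_le)
    also have "\<dots> = ennreal (2 * (e / 4) + 2 * (e / 4))"
      using \<open>0 < e\<close> by (simp only: ennreal_plus ennreal_mult' ennreal_numeral)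
    finally show "sqnorm M (\<lambda>x. f i x - f j x) \<le> ennreal e"
      by simp
  qed
qed

lemma convergent_subseq_finite_family:
  fixes c :: "nat \<Rightarrow> 'a \<Rightarrow> real"
  assumes "finite S" and "\<And>A. A \<in> S \<Longrightarrow> bounded (range (\<lambda>n. c n A))"
  shows "\<exists>r. strict_mono (r :: nat \<Rightarrow> nat) \<and> (\<forall>A\<in>S. convergent (\<lambda>n. c (r n) A))"
  using assms
proof (induction S rule: finite_induct)
  case empty
  show ?case using strict_mono_id by blast
next
  case (insert A S)
  then obtain r where r: "strict_mono r" "\<forall>B\<in>S. convergent (\<lambda>n. c (r n) B)"
    by auto
  have "bounded (range (\<lambda>n. c (r n) A))"
    by (rule bounded_subset[OF insert.prems[of A]]) auto
  then obtain l q where q: "strict_mono q" "((\<lambda>n. c (r n) A) \<circ> q) \<longlonglongrightarrow> l"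
    using bounded_imp_convergent_subsequence by blast
  have "convergent (\<lambda>n. c ((r \<circ> q) n) B)" if "B \<in> insert A S" for B
  proof (cases "B = A")
    case True
    then show ?thesis using q(2) by (auto simp: convergent_def o_def)
  next
    case False
    then show ?thesis
      using that convergent_subseq_convergent[of "\<lambda>n. c (r n) B" q] q(1) r(2) by (auto simp: o_def)
  qed
  then show ?case
    using strict_mono_o[OF r(1) q(1)] by blast
qed

text \<open>Bolzano-Weierstrass for the coefficients: on pieces of positive measure the norm bound
  \<open>B\<close> keeps them bounded, so along a subsequence they converge to some
  \<open>l\<close>. The error with the fixed coefficients \<open>l\<close> is then at most 2e + e,
  and two functions with this error differ by at most 2(3e) + 2(3e) = 12e. Overlapping pieces do no
  harm, since a point in several of them only enlarges the upper bound.\<close>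

lemma L2_almost_cauchy_subseq:
  fixes f :: "nat \<Rightarrow> 'a \<Rightarrow> real"
  assumes [measurable]: "\<And>n. f n \<in> borel_measurable M" and "finite_measure M"
    and B: "\<And>n. sqnorm M (f n) \<le> ennreal B" and "0 < e"
    and fin: "finite \<A>" and sets: "\<A> \<subseteq> sets M" and cover: "AE x in M. x \<in> \<Union>\<A>"
    and approx: "\<forall>\<^sub>F n in sequentially. \<exists>c :: 'a set \<Rightarrow> real.
      (\<Sum>A\<in>\<A>. \<integral>\<^sup>+x. ennreal ((f n x - c A)\<^sup>2) * indicator A x \<partial>M) \<le> ennreal e"
  shows "\<exists>r N. strict_mono (r :: nat \<Rightarrow> nat) \<and>
    (\<forall>i\<ge>N. \<forall>j\<ge>N. sqnorm M (\<lambda>x. f (r i) x - f (r j) x) \<le> ennreal (12 * e))"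
proof -
  interpret finite_measure M by fact
  have [measurable]: "A \<in> sets M" if "A \<in> \<A>" for A
    using that sets by auto
  define D where "D n c = (\<Sum>A\<in>\<A>. \<integral>\<^sup>+x. ennreal ((f n x - c A)\<^sup>2) * indicator A x \<partial>M)"
    for n and c :: "'a set \<Rightarrow> real"
  obtain N0 where N0: "\<And>n. n \<ge> N0 \<Longrightarrow> \<exists>c. D n c \<le> ennreal e"
    using approx unfolding D_def eventually_sequentially by auto
  then obtain c where c: "\<And>n. n \<ge> N0 \<Longrightarrow> D n (c n) \<le> ennreal e"
    by metis
  \<comment> \<open>On a null piece the given coefficient is arbitrary and may be unbounded in n;
    replacing it by 0 changes no integral. The value 0 before \<open>N0\<close>, where no
    coefficient is available, keeps the whole sequence bounded.\<close>
  define d where "d n A = (if n \<ge> N0 \<and> measure M A \<noteq> 0 then c n A else 0)" for n A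
  have d: "D n (d n) \<le> ennreal e" if "n \<ge> N0" for n
  proof -
    have "D n (d n) = D n (c n)"
      unfolding D_def
    proof (rule sum.cong)
      fix A assume A: "A \<in> \<A>"
      show "(\<integral>\<^sup>+x. ennreal ((f n x - d n A)\<^sup>2) * indicator A x \<partial>M) =
        (\<integral>\<^sup>+x. ennreal ((f n x - c n A)\<^sup>2) * indicator A x \<partial>M)"
      proof (cases "measure M A = 0")
        case True
        then have "A \<in> null_sets M"
          using A by (auto simp: null_sets_def emeasure_eq_measure)
        then have "AE x in M. x \<notin> A"
          by (rule AE_not_in)
        then show ?thesis
          by (intro nn_integral_cong_AE) (auto simp: indicator_def)
      qed (use that in \<open>simp add: d_def\<close>)
    qed simp
    then show ?thesis using c[OF that] by simp
  qed
  have piece: "(\<integral>\<^sup>+x. ennreal ((f n x - d n A)\<^sup>2) * indicator A x \<partial>M) \<le> ennreal e"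
    if "A \<in> \<A>" "n \<ge> N0" for n A
    using d[OF that(2)] unfolding D_def
    by (rule order_trans[OF member_le_sum[OF that(1) _ fin, of "\<lambda>A. \<integral>\<^sup>+x. ennreal ((f n x - d n A)\<^sup>2) * indicator A x \<partial>M"], rotated]) simp
  have "bounded (range (\<lambda>n. d n A))" if A: "A \<in> \<A>" for A
  proof (cases "measure M A = 0")
    case True
    then have "range (\<lambda>n. d n A) \<subseteq> {0}" by (auto simp: d_def)
    then show ?thesis by (rule bounded_subset[rotated]) simp
  next
    case False
    then have pos: "measure M A > 0" by (simp add: zero_less_measure_iff)
    have Bp: "ennreal B = ennreal (max B 0)" by (simp add: max_def ennreal_neg)
    have "norm (d n A) \<le> sqrt ((2 * e + 2 * max B 0) / measure M A)" for n
    proof (cases "n \<ge> N0")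
      case True
      have "ennreal ((d n A)\<^sup>2 * measure M A) = (\<integral>\<^sup>+x. ennreal ((d n A)\<^sup>2) * indicator A x \<partial>M)"
        using A by (simp add: nn_integral_cmult_indicator ennreal_mult emeasure_eq_measure)
      also have "\<dots> \<le> (\<integral>\<^sup>+x. 2 * (ennreal ((f n x - d n A)\<^sup>2) * indicator A x) + 2 * ennreal ((f n x)\<^sup>2) \<partial>M)"
      proof (rule nn_integral_mono)
        fix x
        show "ennreal ((d n A)\<^sup>2) * indicator A x \<le>
          2 * (ennreal ((f n x - d n A)\<^sup>2) * indicator A x) + 2 * ennreal ((f n x)\<^sup>2)"
          using ennreal_square_diff_le[of "d n A" 0 "f n x"]
          by (simp add: indicator_def power2_commute[of "d n A"])
      qed
      also have "\<dots> = 2 * (\<integral>\<^sup>+x. ennreal ((f n x - d n A)\<^sup>2) * indicator A x \<partial>M) + 2 * sqnorm M (f n)"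
        unfolding sqnorm_def using A by (subst nn_integral_add) (auto simp: nn_integral_cmult)
      also have "\<dots> \<le> 2 * ennreal e + 2 * ennreal (max B 0)"
        using piece[OF A True] B[of n] unfolding Bp by (intro add_mono mult_left_mono) auto
      also have "\<dots> = ennreal (2 * e + 2 * max B 0)"
        using \<open>0 < e\<close> by (simp add: ennreal_mult'' ennreal_plus)
      finally have "(d n A)\<^sup>2 * measure M A \<le> 2 * e + 2 * max B 0"
        using \<open>0 < e\<close> by (subst (asm) ennreal_le_iff) auto
      then have "(d n A)\<^sup>2 \<le> (2 * e + 2 * max B 0) / measure M A"
        using pos by (simp add: field_simps)
      then have "sqrt ((d n A)\<^sup>2) \<le> sqrt ((2 * e + 2 * max B 0) / measure M A)"
        by (rule real_sqrt_le_mono)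
      then show ?thesis by simp
    qed (use \<open>0 < e\<close> pos in \<open>simp add: d_def\<close>)
    then show ?thesis unfolding bounded_iff by blast
  qed
  then obtain r where r: "strict_mono r" "\<forall>A\<in>\<A>. convergent (\<lambda>n. d (r n) A)"
    using convergent_subseq_finite_family[OF fin, of d] by blast
  then obtain l where l: "\<And>A. A \<in> \<A> \<Longrightarrow> (\<lambda>n. d (r n) A) \<longlonglongrightarrow> l A"
    unfolding convergent_def by metis
  have "(\<lambda>n. \<Sum>A\<in>\<A>. 2 * (d (r n) A - l A)\<^sup>2 * measure M A) \<longlonglongrightarrow> (\<Sum>A\<in>\<A>. 2 * (l A - l A)\<^sup>2 * measure M A)"
    by (intro tendsto_intros l)
  then have "\<forall>\<^sub>F n in sequentially. (\<Sum>A\<in>\<A>. 2 * (d (r n) A - l A)\<^sup>2 * measure M A) < e"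
    by (rule order_tendstoD(2)) (use \<open>0 < e\<close> in simp)
  then obtain N1 where N1: "\<And>n. n \<ge> N1 \<Longrightarrow> (\<Sum>A\<in>\<A>. 2 * (d (r n) A - l A)\<^sup>2 * measure M A) < e"
    unfolding eventually_sequentially by blast
  have Dl: "D (r n) l \<le> ennreal (3 * e)" if n: "n \<ge> max N0 N1" for n
  proof -
    have rn: "r n \<ge> N0" using seq_suble[OF r(1), of n] n by simp
    have "D (r n) l \<le> (\<Sum>A\<in>\<A>. 2 * (\<integral>\<^sup>+x. ennreal ((f (r n) x - d (r n) A)\<^sup>2) * indicator A x \<partial>M)
       + ennreal (2 * (d (r n) A - l A)\<^sup>2 * measure M A))"
      unfolding D_def
    proof (rule sum_mono)
      fix A assume A: "A \<in> \<A>"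
      have "(\<integral>\<^sup>+x. ennreal ((f (r n) x - l A)\<^sup>2) * indicator A x \<partial>M) \<le>
        (\<integral>\<^sup>+x. 2 * (ennreal ((f (r n) x - d (r n) A)\<^sup>2) * indicator A x) +
            2 * ennreal ((d (r n) A - l A)\<^sup>2) * indicator A x \<partial>M)"
        using ennreal_square_diff_le by (intro nn_integral_mono) (auto simp: indicator_def)
      also have "\<dots> = 2 * (\<integral>\<^sup>+x. ennreal ((f (r n) x - d (r n) A)\<^sup>2) * indicator A x \<partial>M)
         + 2 * ennreal ((d (r n) A - l A)\<^sup>2) * emeasure M A"
        using A by (subst nn_integral_add) (auto simp: nn_integral_cmult nn_integral_cmult_indicator)
      also have "2 * ennreal ((d (r n) A - l A)\<^sup>2) * emeasure M A = ennreal (2 * (d (r n) A - l A)\<^sup>2 * measure M A)"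
        by (simp add: ennreal_mult emeasure_eq_measure)
      finally show "(\<integral>\<^sup>+x. ennreal ((f (r n) x - l A)\<^sup>2) * indicator A x \<partial>M) \<le>
          2 * (\<integral>\<^sup>+x. ennreal ((f (r n) x - d (r n) A)\<^sup>2) * indicator A x \<partial>M)
       + ennreal (2 * (d (r n) A - l A)\<^sup>2 * measure M A)" .
    qed
    also have "\<dots> = 2 * D (r n) (d (r n)) + ennreal (\<Sum>A\<in>\<A>. 2 * (d (r n) A - l A)\<^sup>2 * measure M A)"
      unfolding D_def by (subst sum_ennreal[symmetric]) (auto simp: sum.distrib sum_distrib_left)
    also have "\<dots> \<le> 2 * ennreal e + ennreal e"
      using n by (intro add_mono mult_left_mono d rn ennreal_leI less_imp_le[OF N1]) auto
    also have "\<dots> = ennreal (2 * e + e)"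
      using \<open>0 < e\<close> by (simp only: ennreal_plus ennreal_mult' ennreal_numeral)
    finally show ?thesis by simp
  qed
  have "sqnorm M (\<lambda>x. f (r i) x - f (r j) x) \<le> ennreal (12 * e)"
    if ij: "i \<ge> max N0 N1" "j \<ge> max N0 N1" for i j
  proof -
    have "sqnorm M (\<lambda>x. f (r i) x - f (r j) x) \<le>
      (\<integral>\<^sup>+x. (\<Sum>A\<in>\<A>. 2 * (ennreal ((f (r i) x - l A)\<^sup>2) * indicator A x) +
         2 * (ennreal ((f (r j) x - l A)\<^sup>2) * indicator A x)) \<partial>M)"
      unfolding sqnorm_def
    proof (rule nn_integral_mono_AE, use cover in eventually_elim)
      case (elim x)
      then obtain A where A: "A \<in> \<A>" "x \<in> A" by auto
      have "ennreal ((f (r i) x - f (r j) x)\<^sup>2) \<le> 2 * (ennreal ((f (r i) x - l A)\<^sup>2) * indicator A x) +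
         2 * (ennreal ((f (r j) x - l A)\<^sup>2) * indicator A x)"
        using A ennreal_square_diff_le[of "f (r i) x" "f (r j) x" "l A"] by (simp add: power2_commute)
      also have "\<dots> \<le> (\<Sum>A\<in>\<A>. 2 * (ennreal ((f (r i) x - l A)\<^sup>2) * indicator A x) +
         2 * (ennreal ((f (r j) x - l A)\<^sup>2) * indicator A x))"
        by (rule member_le_sum[OF A(1) _ fin]) simp
      finally show ?case .
    qed
    also have "\<dots> = 2 * D (r i) l + 2 * D (r j) l"
      unfolding D_def sum_distrib_left sum.distrib[symmetric]
      by (subst nn_integral_sum) (auto intro!: sum.cong simp: nn_integral_add nn_integral_cmult)
    also have "\<dots> \<le> 2 * ennreal (3 * e) + 2 * ennreal (3 * e)"
      by (intro add_mono mult_left_mono Dl ij) auto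
    also have "\<dots> = ennreal (2 * (3 * e) + 2 * (3 * e))"
      using \<open>0 < e\<close> by (simp only: ennreal_plus ennreal_mult' ennreal_numeral)
    finally show ?thesis by simp
  qed
  then show ?thesis using r(1) by blast
qed

text \<open>Total boundedness phrased with step functions: the family \<open>\<A>\<close> has to
  serve all large n at once, and only the constants \<open>c\<close> vary with n. Large n are the
  right scope because pieces of a fixed size control \<open>f n\<close> only when the range of the
  kernel is small against them.\<close>

definition approximable :: "'a measure \<Rightarrow> (nat \<Rightarrow> 'a \<Rightarrow> real) \<Rightarrow> 'a set \<Rightarrow> bool" where
  "approximable M f K \<longleftrightarrow> (\<forall>e>0. \<exists>\<A>. finite \<A> \<and> \<A> \<subseteq> sets M \<and> K \<subseteq> \<Union>\<A> \<and>
      (\<forall>\<^sub>F n in sequentially. \<exists>c :: 'a set \<Rightarrow> real.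
         (\<Sum>A\<in>\<A>. \<integral>\<^sup>+x. ennreal ((f n x - c A)\<^sup>2) * indicator A x \<partial>M) \<le> ennreal e))"

text \<open>Each accuracy 1/(k+1) is reached along some subsequence of any given one and is
  inherited by further subsequences, so a diagonal sequence reaches all of them.\<close>

lemma L2_precompact:
  fixes f :: "nat \<Rightarrow> 'a \<Rightarrow> real"
  assumes [measurable]: "\<And>n. f n \<in> borel_measurable M" and "finite_measure M"
    and B: "\<And>n. sqnorm M (f n) \<le> ennreal B"
    and approx: "approximable M f K" and K: "AE x in M. x \<in> K"
  shows "\<exists>r. strict_mono (r :: nat \<Rightarrow> nat) \<and> L2_cauchy M (\<lambda>n. f (r n))"
proof -
  define P where "P k s \<longleftrightarrow> (\<exists>N. \<forall>i\<ge>N. \<forall>j\<ge>N.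
      sqnorm M (\<lambda>x. f (s i) x - f (s j) x) \<le> ennreal (1 / real (Suc k)))" for k and s :: "nat \<Rightarrow> nat"
  interpret subseqs P
  proof
    fix k and s :: "nat \<Rightarrow> nat" assume s: "strict_mono s"
    \<comment> \<open>The factor 12 lost in \<open>L2_almost_cauchy_subseq\<close> is divided out in
      advance.\<close>
    let ?e = "1 / real (Suc k) / 12"
    have "0 < ?e" by simp
    with approx[unfolded approximable_def, rule_format, of ?e]
    obtain \<A> where \<A>: "finite \<A>" "\<A> \<subseteq> sets M" "K \<subseteq> \<Union>\<A>"
      "\<forall>\<^sub>F n in sequentially. \<exists>c :: 'a set \<Rightarrow> real.
         (\<Sum>A\<in>\<A>. \<integral>\<^sup>+x. ennreal ((f n x - c A)\<^sup>2) * indicator A x \<partial>M) \<le> ennreal ?e"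
      by blast
    have cover: "AE x in M. x \<in> \<Union>\<A>"
      using K by eventually_elim (use \<A>(3) in blast)
    have "\<forall>\<^sub>F n in sequentially. \<exists>c :: 'a set \<Rightarrow> real.
         (\<Sum>A\<in>\<A>. \<integral>\<^sup>+x. ennreal ((f (s n) x - c A)\<^sup>2) * indicator A x \<partial>M) \<le> ennreal ?e"
      by (rule eventually_subseq[OF s \<A>(4)])
    from L2_almost_cauchy_subseq[OF assms(1) assms(2) B \<open>0 < ?e\<close> \<A>(1,2) cover this]
    obtain q :: "nat \<Rightarrow> nat" and N where "strict_mono q"
      "\<forall>i\<ge>N. \<forall>j\<ge>N. sqnorm M (\<lambda>x. f (s (q i)) x - f (s (q j)) x) \<le> ennreal (12 * ?e)"
      by blast
    moreover have "12 * ?e = 1 / real (Suc k)" by (simp add: field_simps)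
    ultimately show "\<exists>r'. strict_mono r' \<and> P k (s \<circ> r')"
      unfolding P_def by (intro exI[of _ q] conjI exI[of _ N]) (simp_all only: o_def)
  qed
  have "L2_cauchy M (\<lambda>n. f (diagseq n))"
    unfolding L2_cauchy_def
  proof (intro allI impI)
    fix e :: real assume "0 < e"
    then obtain k where k: "1 / real (Suc k) < e"
      using nat_approx_posE by blast
    \<comment> \<open>From index k + 1 on, the diagonal sequence is a subsequence of the one built
      for accuracy k.\<close>
    have "P k (diagseq \<circ> ((+) (Suc k)))"
    proof (rule diagseq_holds)
      fix r s :: "nat \<Rightarrow> nat" and n assume r: "strict_mono r" and "P n s"
      then obtain N where "\<forall>i\<ge>N. \<forall>j\<ge>N. sqnorm M (\<lambda>x. f (s i) x - f (s j) x) \<le> ennreal (1 / real (Suc n))"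
        unfolding P_def by blast
      then show "P n (s \<circ> r)"
        unfolding P_def using seq_suble[OF r]
        by (intro exI[of _ N]) (metis comp_def order_trans)
    qed
    then obtain N where N: "\<And>i j. i \<ge> N \<Longrightarrow> j \<ge> N \<Longrightarrow>
       sqnorm M (\<lambda>x. f (diagseq (Suc k + i)) x - f (diagseq (Suc k + j)) x) \<le> ennreal (1 / real (Suc k))"
      unfolding P_def by auto
    show "\<exists>N. \<forall>i\<ge>N. \<forall>j\<ge>N. sqnorm M (\<lambda>x. f (diagseq i) x - f (diagseq j) x) \<le> ennreal e"
    proof (intro exI[of _ "Suc k + N"] allI impI)
      fix i j assume "Suc k + N \<le> i" "Suc k + N \<le> j"
      then have "sqnorm M (\<lambda>x. f (diagseq i) x - f (diagseq j) x) \<le> ennreal (1 / real (Suc k))"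
        using N[of "i - Suc k" "j - Suc k"] by simp
      also have "\<dots> \<le> ennreal e" using k by (intro ennreal_leI) simp
      finally show "sqnorm M (\<lambda>x. f (diagseq i) x - f (diagseq j) x) \<le> ennreal e" .
    qed
  qed
  then show ?thesis using subseq_diagseq by blast
qed

section \<open>A nonlocal Poincare inequality on cubes\<close>

lemma nn_integral_lborel_affine:
  fixes f :: "'a::euclidean_space \<Rightarrow> ennreal"
  assumes [measurable]: "f \<in> borel_measurable borel" and c: "0 < c"
  shows "(\<integral>\<^sup>+x. f x \<partial>lborel) = ennreal (c ^ DIM('a)) * (\<integral>\<^sup>+x. f (t + c *\<^sub>R x) \<partial>lborel)"
  using c
  by (subst lborel_affine[of c t])
    (auto simp: nn_integral_density nn_integral_distr nn_integral_cmult)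

lemma nn_integral_lborel_scale:
  fixes f :: "'a::euclidean_space \<Rightarrow> ennreal"
  assumes [measurable]: "f \<in> borel_measurable borel" and c: "0 < c"
  shows "(\<integral>\<^sup>+x. f (t + c *\<^sub>R x) \<partial>lborel) = ennreal ((1 / c) ^ DIM('a)) * (\<integral>\<^sup>+x. f x \<partial>lborel)"
proof -
  have "ennreal ((1 / c) ^ DIM('a)) * (\<integral>\<^sup>+x. f x \<partial>lborel) =
      (ennreal ((1 / c) ^ DIM('a)) * ennreal (c ^ DIM('a))) * (\<integral>\<^sup>+x. f (t + c *\<^sub>R x) \<partial>lborel)"
    by (subst nn_integral_lborel_affine[OF assms, of t]) (simp only: mult.assoc)
  also have "ennreal ((1 / c) ^ DIM('a)) * ennreal (c ^ DIM('a)) = 1"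
    using c by (simp add: ennreal_mult[symmetric] power_mult_distrib[symmetric] del: ennreal_power)
  finally show ?thesis by simp
qed

text \<open>Left without normalising powers of r or of the volume, so that every power of \<epsilon>
  stays visible in the estimates.\<close>

definition osc :: "'a::metric_space measure \<Rightarrow> 'a set \<Rightarrow> ('a \<Rightarrow> real) \<Rightarrow> real \<Rightarrow> ennreal" where
  "osc \<nu> Q F r =
     (\<integral>\<^sup>+x. \<integral>\<^sup>+y. ennreal ((F x - F y)\<^sup>2) * (indicator Q x * indicator Q y * indicator {..r} (dist x y)) \<partial>\<nu> \<partial>\<nu>)"

lemma osc_mono: "r \<le> r' \<Longrightarrow> osc \<nu> Q F r \<le> osc \<nu> Q F r'"
  unfolding osc_def by (intro nn_integral_mono mult_left_mono) (auto simp: indicator_def)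

text \<open>With m the midpoint of x and y, (F x - F y)^2 \<le> 2 (F x - F m)^2 + 2 (F m - F y)^2;
  both new distances are half the old one, and convexity keeps m in \<open>Q\<close>. By symmetry
  the two terms have equal integrals, which gives the factor 4, and taking m as the variable in
  place of y gives \<open>2 ^ DIM('a)\<close>.\<close>

lemma osc_halve:
  fixes F :: "'a::euclidean_space \<Rightarrow> real"
  assumes [measurable]: "F \<in> borel_measurable borel" "Q \<in> sets borel" and Q: "convex Q"
  shows "osc lborel Q F r \<le> ennreal (2 ^ (DIM('a) + 2)) * osc lborel Q F (r / 2)"
proof -
  define h :: "real \<Rightarrow> 'a \<Rightarrow> 'a \<Rightarrow> ennreal" where
    "h r x y = ennreal ((F x - F y)\<^sup>2) * (indicator Q x * indicator Q y * indicator {..r} (dist x y))" for r x y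
  have [measurable]: "(\<lambda>p. h r (fst p) (snd p)) \<in> borel_measurable (borel \<Otimes>\<^sub>M borel)" for r
    unfolding h_def by measurable
  have [measurable]: "(\<lambda>x. h r (f x) (g x)) \<in> borel_measurable M"
    if [measurable]: "f \<in> borel_measurable M" "g \<in> borel_measurable M" for f g r and M :: "'c measure"
    unfolding h_def by measurable
  have sym: "h r x y = h r y x" for r x y
    by (simp add: h_def power2_commute dist_commute ac_simps)
  have pt: "h r x y \<le> 2 * h (r/2) x ((1/2) *\<^sub>R x + (1/2) *\<^sub>R y) + 2 * h (r/2) y ((1/2) *\<^sub>R y + (1/2) *\<^sub>R x)" for x y
  proof (cases "x \<in> Q \<and> y \<in> Q \<and> dist x y \<le> r")
    case True
    define m where "m = (1/2) *\<^sub>R x + (1/2) *\<^sub>R y"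
    have "m \<in> Q"
      unfolding m_def using True Q by (intro convexD) auto
    have "x - m = (1/2) *\<^sub>R (x - y)" "y - m = (1/2) *\<^sub>R (y - x)"
      by (simp_all add: m_def algebra_simps flip: scaleR_add_left)
    then have "dist x m = dist x y / 2" "dist y m = dist x y / 2"
      by (simp_all add: dist_norm norm_minus_commute)
    then show ?thesis
      using True \<open>m \<in> Q\<close> ennreal_square_diff_le[of "F x" "F y" "F m"]
      by (simp add: h_def m_def[symmetric] add.commute[of "(1/2) *\<^sub>R y"] power2_commute[of "F y" "F m"])
  next
    case False
    then have "h r x y = 0" by (auto simp: h_def indicator_def)
    then show ?thesis by simp
  qed
  have half: "(\<integral>\<^sup>+x. \<integral>\<^sup>+y. h (r/2) x ((1/2) *\<^sub>R x + (1/2) *\<^sub>R y) \<partial>lborel \<partial>lborel) = ennreal (2 ^ DIM('a)) * osc lborel Q F (r/2)"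
    by (simp add: nn_integral_lborel_scale nn_integral_cmult osc_def h_def[symmetric])
  have "osc lborel Q F r = (\<integral>\<^sup>+x. \<integral>\<^sup>+y. h r x y \<partial>lborel \<partial>lborel)"
    by (simp add: osc_def h_def)
  also have "\<dots> \<le> (\<integral>\<^sup>+x. \<integral>\<^sup>+y. 2 * h (r/2) x ((1/2) *\<^sub>R x + (1/2) *\<^sub>R y) + 2 * h (r/2) y ((1/2) *\<^sub>R y + (1/2) *\<^sub>R x) \<partial>lborel \<partial>lborel)"
    by (intro nn_integral_mono pt)
  also have "\<dots> = 2 * (\<integral>\<^sup>+x. \<integral>\<^sup>+y. h (r/2) x ((1/2) *\<^sub>R x + (1/2) *\<^sub>R y) \<partial>lborel \<partial>lborel) +
      2 * (\<integral>\<^sup>+x. \<integral>\<^sup>+y. h (r/2) y ((1/2) *\<^sub>R y + (1/2) *\<^sub>R x) \<partial>lborel \<partial>lborel)"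
    by (simp add: nn_integral_add nn_integral_cmult)
  also have "(\<integral>\<^sup>+x. \<integral>\<^sup>+y. h (r/2) y ((1/2) *\<^sub>R y + (1/2) *\<^sub>R x) \<partial>lborel \<partial>lborel) =
      (\<integral>\<^sup>+x. \<integral>\<^sup>+y. h (r/2) x ((1/2) *\<^sub>R x + (1/2) *\<^sub>R y) \<partial>lborel \<partial>lborel)"
    by (rule lborel_pair.Fubini') measurable
  also have "2 * (\<integral>\<^sup>+x. \<integral>\<^sup>+y. h (r/2) x ((1/2) *\<^sub>R x + (1/2) *\<^sub>R y) \<partial>lborel \<partial>lborel) +
      2 * (\<integral>\<^sup>+x. \<integral>\<^sup>+y. h (r/2) x ((1/2) *\<^sub>R x + (1/2) *\<^sub>R y) \<partial>lborel \<partial>lborel) =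
      ennreal (2 ^ (DIM('a) + 2)) * osc lborel Q F (r / 2)"
    unfolding half by (simp add: ennreal_mult mult.assoc[symmetric] flip: distrib_right)
  finally show ?thesis .
qed

lemma osc_iterate:
  fixes F :: "'a::euclidean_space \<Rightarrow> real"
  assumes "F \<in> borel_measurable borel" "Q \<in> sets borel" "convex Q"
  shows "osc lborel Q F r \<le> ennreal ((2 ^ p) ^ (DIM('a) + 2)) * osc lborel Q F (r / 2 ^ p)"
proof (induction p)
  case (Suc p)
  have "osc lborel Q F r \<le> ennreal ((2 ^ p) ^ (DIM('a) + 2)) * (ennreal (2 ^ (DIM('a) + 2)) * osc lborel Q F (r / 2 ^ p / 2))"
    by (rule order_trans[OF Suc.IH]) (intro mult_left_mono osc_halve assms, simp)
  also have "\<dots> = ennreal ((2 ^ p) ^ (DIM('a) + 2) * 2 ^ (DIM('a) + 2)) * osc lborel Q F (r / 2 ^ Suc p)"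
    by (simp only: ennreal_mult zero_le_power zero_le_numeral mult.assoc divide_divide_eq_left power_Suc mult.commute[of 2 "2 ^ p"])
  finally show ?case
    by (simp only: power_mult_distrib[symmetric] power_Suc2)
qed simp

text \<open>Halving is iterated for the least p with R/2^p \<le> \<rho>. Minimality gives 2^p \<le>
  2R/\<rho>; for p = 0 this follows from \<rho> \<le> R.\<close>

lemma osc_le_scaled:
  fixes F :: "'a::euclidean_space \<Rightarrow> real"
  assumes "F \<in> borel_measurable borel" "Q \<in> sets borel" "convex Q" and "0 < \<rho>" "\<rho> \<le> R"
  shows "osc lborel Q F R \<le> ennreal ((2 * R / \<rho>) ^ (DIM('a) + 2)) * osc lborel Q F \<rho>"
proof -
  have "\<exists>p. R / 2 ^ p \<le> \<rho>"
  proof -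
    obtain p where "R / \<rho> < 2 ^ p"
      using real_arch_pow[of 2 "R / \<rho>"] by auto
    then show ?thesis
      using \<open>0 < \<rho>\<close> by (intro exI[of _ p]) (simp add: field_simps)
  qed
  then obtain p where p: "R / 2 ^ p \<le> \<rho>" and least: "\<And>q. q < p \<Longrightarrow> \<not> R / 2 ^ q \<le> \<rho>"
    using exists_least_iff[of "\<lambda>p. R / 2 ^ p \<le> \<rho>"] by blast
  have "2 ^ p \<le> 2 * R / \<rho>"
  proof (cases p)
    case 0
    then show ?thesis using assms by (simp add: field_simps)
  next
    case (Suc q)
    then show ?thesis using least[of q] \<open>0 < \<rho>\<close> by (simp add: field_simps)
  qed
  then have "ennreal ((2 ^ p) ^ (DIM('a) + 2)) \<le> ennreal ((2 * R / \<rho>) ^ (DIM('a) + 2))"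
    by (intro ennreal_leI power_mono) auto
  then show ?thesis
    by (rule order_trans[OF osc_iterate[OF assms(1-3), of R p] mult_mono[OF _ osc_mono[OF p]]]) auto
qed

text \<open>Half-open, so that cubes of side s/m partition it exactly.\<close>

definition hcube :: "'a::euclidean_space \<Rightarrow> real \<Rightarrow> 'a set" where
  "hcube l s = {x. \<forall>b\<in>Basis. l \<bullet> b \<le> x \<bullet> b \<and> x \<bullet> b < l \<bullet> b + s}"

lemma convex_hcube: "convex (hcube l s)"
proof -
  have "hcube l s = (\<Inter>b\<in>Basis. {x. b \<bullet> x \<ge> l \<bullet> b} \<inter> {x. b \<bullet> x < l \<bullet> b + s})"
    by (auto simp: hcube_def inner_commute)
  then show ?thesis
    by (simp add: convex_INT convex_Int convex_halfspace_ge convex_halfspace_lt)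
qed

lemma borel_hcube [measurable]: "hcube l s \<in> sets borel"
proof -
  have "hcube l s = (\<Inter>b\<in>Basis. {x. l \<bullet> b \<le> x \<bullet> b} \<inter> {x. x \<bullet> b < l \<bullet> b + s})"
    by (auto simp: hcube_def)
  also have "\<dots> \<in> sets borel"
    by (intro sets.finite_INT) auto
  finally show ?thesis .
qed

lemma emeasure_hcube_ge:
  fixes l :: "'a::euclidean_space"
  assumes "0 \<le> s"
  shows "ennreal (s ^ DIM('a)) \<le> emeasure lborel (hcube l s)"
proof -
  have "ennreal (s ^ DIM('a)) = emeasure lborel (box l (l + s *\<^sub>R One))"
    using assms by (subst emeasure_lborel_box) (auto simp: algebra_simps inner_simps)
  also have "\<dots> \<le> emeasure lborel (hcube l s)"
    by (rule emeasure_mono) (auto simp: box_def hcube_def inner_simps less_imp_le)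
  finally show ?thesis .
qed

text \<open>The estimate goes through the l1 norm, hence the factor \<open>DIM('a)\<close> that
  reappears in the Poincare constants.\<close>

lemma dist_hcube_le:
  fixes x :: "'a::euclidean_space"
  assumes "x \<in> hcube l s" "y \<in> hcube l s"
  shows "dist x y \<le> s * DIM('a)"
proof -
  have "dist x y \<le> (\<Sum>b\<in>Basis. \<bar>(x - y) \<bullet> b\<bar>)"
    unfolding dist_norm by (rule norm_le_l1)
  also have "\<dots> \<le> (\<Sum>b\<in>(Basis :: 'a set). s)"
  proof (rule sum_mono)
    fix b :: 'a assume "b \<in> Basis"
    then have "l \<bullet> b \<le> x \<bullet> b" "x \<bullet> b < l \<bullet> b + s" "l \<bullet> b \<le> y \<bullet> b" "y \<bullet> b < l \<bullet> b + s"
      using assms by (auto simp: hcube_def)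
    then show "\<bar>(x - y) \<bullet> b\<bar> \<le> s" by (simp add: inner_diff_left abs_le_iff)
  qed
  finally show ?thesis by (simp add: mult.commute)
qed

text \<open>A function cannot exceed its mean everywhere on a set of positive finite measure. The
  inequality is multiplied out so that an infinite integral causes no trouble.\<close>

lemma exists_le_average:
  assumes [measurable]: "g \<in> borel_measurable M" "Q \<in> sets M"
    and Q: "emeasure M Q \<noteq> 0" "emeasure M Q \<noteq> \<infinity>"
  shows "\<exists>y\<in>Q. g y * emeasure M Q \<le> (\<integral>\<^sup>+x\<in>Q. g x \<partial>M)"
proof (rule ccontr)
  let ?I = "\<integral>\<^sup>+x\<in>Q. g x \<partial>M"
  assume "\<not> ?thesis"
  then have less: "?I < g y * emeasure M Q" if "y \<in> Q" for y
    using that by force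
  define c where "c = ?I / emeasure M Q"
  have cQ: "c * emeasure M Q = ?I"
    unfolding c_def using Q
    by (simp only: mult.commute[of "?I / _"] ennreal_times_divide mult.commute[of _ ?I] mult_divide_eq_ennreal infinity_ennreal_def not_False_eq_True)
  have "Q \<noteq> {}" using Q by auto
  then have fin: "?I < \<infinity>"
    using less by (auto simp: less_top[symmetric])
  have cg: "c < g y" if "y \<in> Q" for y
    using less[OF that] unfolding cQ[symmetric] by (meson linorder_not_less mult_right_mono zero_le)
  have int_c: "(\<integral>\<^sup>+x\<in>Q. c \<partial>M) = ?I"
    using cQ by (simp add: nn_integral_cmult_indicator)
  have "(\<integral>\<^sup>+x\<in>Q. c \<partial>M) < ?I"
  proof (rule nn_integral_less)
    show "(\<integral>\<^sup>+x\<in>Q. c \<partial>M) \<noteq> \<infinity>" using int_c fin by simp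
    show "AE x in M. c * indicator Q x \<le> g x * indicator Q x"
      using cg by (auto simp: indicator_def less_imp_le)
    show "\<not> (AE x in M. g x * indicator Q x \<le> c * indicator Q x)"
    proof
      assume "AE x in M. g x * indicator Q x \<le> c * indicator Q x"
      then have "AE x in M. x \<notin> Q"
        by eventually_elim (use cg in \<open>force simp: indicator_def\<close>)
      then show False
        using Q(1) AE_iff_null_sets[OF assms(2)] by (simp add: null_sets_def)
    qed
  qed auto
  then show False using int_c by simp
qed

text \<open>The constant is a value F y, with y chosen so that the integral of (F x - F y)^2 over x
  does not exceed its mean over y. Inside the cube a cut-off at distance \<open>s * DIM('a)\<close>
  is void, so the double integral is an \<open>osc\<close>, which \<open>osc_le_scaled\<close>
  brings down to range \<rho>. Division by the volume s^d turns s^(d+2) into s^2.\<close>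

lemma poincare_hcube:
  fixes F :: "'a::euclidean_space \<Rightarrow> real" and s \<rho> :: real
  assumes [measurable]: "F \<in> borel_measurable borel" and s: "0 < s" and \<rho>: "0 < \<rho>" "\<rho> \<le> s * DIM('a)"
  shows "\<exists>c. (\<integral>\<^sup>+x\<in>hcube l s. ennreal ((F x - c)\<^sup>2) \<partial>lborel) \<le>
    ennreal ((2 * real DIM('a)) ^ (DIM('a) + 2) * s\<^sup>2 / \<rho> ^ (DIM('a) + 2)) * osc lborel (hcube l s) F \<rho>"
proof -
  let ?Q = "hcube l s" and ?d = "DIM('a)"
  let ?g = "\<lambda>y. \<integral>\<^sup>+x\<in>?Q. ennreal ((F x - F y)\<^sup>2) \<partial>lborel"
  have Qpos: "0 < emeasure lborel ?Q"
    using s by (intro less_le_trans[OF _ emeasure_hcube_ge]) auto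
  have "?Q \<subseteq> cbox l (l + s *\<^sub>R One)"
    by (auto simp: hcube_def cbox_def inner_simps less_imp_le)
  then have "bounded ?Q"
    by (rule bounded_subset[OF bounded_cbox])
  then have Qfin: "emeasure lborel ?Q < \<infinity>"
    by (rule emeasure_bounded_finite)
  have "\<exists>y\<in>?Q. ?g y * emeasure lborel ?Q \<le> (\<integral>\<^sup>+y\<in>?Q. ?g y \<partial>lborel)"
    using Qpos Qfin by (intro exists_le_average) auto
  then obtain y where y: "?g y * emeasure lborel ?Q \<le> (\<integral>\<^sup>+y\<in>?Q. ?g y \<partial>lborel)" by blast
  have "(\<integral>\<^sup>+y\<in>?Q. ?g y \<partial>lborel) = osc lborel ?Q F (s * ?d)"
    unfolding osc_def
    by (auto simp: indicator_def power2_commute dist_commute dist_hcube_le intro!: nn_integral_cong)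
  also have "\<dots> \<le> ennreal ((2 * (s * ?d) / \<rho>) ^ (?d + 2)) * osc lborel ?Q F \<rho>"
    using \<rho> by (intro osc_le_scaled convex_hcube) auto
  finally have le: "?g y * emeasure lborel ?Q \<le> ennreal ((2 * (s * ?d) / \<rho>) ^ (?d + 2)) * osc lborel ?Q F \<rho>"
    using y by (rule order_trans[rotated])
  have sd: "ennreal ((1 / s) ^ ?d) * ennreal (s ^ ?d) = 1"
    using s by (simp add: ennreal_mult[symmetric] power_mult_distrib[symmetric] del: ennreal_power)
  have "?g y = ennreal ((1 / s) ^ ?d) * (?g y * ennreal (s ^ ?d))"
    using sd by (simp only: mult.left_commute[of _ "?g y"] mult_1_right)
  also have "\<dots> \<le> ennreal ((1 / s) ^ ?d) * (?g y * emeasure lborel ?Q)"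
    using s by (intro mult_left_mono emeasure_hcube_ge) auto
  also have "\<dots> \<le> ennreal ((1 / s) ^ ?d) * (ennreal ((2 * (s * ?d) / \<rho>) ^ (?d + 2)) * osc lborel ?Q F \<rho>)"
    by (intro mult_left_mono le) auto
  also have "\<dots> = ennreal ((1 / s) ^ ?d * (2 * (s * ?d) / \<rho>) ^ (?d + 2)) * osc lborel ?Q F \<rho>"
    using s \<rho> by (subst ennreal_mult) (auto simp: mult.assoc)
  also have "(1 / s) ^ ?d * (2 * (s * ?d) / \<rho>) ^ (?d + 2) = (2 * real ?d) ^ (?d + 2) * s\<^sup>2 / \<rho> ^ (?d + 2)"
    using s \<rho> by (simp add: power_divide power_mult_distrib power_add power2_eq_square field_simps)
  finally show ?thesis by blast
qed

definition cell :: "'a::euclidean_space \<Rightarrow> real \<Rightarrow> nat \<Rightarrow> ('a \<Rightarrow> nat) \<Rightarrow> 'a set" where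
  "cell l s m k = hcube (l + (\<Sum>b\<in>Basis. (real (k b) * (s / m)) *\<^sub>R b)) (s / m)"

text \<open>Extensional functions: the index is fixed outside \<open>Basis\<close>, so that a cell
  determines its index.\<close>

abbreviation cells :: "nat \<Rightarrow> ('a::euclidean_space \<Rightarrow> nat) set" where
  "cells m \<equiv> PiE Basis (\<lambda>_. {..<m})"

text \<open>Integer parts reduce disjointness and covering of the cells to arithmetic.\<close>

lemma mem_cell:
  fixes l :: "'a::euclidean_space"
  assumes "0 < s" "0 < m"
  shows "x \<in> cell l s m k \<longleftrightarrow> (\<forall>b\<in>Basis. \<lfloor>(x \<bullet> b - l \<bullet> b) * (m / s)\<rfloor> = int (k b))"
proof -
  have "(l \<bullet> b + real (k b) * (s / m) \<le> x \<bullet> b \<and> x \<bullet> b < l \<bullet> b + real (k b) * (s / m) + s / m) \<longleftrightarrow>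
     \<lfloor>(x \<bullet> b - l \<bullet> b) * (m / s)\<rfloor> = int (k b)" for b
    unfolding floor_eq_iff using assms by (auto simp: field_simps)
  then show ?thesis
    by (simp add: cell_def hcube_def inner_simps inner_sum_left inner_Basis if_distrib cong: if_cong)
qed

lemma hcube_eq_Union_cells:
  fixes l :: "'a::euclidean_space"
  assumes s: "0 < s" and m: "0 < m"
  shows "hcube l s = (\<Union>k\<in>cells m. cell l s m k)"
proof (intro equalityI subsetI)
  fix x assume x: "x \<in> hcube l s"
  define k where "k = restrict (\<lambda>b. nat \<lfloor>(x \<bullet> b - l \<bullet> b) * (m / s)\<rfloor>) (Basis :: 'a set)"
  have rng: "0 \<le> (x \<bullet> b - l \<bullet> b) * (m / s)" "(x \<bullet> b - l \<bullet> b) * (m / s) < m" if "b \<in> Basis" for b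
  proof -
    have "0 \<le> x \<bullet> b - l \<bullet> b" "x \<bullet> b - l \<bullet> b < s"
      using x that by (auto simp: hcube_def)
    then show "0 \<le> (x \<bullet> b - l \<bullet> b) * (m / s)"
      using s by simp
    have "(x \<bullet> b - l \<bullet> b) * (m / s) < s * (m / s)"
      by (rule mult_strict_right_mono) (use \<open>x \<bullet> b - l \<bullet> b < s\<close> s m in simp_all)
    then show "(x \<bullet> b - l \<bullet> b) * (m / s) < m"
      using s by simp
  qed
  have "k \<in> cells m"
    using rng by (auto simp: k_def nat_less_iff floor_less_iff)
  moreover have "x \<in> cell l s m k"
    using rng by (auto simp: mem_cell[OF s m] k_def)
  ultimately show "x \<in> (\<Union>k\<in>cells m. cell l s m k)" by blast
next
  fix x assume "x \<in> (\<Union>k\<in>cells m. cell l s m k)"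
  then obtain k where k: "k \<in> cells m" "x \<in> cell l s m k" by blast
  show "x \<in> hcube l s"
    unfolding hcube_def
  proof (intro CollectI ballI)
    fix b :: 'a assume b: "b \<in> Basis"
    then have "\<lfloor>(x \<bullet> b - l \<bullet> b) * (m / s)\<rfloor> = int (k b)" "k b < m"
      using k by (auto simp: mem_cell[OF s m])
    then have "0 \<le> (x \<bullet> b - l \<bullet> b) * (m / s)" "(x \<bullet> b - l \<bullet> b) * (m / s) < m"
      by (auto simp: floor_eq_iff)
    moreover from this have "(x \<bullet> b - l \<bullet> b) < real m / (m / s)"
      using s m by (subst pos_less_divide_eq) simp_all
    ultimately show "l \<bullet> b \<le> x \<bullet> b \<and> x \<bullet> b < l \<bullet> b + s"
      using s m by (auto simp: zero_le_mult_iff zero_le_divide_iff)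
  qed
qed

lemma cell_disjoint:
  assumes "0 < s" "0 < m" "k \<in> cells m" "k' \<in> cells m" "x \<in> cell l s m k" "x \<in> cell l s m k'"
  shows "k = k'"
  using assms by (intro PiE_ext[of k Basis _ k']) (auto simp: mem_cell)

lemma finite_cells: "finite (cells m)"
  by (intro finite_PiE) auto

text \<open>A pair of points counts at most once, namely when some cell contains both, so the
  oscillations of the disjoint cells add up to at most that of the cube. For fixed \<rho> the
  constant gains a factor 1/m^2; this gain is what makes step functions approximate well.\<close>

lemma poincare_cells:
  fixes F :: "'a::euclidean_space \<Rightarrow> real" and s \<rho> :: real
  assumes [measurable]: "F \<in> borel_measurable borel" and s: "0 < s" and m: "0 < m"
    and \<rho>: "0 < \<rho>" "\<rho> \<le> s / m * DIM('a)"
  shows "\<exists>c. (\<Sum>k\<in>cells m. \<integral>\<^sup>+x\<in>cell l s m k. ennreal ((F x - c k)\<^sup>2) \<partial>lborel) \<le>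
    ennreal ((2 * real DIM('a)) ^ (DIM('a) + 2) * (s / m)\<^sup>2 / \<rho> ^ (DIM('a) + 2)) * osc lborel (hcube l s) F \<rho>"
proof -
  let ?C = "ennreal ((2 * real DIM('a)) ^ (DIM('a) + 2) * (s / m)\<^sup>2 / \<rho> ^ (DIM('a) + 2))"
  have "\<forall>k. \<exists>c. (\<integral>\<^sup>+x\<in>cell l s m k. ennreal ((F x - c)\<^sup>2) \<partial>lborel) \<le> ?C * osc lborel (cell l s m k) F \<rho>"
    unfolding cell_def using s m \<rho> by (intro allI poincare_hcube) auto
  from choice[OF this] obtain c where
    c: "\<And>k. (\<integral>\<^sup>+x\<in>cell l s m k. ennreal ((F x - c k)\<^sup>2) \<partial>lborel) \<le> ?C * osc lborel (cell l s m k) F \<rho>"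
    by blast
  have [measurable]: "cell l s m k \<in> sets borel" for k
    unfolding cell_def by measurable
  have "(\<Sum>k\<in>cells m. osc lborel (cell l s m k) F \<rho>) =
    (\<integral>\<^sup>+x. \<integral>\<^sup>+y. (\<Sum>k\<in>cells m. ennreal ((F x - F y)\<^sup>2) *
        (indicator (cell l s m k) x * indicator (cell l s m k) y * indicator {..\<rho>} (dist x y))) \<partial>lborel \<partial>lborel)"
    unfolding osc_def by (simp add: nn_integral_sum)
  also have "\<dots> \<le> osc lborel (hcube l s) F \<rho>"
    unfolding osc_def
  proof (intro nn_integral_mono)
    fix x y
    show "(\<Sum>k\<in>cells m. ennreal ((F x - F y)\<^sup>2) * (indicator (cell l s m k) x * indicator (cell l s m k) y * indicator {..\<rho>} (dist x y)))
      \<le> ennreal ((F x - F y)\<^sup>2) * (indicator (hcube l s) x * indicator (hcube l s) y * indicator {..\<rho>} (dist x y))"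
    proof (cases "\<exists>k\<in>cells m. x \<in> cell l s m k \<and> y \<in> cell l s m k")
      case True
      then obtain k where k: "k \<in> cells m" "x \<in> cell l s m k" "y \<in> cell l s m k" by blast
      have "(\<Sum>k'\<in>cells m. ennreal ((F x - F y)\<^sup>2) * (indicator (cell l s m k') x * indicator (cell l s m k') y * indicator {..\<rho>} (dist x y)))
         = (\<Sum>k'\<in>{k}. ennreal ((F x - F y)\<^sup>2) * (indicator (cell l s m k') x * indicator (cell l s m k') y * indicator {..\<rho>} (dist x y)))"
      proof (rule sum.mono_neutral_right[OF finite_cells])
        show "{k} \<subseteq> cells m" using k(1) by simp
        show "\<forall>k'\<in>cells m - {k}. ennreal ((F x - F y)\<^sup>2) * (indicator (cell l s m k') x * indicator (cell l s m k') y * indicator {..\<rho>} (dist x y)) = 0"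
        proof
          fix k' assume "k' \<in> cells m - {k}"
          then have "x \<notin> cell l s m k'"
            using cell_disjoint[OF s m k(1) _ k(2)] by auto
          then show "ennreal ((F x - F y)\<^sup>2) * (indicator (cell l s m k') x * indicator (cell l s m k') y * indicator {..\<rho>} (dist x y)) = 0"
            by simp
        qed
      qed
      also have "\<dots> \<le> ennreal ((F x - F y)\<^sup>2) * (indicator (hcube l s) x * indicator (hcube l s) y * indicator {..\<rho>} (dist x y))"
      proof -
        have "x \<in> hcube l s" "y \<in> hcube l s"
          using k hcube_eq_Union_cells[OF s m, of l] by blast+
        then show ?thesis using k by simp
      qed
      finally show ?thesis .
    next
      case False
      then have "(\<Sum>k'\<in>cells m. ennreal ((F x - F y)\<^sup>2) * (indicator (cell l s m k') x * indicator (cell l s m k') y * indicator {..\<rho>} (dist x y))) = 0"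
        by (intro sum.neutral ballI) (simp add: indicator_def)
      then show ?thesis by simp
    qed
  qed
  finally have "?C * (\<Sum>k\<in>cells m. osc lborel (cell l s m k) F \<rho>) \<le> ?C * osc lborel (hcube l s) F \<rho>"
    by (rule mult_left_mono) simp
  moreover have "(\<Sum>k\<in>cells m. \<integral>\<^sup>+x\<in>cell l s m k. ennreal ((F x - c k)\<^sup>2) \<partial>lborel) \<le>
      ?C * (\<Sum>k\<in>cells m. osc lborel (cell l s m k) F \<rho>)"
    unfolding sum_distrib_left by (intro sum_mono c)
  ultimately show ?thesis
    by (intro exI[of _ c]) (rule order_trans)
qed

section \<open>Volume charts of compact submanifolds\<close>

lemma has_derivative_cong_open:
  assumes "open S" "x \<in> S" "\<And>y. y \<in> S \<Longrightarrow> f y = g y"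
  shows "(f has_derivative D) (at x) \<longleftrightarrow> (g has_derivative D) (at x)"
  using assms
  by (auto intro: has_derivative_transform_within_open[of f D x UNIV S g]
      has_derivative_transform_within_open[of g D x UNIV S f])

lemma Ck_on_cong:
  assumes "open S" "\<And>x. x \<in> S \<Longrightarrow> f x = g x"
  shows "Ck_on k f S \<longleftrightarrow> Ck_on k g S"
  using assms(2)
proof (induction k arbitrary: f g)
  case 0
  then show ?case by (auto intro: continuous_on_cong)
next
  case (Suc k)
  have D: "(f has_derivative D) (at x) \<longleftrightarrow> (g has_derivative D) (at x)" if "x \<in> S" for x D
    using has_derivative_cong_open[OF assms(1) that Suc.prems] .
  then have "frechet_derivative f (at x) = frechet_derivative g (at x)" if "x \<in> S" for x
    unfolding frechet_derivative_def using that by simp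
  then have "Ck_on k (\<lambda>x. frechet_derivative f (at x) v) S \<longleftrightarrow> Ck_on k (\<lambda>x. frechet_derivative g (at x) v) S" for v
    by (intro Suc.IH) simp
  moreover have "f differentiable_on S \<longleftrightarrow> g differentiable_on S"
    using D by (simp add: differentiable_on_eq_differentiable_at[OF assms(1)] differentiable_def)
  ultimately show ?case by simp
qed

text \<open>By the chain rule the derivative of f o T in direction v is again a composite with
  \<open>T\<close>, namely of the derivative of f in the direction T v. The induction therefore runs
  over arbitrary \<open>f\<close>.\<close>

lemma Ck_on_compose_linear:
  fixes T :: "'a::euclidean_space \<Rightarrow> 'b::euclidean_space" and f :: "'b \<Rightarrow> 'c::real_normed_vector"
  assumes S: "open S" and T: "linear T" and "Ck_on k f S"
  shows "Ck_on k (\<lambda>x. f (T x)) (T -` S)"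
  using assms(3)
proof (induction k arbitrary: f)
  case 0
  then show ?case
    using linear_continuous_on[of T] T
    by (auto intro!: continuous_on_compose2[of S f] simp: linear_conv_bounded_linear)
next
  case (Suc k)
  have open_TS: "open (T -` S)"
    using S linear_continuous_on[of T UNIV] T by (auto intro: open_vimage simp: linear_conv_bounded_linear)
  have D: "((\<lambda>x. f (T x)) has_derivative (\<lambda>v. frechet_derivative f (at (T x)) (T v))) (at x)" if "x \<in> T -` S" for x
  proof -
    have "(f has_derivative frechet_derivative f (at (T x))) (at (T x))"
      using Suc.prems that by (simp add: differentiable_on_eq_differentiable_at[OF S] frechet_derivative_works)
    then show ?thesis
      using has_derivative_compose[of T T x UNIV] linear_imp_has_derivative[OF T] by blast
  qed
  have eq: "frechet_derivative (\<lambda>x. f (T x)) (at x) v = frechet_derivative f (at (T x)) (T v)" if "x \<in> T -` S" for x v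
    by (simp only: frechet_derivative_at[OF D[OF that], symmetric])
  have "(\<lambda>x. f (T x)) differentiable_on T -` S"
    using D by (auto simp: differentiable_on_eq_differentiable_at[OF open_TS] differentiable_def)
  moreover have "Ck_on k (\<lambda>x. frechet_derivative (\<lambda>x. f (T x)) (at x) v) (T -` S)" for v
  proof -
    have "Ck_on k (\<lambda>x. frechet_derivative f (at (T x)) (T v)) (T -` S)"
      using Suc.prems by (intro Suc.IH) simp
    then show ?thesis
      using Ck_on_cong[OF open_TS, of "\<lambda>x. frechet_derivative (\<lambda>x. f (T x)) (at x) v"] eq by simp
  qed
  ultimately show ?case by simp
qed

text \<open>Partial derivatives are bounded on a compact ball by continuity; the sum of their bounds
  controls the operator norm, and convexity of the ball permits the mean value inequality.\<close>

lemma C1_locally_lipschitz: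
  fixes f :: "'a::euclidean_space \<Rightarrow> 'b::real_normed_vector"
  assumes S: "open S" "x \<in> S" and f: "Ck_on (Suc 0) f S"
  obtains t L where "0 < t" "0 < L" "cball x t \<subseteq> S"
    "\<And>y z. y \<in> cball x t \<Longrightarrow> z \<in> cball x t \<Longrightarrow> dist (f y) (f z) \<le> L * dist y z"
proof -
  obtain t where t: "0 < t" "cball x t \<subseteq> S"
    using S open_contains_cball by blast
  have D: "(f has_derivative frechet_derivative f (at y)) (at y)" if "y \<in> S" for y
    using f that by (simp add: differentiable_on_eq_differentiable_at[OF S(1)] frechet_derivative_works)
  have "\<forall>b. \<exists>B. \<forall>y\<in>cball x t. norm (frechet_derivative f (at y) b) \<le> B"
  proof
    fix b
    have "continuous_on (cball x t) (\<lambda>y. frechet_derivative f (at y) b)"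
      using f t by (auto intro: continuous_on_subset)
    then have "bounded ((\<lambda>y. frechet_derivative f (at y) b) ` cball x t)"
      by (intro compact_imp_bounded compact_continuous_image) auto
    then show "\<exists>B. \<forall>y\<in>cball x t. norm (frechet_derivative f (at y) b) \<le> B"
      unfolding bounded_iff by auto
  qed
  from choice[OF this] obtain B where
    B: "\<And>b y. y \<in> cball x t \<Longrightarrow> norm (frechet_derivative f (at y) b) \<le> B b"
    by blast
  define L where "L = (\<Sum>b\<in>(Basis :: 'a set). \<bar>B b\<bar>) + 1"
  have "0 < L"
    unfolding L_def by (intro add_nonneg_pos sum_nonneg) auto
  have "norm (f y - f z) \<le> L * norm (y - z)" if "y \<in> cball x t" "z \<in> cball x t" for y z
  proof (rule differentiable_bound[where f'="\<lambda>y. frechet_derivative f (at y)", OF convex_cball _ _ that])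
    fix y assume y: "y \<in> cball x t"
    then have yS: "y \<in> S" using t(2) by blast
    show "(f has_derivative frechet_derivative f (at y)) (at y within cball x t)"
      by (rule has_derivative_at_withinI[OF D[OF yS]])
    have lin: "linear (frechet_derivative f (at y))"
      by (rule has_derivative_linear[OF D[OF yS]])
    show "onorm (frechet_derivative f (at y)) \<le> L"
    proof (rule onorm_le)
      fix v :: 'a
      have "norm (frechet_derivative f (at y) v) = norm (\<Sum>b\<in>Basis. (v \<bullet> b) *\<^sub>R frechet_derivative f (at y) b)"
        using linear_sum[OF lin, of "\<lambda>b. (v \<bullet> b) *\<^sub>R b" Basis]
        by (simp only: euclidean_representation linear_cmul[OF lin])
      also have "\<dots> \<le> (\<Sum>b\<in>Basis. norm v * \<bar>B b\<bar>)"
      proof (rule order_trans[OF norm_sum sum_mono])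
        fix b :: 'a assume "b \<in> Basis"
        then show "norm ((v \<bullet> b) *\<^sub>R frechet_derivative f (at y) b) \<le> norm v * \<bar>B b\<bar>"
          using B[OF y, of b] mult_mono[OF Basis_le_norm[of b v], of "norm (frechet_derivative f (at y) b)" "\<bar>B b\<bar>"]
          by simp
      qed
      also have "\<dots> \<le> L * norm v"
        unfolding L_def sum_distrib_left[symmetric] mult.commute[of _ "norm v"]
        by (intro mult_left_mono) auto
      finally show "norm (frechet_derivative f (at y) v) \<le> L * norm v" .
    qed
  qed
  then show ?thesis
    by (intro that[OF t(1) \<open>0 < L\<close> t(2)]) (simp add: dist_norm)
qed

lemma continuous_on_det:
  fixes A :: "'a::topological_space \<Rightarrow> real^'n^'n"
  assumes "\<And>i j. continuous_on S (\<lambda>x. A x $ i $ j)"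
  shows "continuous_on S (\<lambda>x. det (A x))"
  unfolding det_def by (intro continuous_intros assms)

text \<open>Along the segment from the identity to \<open>A\<close> the quadratic form stays
  positive, so no matrix on it is singular. A nonpositive determinant at the end would force a zero
  on the way, by the intermediate value theorem.\<close>

lemma det_pos_of_pos_definite:
  fixes A :: "real^'n^'n"
  assumes A: "\<And>v. v \<noteq> 0 \<Longrightarrow> 0 < v \<bullet> (A *v v)"
  shows "0 < det A"
proof (rule ccontr)
  assume neg: "\<not> 0 < det A"
  define B where "B t = (1 - t) *\<^sub>R mat 1 + t *\<^sub>R A" for t
  have "continuous_on {0..1} (\<lambda>t. det (B t))"
    unfolding B_def by (intro continuous_on_det) (auto intro!: continuous_intros)
  then have "\<exists>t\<ge>0. t \<le> 1 \<and> det (B t) = 0"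
    using neg by (intro IVT2') (auto simp: B_def)
  then obtain t where t: "0 \<le> t" "t \<le> 1" "det (B t) = 0" by blast
  then have "\<not> invertible (B t)"
    by (simp add: invertible_det_nz)
  then have "\<not> inj ((*v) (B t))"
    using invertible_left_inverse matrix_left_invertible_injective by blast
  then obtain v where v: "v \<noteq> 0" "B t *v v = 0"
    by (metis matrix_left_invertible_injective matrix_left_invertible_ker)
  have "v \<bullet> (B t *v v) = (1 - t) * (v \<bullet> v) + t * (v \<bullet> (A *v v))"
    by (simp add: B_def matrix_vector_mult_add_rdistrib inner_add_right scaleR_matrix_vector_assoc[symmetric])
  also have "\<dots> > 0"
  proof (cases "t = 0")
    case False
    then show ?thesis using t A[OF v(1)] by (intro add_nonneg_pos) auto
  qed (use v in simp)
  finally show False using v by simp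
qed

text \<open>The metric matrix is the Gram matrix of the columns of the derivative D, so its
  quadratic form at v is |D v|^2.\<close>

lemma det_metric_matrix_pos:
  fixes \<psi> :: "real^'d::finite \<Rightarrow> 'a::euclidean_space"
  assumes lin: "linear (frechet_derivative \<psi> (at x))" and inj: "inj (frechet_derivative \<psi> (at x))"
  shows "0 < det (metric_matrix \<psi> x)"
proof (rule det_pos_of_pos_definite)
  let ?D = "frechet_derivative \<psi> (at x)"
  fix v :: "real^'d" assume "v \<noteq> 0"
  then have "?D v \<noteq> 0"
    using inj lin by (metis linear_0 injD)
  have Dv: "?D v = (\<Sum>i\<in>UNIV. v $ i *\<^sub>R ?D (axis i 1))"
  proof -
    have "?D (\<Sum>i\<in>UNIV. v $ i *\<^sub>R axis i 1) = (\<Sum>i\<in>UNIV. v $ i *\<^sub>R ?D (axis i 1))"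
      by (simp only: linear_sum[OF lin] linear_cmul[OF lin])
    moreover have "(\<Sum>i\<in>UNIV. v $ i *\<^sub>R axis i 1) = v"
      using basis_expansion[of v] by (simp add: scalar_mult_eq_scaleR)
    ultimately show ?thesis by simp
  qed
  have "v \<bullet> (metric_matrix \<psi> x *v v) = (\<Sum>i\<in>UNIV. v $ i * (\<Sum>j\<in>UNIV. (?D (axis i 1) \<bullet> ?D (axis j 1)) * v $ j))"
    by (simp add: inner_vec_def matrix_vector_mult_def metric_matrix_def)
  also have "\<dots> = ?D v \<bullet> ?D v"
    by (subst (1 2) Dv) (simp add: inner_sum_left inner_sum_right sum_distrib_left mult_ac inner_commute)
  finally show "0 < v \<bullet> (metric_matrix \<psi> x *v v)"
    using \<open>?D v \<noteq> 0\<close> by simp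
qed

text \<open>All that the analysis takes from a chart, freed from smoothness: bi-Lipschitz bounds, a
  continuous density between 1/L and L, a derivative at each point, a relatively open image, and the
  change of variables. One constant \<open>L\<close> serves every bound. \<open>\<psi>\<close> and
  \<open>J\<close> are Borel on the whole parameter space, so that integrands built from them are
  measurable without restricting domains.\<close>

definition vol_chart :: "'a::euclidean_space measure \<Rightarrow> 'a set \<Rightarrow> 'b::euclidean_space set \<Rightarrow>
    ('b \<Rightarrow> 'a) \<Rightarrow> ('b \<Rightarrow> real) \<Rightarrow> real \<Rightarrow> bool" where
  "vol_chart \<nu> M \<Omega> \<psi> J L \<longleftrightarrow>
     0 < L \<and> open \<Omega> \<and> \<psi> \<in> borel_measurable borel \<and> J \<in> borel_measurable borel \<and>
     (\<forall>a\<in>\<Omega>. \<forall>b\<in>\<Omega>. dist a b \<le> L * dist (\<psi> a) (\<psi> b) \<and> dist (\<psi> a) (\<psi> b) \<le> L * dist a b) \<and>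
     (\<forall>a\<in>\<Omega>. 1 / L \<le> J a \<and> J a \<le> L) \<and> continuous_on \<Omega> J \<and>
     (\<forall>a\<in>\<Omega>. \<exists>D. (\<psi> has_derivative D) (at a)) \<and>
     (\<exists>U. open U \<and> \<psi> ` \<Omega> = M \<inter> U) \<and>
     (\<forall>g\<in>borel_measurable borel.
        (\<integral>\<^sup>+x\<in>\<psi> ` \<Omega>. g x \<partial>\<nu>) = (\<integral>\<^sup>+a\<in>\<Omega>. g (\<psi> a) * ennreal (J a) \<partial>lborel))"

text \<open>\<open>\<nu>\<close> lives on the Borel sets of the ambient space and is concentrated on
  \<open>M\<close>, so that measures of two manifolds share one \<sigma>-algebra. The dimension is
  carried by the type \<open>'b\<close>.\<close>

definition charted :: "'b::euclidean_space itself \<Rightarrow> 'a::euclidean_space measure \<Rightarrow> 'a set \<Rightarrow> bool" where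
  "charted _ \<nu> M \<longleftrightarrow> compact M \<and> finite_measure \<nu> \<and> sets \<nu> = sets borel \<and> emeasure \<nu> (- M) = 0 \<and>
     (\<forall>x\<in>M. \<exists>\<Omega> (\<psi> :: 'b \<Rightarrow> 'a) J L a. vol_chart \<nu> M \<Omega> \<psi> J L \<and> a \<in> \<Omega> \<and> \<psi> a = x)"

lemma charted_AE:
  assumes "charted TYPE('b::euclidean_space) \<nu> M"
  shows "AE x in \<nu>. x \<in> M"
proof -
  have M: "compact M" "sets \<nu> = sets borel" "emeasure \<nu> (- M) = 0"
    using assms unfolding charted_def by auto
  then show ?thesis
    using borel_compact[OF M(1)] by (intro AE_I[of _ _ "- M"]) auto
qed

text \<open>A linear isometry T of R^d onto the slice W turns the inverse slice chart into the
  parametrization \<psi> o T, with inverse P o \<phi>. Its derivative is injective because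
  differentiating \<phi> o (\<psi> o T) = T gives the injective map T. The expansion bound holds
  after shrinking to the part mapped into a ball around x on which \<phi> is Lipschitz, as T
  preserves distances.\<close>

lemma slice_chart_parametrization:
  fixes M :: "'a::euclidean_space set"
  assumes M: "smooth_submanifold CARD('d::finite) M" and x: "x \<in> M"
  obtains \<Omega> and \<psi> :: "real^'d \<Rightarrow> 'a" and a K where
    "local_parametrization M \<Omega> \<psi>" "a \<in> \<Omega>" "\<psi> a = x" "0 < K"
    "\<And>b c. b \<in> \<Omega> \<Longrightarrow> c \<in> \<Omega> \<Longrightarrow> dist b c \<le> K * dist (\<psi> b) (\<psi> c)"
proof -
  obtain U V \<phi> \<psi> W where U: "x \<in> U" and diffeo: "smooth_diffeomorphism U V \<phi> \<psi>"
    and W: "subspace (W :: 'a set)" "dim W = CARD('d)" and slice: "\<phi> ` (U \<inter> M) = V \<inter> W"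
    using M x unfolding smooth_submanifold_def by metis
  have open_UV: "open U" "open V" and smooth: "smooth_on \<phi> U" "smooth_on \<psi> V"
    and maps: "\<phi> ` U = V" "\<psi> ` V = U" and inverse: "\<And>y. y \<in> U \<Longrightarrow> \<psi> (\<phi> y) = y" "\<And>y. y \<in> V \<Longrightarrow> \<phi> (\<psi> y) = y"
    using diffeo unfolding smooth_diffeomorphism_def by auto
  have "dim (UNIV :: (real^'d) set) = dim W" using W by simp
  then obtain T :: "real^'d \<Rightarrow> 'a" and P where T: "linear T" "linear P" "range T = W"
    and normT: "\<And>v. norm (T v) = norm v" and PT: "\<And>v. P (T v) = v" and TP: "\<And>w. w \<in> W \<Longrightarrow> T (P w) = w"
    using isometries_subspaces[OF subspace_UNIV W(1)] by (metis UNIV_I)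
  have distT: "dist (T b) (T c) = dist b c" for b c
    using normT[of "b - c"] by (simp add: dist_norm linear_diff[OF T(1)])
  have contT: "continuous_on S T" and contP: "continuous_on S' P" for S S'
    using T linear_continuous_on by (auto simp: linear_conv_bounded_linear)
  obtain t L where t: "0 < t" "0 < L" "cball x t \<subseteq> U"
    and lip: "\<And>y z. y \<in> cball x t \<Longrightarrow> z \<in> cball x t \<Longrightarrow> dist (\<phi> y) (\<phi> z) \<le> L * dist y z"
    using C1_locally_lipschitz[OF open_UV(1) U, of \<phi>] smooth(1) unfolding smooth_on_def by metis
  define \<Omega>0 where "\<Omega>0 = T -` V"
  define \<Psi> where "\<Psi> b = \<psi> (T b)" for b
  have \<phi>\<Psi>: "\<phi> (\<Psi> b) = T b" if "b \<in> \<Omega>0" for b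
    using that inverse by (simp add: \<Omega>0_def \<Psi>_def)
  have open0: "open \<Omega>0"
    unfolding \<Omega>0_def using open_UV(2) contT by (rule open_vimage)
  have smooth0: "smooth_on \<Psi> \<Omega>0"
    using smooth(2) Ck_on_compose_linear[OF open_UV(2) T(1)] unfolding smooth_on_def \<Omega>0_def \<Psi>_def by auto
  have cont0: "continuous_on \<Omega>0 \<Psi>"
    using smooth0 unfolding smooth_on_def by (metis Ck_on.simps(1))
  have image0: "\<Psi> ` \<Omega>0 = U \<inter> M"
  proof (intro equalityI subsetI)
    fix y assume "y \<in> \<Psi> ` \<Omega>0"
    then obtain b where b: "b \<in> \<Omega>0" "y = \<Psi> b" by blast
    then have "T b \<in> \<phi> ` (U \<inter> M)"
      using T(3) unfolding slice by (auto simp: \<Omega>0_def)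
    then show "y \<in> U \<inter> M"
      using b inverse by (auto simp: \<Psi>_def)
  next
    fix y assume y: "y \<in> U \<inter> M"
    then have "\<phi> y \<in> V \<inter> W" using slice by blast
    then show "y \<in> \<Psi> ` \<Omega>0"
      using y inverse TP by (intro image_eqI[of _ _ "P (\<phi> y)"]) (auto simp: \<Psi>_def \<Omega>0_def)
  qed
  have cont\<phi>: "continuous_on U \<phi>"
    using smooth(1) unfolding smooth_on_def by (metis Ck_on.simps(1))
  have homeo0: "homeomorphism \<Omega>0 (\<Psi> ` \<Omega>0) \<Psi> (\<lambda>y. P (\<phi> y))"
  proof
    show "continuous_on (\<Psi> ` \<Omega>0) (\<lambda>y. P (\<phi> y))"
      unfolding image0 using cont\<phi> by (intro continuous_on_compose2[OF contP[of UNIV]] continuous_on_subset[OF cont\<phi>]) auto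
  qed (use cont0 \<phi>\<Psi> PT in auto)
  define \<Omega> where "\<Omega> = \<Omega>0 \<inter> \<Psi> -` ball x t"
  define a where "a = P (\<phi> x)"
  have Ta: "T a = \<phi> x"
    unfolding a_def using slice U x by (intro TP) blast
  have a: "a \<in> \<Omega>" "\<Psi> a = x"
    using U maps t inverse by (auto simp: \<Omega>_def \<Omega>0_def \<Psi>_def Ta)
  have open_\<Omega>: "open \<Omega>"
    unfolding \<Omega>_def by (rule continuous_open_preimage[OF cont0 open0]) simp
  have sub: "\<Omega> \<subseteq> \<Omega>0" by (auto simp: \<Omega>_def)
  have smooth_\<Omega>: "smooth_on \<Psi> \<Omega>"
  proof -
    have "Ck_on k f \<Omega>" if "Ck_on k f \<Omega>0" for k and f :: "real^'d \<Rightarrow> 'a"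
      using that
    proof (induction k arbitrary: f)
      case 0
      then show ?case using sub by (auto intro: continuous_on_subset)
    next
      case (Suc k)
      then show ?case using sub by (auto intro: differentiable_on_subset)
    qed
    then show ?thesis using smooth0 unfolding smooth_on_def by blast
  qed
  have inj_D: "inj (frechet_derivative \<Psi> (at b))" if b: "b \<in> \<Omega>" for b
  proof -
    have b0: "b \<in> \<Omega>0" using b sub by blast
    have "Ck_on (Suc 0) \<Psi> \<Omega>0" "Ck_on (Suc 0) \<phi> U"
      using smooth0 smooth(1) unfolding smooth_on_def by blast+
    then have "\<Psi> differentiable (at b)" "\<phi> differentiable (at (\<Psi> b))"
      using b0 image0 by (auto simp: differentiable_on_eq_differentiable_at open0 open_UV)
    then have "((\<lambda>c. \<phi> (\<Psi> c)) has_derivative (\<lambda>v. frechet_derivative \<phi> (at (\<Psi> b)) (frechet_derivative \<Psi> (at b) v))) (at b)"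
      unfolding frechet_derivative_works by (intro has_derivative_compose[of \<Psi> _ b UNIV \<phi>])
    then have "(T has_derivative (\<lambda>v. frechet_derivative \<phi> (at (\<Psi> b)) (frechet_derivative \<Psi> (at b) v))) (at b)"
      using has_derivative_cong_open[OF open0 b0, of "\<lambda>c. \<phi> (\<Psi> c)" T] \<phi>\<Psi> by simp
    then have "(\<lambda>v. frechet_derivative \<phi> (at (\<Psi> b)) (frechet_derivative \<Psi> (at b) v)) = T"
      using has_derivative_unique linear_imp_has_derivative[OF T(1)] by blast
    then show ?thesis
      by (intro injI) (metis PT)
  qed
  have openin: "openin (top_of_set M) (\<Psi> ` \<Omega>)"
  proof -
    have "openin (top_of_set (\<Psi> ` \<Omega>0)) (\<Psi> ` \<Omega>)"
      using homeomorphism_imp_open_map[OF homeo0] open_\<Omega> sub by (simp add: openin_open_eq open0)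
    moreover have "openin (top_of_set M) (\<Psi> ` \<Omega>0)"
      unfolding image0 using open_UV(1) by (simp add: openin_open_Int Int_commute[of U])
    ultimately show ?thesis by (rule openin_trans)
  qed
  have "homeomorphism \<Omega> (\<Psi> ` \<Omega>) \<Psi> (\<lambda>y. P (\<phi> y))"
    using homeomorphism_of_subsets[OF homeo0 sub] by blast
  then have "local_parametrization M \<Omega> \<Psi>"
    unfolding local_parametrization_def using open_\<Omega> smooth_\<Omega> inj_D openin by blast
  moreover have "dist b c \<le> L * dist (\<Psi> b) (\<Psi> c)" if "b \<in> \<Omega>" "c \<in> \<Omega>" for b c
  proof -
    have "dist (\<phi> (\<Psi> b)) (\<phi> (\<Psi> c)) \<le> L * dist (\<Psi> b) (\<Psi> c)"
      using that by (intro lip) (auto simp: \<Omega>_def)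
    then show ?thesis using that \<phi>\<Psi> sub distT by (simp add: subset_iff)
  qed
  ultimately show ?thesis
    using that[of \<Omega> \<Psi> a L] a t(2) by blast
qed

lemma homeomorphism_image_openin_subset:
  assumes "homeomorphism \<Omega> (\<psi> ` \<Omega>) \<psi> \<phi>" "openin (top_of_set M) (\<psi> ` \<Omega>)" "open \<Omega>" "open B" "B \<subseteq> \<Omega>"
  obtains U where "open U" "\<psi> ` B = M \<inter> U"
proof -
  have "openin (top_of_set (\<psi> ` \<Omega>)) (\<psi> ` B)"
    using homeomorphism_imp_open_map[OF assms(1)] assms by (simp add: openin_open_eq)
  then have "openin (top_of_set M) (\<psi> ` B)"
    using assms(2) openin_trans by blast
  then show ?thesis
    using that unfolding openin_open by blast
qed

text \<open>On a small closed ball around the parameter of x the parametrization is Lipschitz, and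
  the volume density sqrt(det g), being continuous and positive, attains positive extrema
  there.\<close>

lemma vol_chart_exists:
  fixes M :: "'a::euclidean_space set"
  assumes "compact M" and M: "smooth_submanifold CARD('d::finite) M" and V: "is_volume_measure TYPE('d) M V"
    and x: "x \<in> M"
  obtains \<Omega> and \<psi> :: "real^'d \<Rightarrow> 'a" and J L a where
    "vol_chart (distr V borel (\<lambda>x. x)) M \<Omega> \<psi> J L" "a \<in> \<Omega>" "\<psi> a = x"
proof -
  obtain \<Omega> and \<psi> :: "real^'d \<Rightarrow> 'a" and a K where
    par: "local_parametrization M \<Omega> \<psi>" and a: "a \<in> \<Omega>" "\<psi> a = x" and K: "0 < K"
    and expand: "\<And>b c. b \<in> \<Omega> \<Longrightarrow> c \<in> \<Omega> \<Longrightarrow> dist b c \<le> K * dist (\<psi> b) (\<psi> c)"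
    by (rule slice_chart_parametrization[OF M x]) blast
  obtain \<phi> where open_\<Omega>: "open \<Omega>" and smooth: "smooth_on \<psi> \<Omega>"
    and inj: "\<And>b. b \<in> \<Omega> \<Longrightarrow> inj (frechet_derivative \<psi> (at b))"
    and openin: "openin (top_of_set M) (\<psi> ` \<Omega>)" and homeo: "homeomorphism \<Omega> (\<psi> ` \<Omega>) \<psi> \<phi>"
    using par unfolding local_parametrization_def by blast
  have C1: "Ck_on (Suc 0) \<psi> \<Omega>" and cont: "continuous_on \<Omega> \<psi>"
    using smooth unfolding smooth_on_def by (blast, metis Ck_on.simps(1))
  have D: "(\<psi> has_derivative frechet_derivative \<psi> (at b)) (at b)" if "b \<in> \<Omega>" for b
    using C1 that by (simp add: differentiable_on_eq_differentiable_at[OF open_\<Omega>] frechet_derivative_works)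
  define G where "G b = sqrt (det (metric_matrix \<psi> b))" for b
  have contG: "continuous_on \<Omega> G"
    unfolding G_def metric_matrix_def using C1
    by (intro continuous_on_real_sqrt continuous_on_det) (auto intro!: continuous_intros)
  have Gpos: "0 < G b" if "b \<in> \<Omega>" for b
    unfolding G_def using det_metric_matrix_pos[OF has_derivative_linear[OF D] inj] that by simp
  obtain t0 L1 where t0: "0 < t0" "0 < L1" "cball a t0 \<subseteq> \<Omega>"
    and lip: "\<And>y z. y \<in> cball a t0 \<Longrightarrow> z \<in> cball a t0 \<Longrightarrow> dist (\<psi> y) (\<psi> z) \<le> L1 * dist y z"
    using C1_locally_lipschitz[OF open_\<Omega> a(1) C1] by metis
  define B where "B = ball a t0"
  have B: "open B" "B \<subseteq> cball a t0" "B \<subseteq> \<Omega>" "a \<in> B"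
    using t0 by (auto simp: B_def)
  have comp: "compact (G ` cball a t0)"
    using continuous_on_subset[OF contG t0(3)] by (intro compact_continuous_image) auto
  have "cball a t0 \<noteq> {}" using t0 by auto
  then obtain b0 b1 where b0: "b0 \<in> cball a t0" "\<And>b. b \<in> cball a t0 \<Longrightarrow> G b0 \<le> G b"
    and b1: "b1 \<in> cball a t0" "\<And>b. b \<in> cball a t0 \<Longrightarrow> G b \<le> G b1"
    using continuous_attains_inf[of "cball a t0" G] continuous_attains_sup[of "cball a t0" G]
      continuous_on_subset[OF contG t0(3)] by (metis compact_cball)
  \<comment> \<open>The sum dominates each of the constants that a chart has to satisfy.\<close>
  define L where "L = K + L1 + G b1 + 1 / G b0"
  have posb: "0 < G b0" "0 < G b1"
    using Gpos b0(1) b1(1) t0(3) by auto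
  have L: "0 < L" "K \<le> L" "L1 \<le> L" "G b1 \<le> L" "1 / G b0 \<le> L"
    using K t0 posb unfolding L_def by (auto intro!: add_nonneg_nonneg add_pos_pos)
  have GL: "1 / L \<le> G b" "G b \<le> L" if "b \<in> B" for b
  proof -
    have "1 / L \<le> G b0" using L(1,5) posb by (simp add: field_simps)
    also have "\<dots> \<le> G b" using b0 that B by auto
    finally show "1 / L \<le> G b" .
    show "G b \<le> L" using b1(2)[of b] that B L(4) by auto
  qed
  \<comment> \<open>Extension by 0 outside the open ball \<open>B\<close> gives Borel functions on
    the whole space and changes nothing on \<open>B\<close>.\<close>
  define \<psi>' where "\<psi>' b = (if b \<in> B then \<psi> b else 0)" for b
  define J where "J b = (if b \<in> B then G b else 0)" for b
  have image: "\<psi>' ` S = \<psi> ` S" if "S \<subseteq> B" for S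
    using that by (auto simp: \<psi>'_def image_def)
  have [measurable]: "B \<in> sets borel" using B(1) by simp
  have [measurable]: "\<psi>' \<in> borel_measurable borel"
    unfolding \<psi>'_def using continuous_on_subset[OF cont B(3)]
    by (intro borel_measurable_continuous_on_if) (auto intro: borel_open)
  have [measurable]: "J \<in> borel_measurable borel"
    unfolding J_def using continuous_on_subset[OF contG B(3)]
    by (intro borel_measurable_continuous_on_if) (auto intro: borel_open)
  obtain U where U: "open U" "\<psi> ` B = M \<inter> U"
    using homeomorphism_image_openin_subset[OF homeo openin open_\<Omega> B(1,3)] by blast
  have "M \<in> sets borel" using \<open>compact M\<close> by (rule borel_compact)
  have [measurable]: "\<psi>' ` B \<in> sets borel"
    using U \<open>M \<in> sets borel\<close> by (simp add: image)
  let ?\<nu> = "distr V borel (\<lambda>x. x)"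
  have spaceV: "space V = M" and setsV: "sets V = sets (restrict_space borel M)"
    using V unfolding is_volume_measure_def by auto
  have idV [measurable]: "(\<lambda>x. x) \<in> measurable V borel"
    by (subst measurable_cong_sets[OF setsV refl]) (simp add: measurable_restrict_space1)
  have int: "(\<integral>\<^sup>+y\<in>\<psi>' ` B. g y \<partial>?\<nu>) = (\<integral>\<^sup>+b\<in>B. g (\<psi>' b) * ennreal (J b) \<partial>lborel)"
    if [measurable]: "g \<in> borel_measurable borel" for g
  proof -
    \<comment> \<open>The defining property of the volume, known for sets, amounts to the equality
      of these two measures; the formula for integrands then follows.\<close>
    have "density ?\<nu> (indicator (\<psi>' ` B)) = distr (density lborel (\<lambda>b. ennreal (J b))) borel \<psi>'"
    proof (rule measure_eqI)
      fix C assume "C \<in> sets (density ?\<nu> (indicator (\<psi>' ` B)))"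
      then have [measurable]: "C \<in> sets borel" by simp
      define A where "A = B \<inter> \<psi>' -` C"
      have A: "A \<in> sets borel" "A \<subseteq> \<Omega>" "A \<subseteq> B"
        unfolding A_def using B measurable_sets_borel[of \<psi>' borel C] by auto
      have "emeasure (density ?\<nu> (indicator (\<psi>' ` B))) C = emeasure ?\<nu> (\<psi>' ` B \<inter> C)"
        by (subst emeasure_density) (auto simp: indicator_inter_arith[symmetric])
      also have "\<dots> = emeasure V (\<psi>' ` B \<inter> C)"
      proof -
        have "\<psi>' ` B \<inter> C \<subseteq> space V" using U(2) spaceV image[of B] by blast
        moreover have "\<psi>' ` B \<inter> C \<in> sets borel" by measurable
        ultimately show ?thesis by (simp add: emeasure_distr Int_absorb2)
      qed
      also have "\<psi>' ` B \<inter> C = \<psi> ` A"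
        using A(3) by (subst image[OF A(3), symmetric]) (auto simp: A_def)
      also have "emeasure V (\<psi> ` A) = (\<integral>\<^sup>+b\<in>A. ennreal (G b) \<partial>lborel)"
        using V par A unfolding is_volume_measure_def G_def by blast
      also have "\<dots> = (\<integral>\<^sup>+b. ennreal (J b) * indicator (\<psi>' -` C) b \<partial>lborel)"
        by (intro nn_integral_cong) (auto simp: A_def J_def indicator_def)
      also have "\<dots> = emeasure (distr (density lborel (\<lambda>b. ennreal (J b))) borel \<psi>') C"
      proof -
        have "\<psi>' -` C \<in> sets lborel" using measurable_sets_borel[of \<psi>' borel C] by simp
        then show ?thesis by (simp add: emeasure_distr emeasure_density)
      qed
      finally show "emeasure (density ?\<nu> (indicator (\<psi>' ` B))) C = \<dots>" .
    qed simp
    then have "(\<integral>\<^sup>+y. g y \<partial>density ?\<nu> (indicator (\<psi>' ` B))) =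
      (\<integral>\<^sup>+y. g y \<partial>distr (density lborel (\<lambda>b. ennreal (J b))) borel \<psi>')"
      by simp
    also have "(\<integral>\<^sup>+y. g y \<partial>density ?\<nu> (indicator (\<psi>' ` B))) = (\<integral>\<^sup>+y\<in>\<psi>' ` B. g y \<partial>?\<nu>)"
      by (subst nn_integral_density) (auto simp: mult.commute)
    also have "(\<integral>\<^sup>+y. g y \<partial>distr (density lborel (\<lambda>b. ennreal (J b))) borel \<psi>') = (\<integral>\<^sup>+b. ennreal (J b) * g (\<psi>' b) \<partial>lborel)"
      by (simp add: nn_integral_distr nn_integral_density)
    also have "\<dots> = (\<integral>\<^sup>+b\<in>B. g (\<psi>' b) * ennreal (J b) \<partial>lborel)"
      by (intro nn_integral_cong) (auto simp: J_def indicator_def mult.commute)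
    finally show ?thesis .
  qed
  have "vol_chart ?\<nu> M B \<psi>' J L"
    unfolding vol_chart_def
  proof (intro conjI ballI)
    fix b c assume bc: "b \<in> B" "c \<in> B"
    have "dist b c \<le> K * dist (\<psi> b) (\<psi> c)" using expand bc B(3) by blast
    also have "\<dots> \<le> L * dist (\<psi> b) (\<psi> c)" using L by (intro mult_right_mono) auto
    finally show "dist b c \<le> L * dist (\<psi>' b) (\<psi>' c)" using bc by (simp add: \<psi>'_def)
    have "dist (\<psi> b) (\<psi> c) \<le> L1 * dist b c" using lip bc B(2) by blast
    also have "\<dots> \<le> L * dist b c" using L by (intro mult_right_mono) auto
    finally show "dist (\<psi>' b) (\<psi>' c) \<le> L * dist b c" using bc by (simp add: \<psi>'_def)
  next
    fix b assume b: "b \<in> B"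
    show "1 / L \<le> J b" "J b \<le> L" using GL[OF b] b by (auto simp: J_def)
    have "(\<psi> has_derivative frechet_derivative \<psi> (at b)) (at b)" using D b B(3) by blast
    then have "(\<psi>' has_derivative frechet_derivative \<psi> (at b)) (at b)"
      using has_derivative_cong_open[OF B(1) b, of \<psi>' \<psi>] by (simp add: \<psi>'_def)
    then show "\<exists>D. (\<psi>' has_derivative D) (at b)" by blast
  next
    show "continuous_on B J"
      using continuous_on_subset[OF contG B(3)] by (subst continuous_on_cong[of B B J G]) (auto simp: J_def)
    show "\<exists>U. open U \<and> \<psi>' ` B = M \<inter> U" using U image by auto
  qed (use L B int in auto)
  moreover have "\<psi>' a = x" using a B by (simp add: \<psi>'_def)
  ultimately show ?thesis using that B(4) by blast
qed

text \<open>Pushing \<open>V\<close> forward along the inclusion of \<open>M\<close> replaces the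
  trace \<sigma>-algebra on \<open>M\<close> by the Borel sets of the ambient space.\<close>

lemma charted_volume_measure:
  fixes M :: "'a::euclidean_space set"
  assumes M: "compact M" "smooth_submanifold CARD('d::finite) M" and V: "is_volume_measure TYPE('d) M V"
    and "finite_measure V"
  shows "charted TYPE(real^'d) (distr V borel (\<lambda>x. x)) M"
proof -
  have spaceV: "space V = M" and setsV: "sets V = sets (restrict_space borel M)"
    using V unfolding is_volume_measure_def by auto
  have idV [measurable]: "(\<lambda>x. x) \<in> measurable V borel"
    by (subst measurable_cong_sets[OF setsV refl]) (simp add: measurable_restrict_space1)
  have "emeasure (distr V borel (\<lambda>x. x)) (- M) = emeasure V (- M \<inter> space V)"
    using borel_compact[OF M(1)] by (subst emeasure_distr) auto
  also have "\<dots> = 0" by (simp add: spaceV)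
  finally have "emeasure (distr V borel (\<lambda>x. x)) (- M) = 0" .
  moreover have "finite_measure (distr V borel (\<lambda>x. x))"
    using finite_measure.finite_measure_distr[OF assms(4) idV] .
  moreover have "\<exists>\<Omega> (\<psi> :: real^'d \<Rightarrow> 'a) J L a. vol_chart (distr V borel (\<lambda>x. x)) M \<Omega> \<psi> J L \<and> a \<in> \<Omega> \<and> \<psi> a = x"
    if "x \<in> M" for x
    using vol_chart_exists[OF M V that] by metis
  ultimately show ?thesis
    unfolding charted_def using M(1) by simp
qed

section \<open>Ahlfors regularity\<close>

lemma vol_chart_inj: "vol_chart \<nu> M \<Omega> \<psi> J L \<Longrightarrow> inj_on \<psi> \<Omega>"
  unfolding vol_chart_def inj_on_def by (metis dist_eq_0_iff dist_self mult_zero_right order_antisym zero_le_dist)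

text \<open>The inverse of \<open>\<psi>\<close> is Lipschitz, hence continuous, on the image of
  \<open>\<Omega>\<close>, which is Borel as a relatively open part of the compact \<open>M\<close>.
  The image of \<open>C\<close> is the preimage of \<open>C\<close> under this inverse.\<close>

lemma vol_chart_image_borel:
  assumes chart: "vol_chart \<nu> M \<Omega> \<psi> J L" and M: "compact M" and C: "C \<in> sets borel" "C \<subseteq> \<Omega>"
  shows "\<psi> ` C \<in> sets borel"
proof -
  note inj = vol_chart_inj[OF chart]
  obtain U where U: "open U" "\<psi> ` \<Omega> = M \<inter> U"
    using chart unfolding vol_chart_def by blast
  have \<Omega>: "\<psi> ` \<Omega> \<in> sets borel"
    unfolding U(2) using U(1) borel_compact[OF M] by auto
  have L: "0 < L" and lip: "\<And>a b. a \<in> \<Omega> \<Longrightarrow> b \<in> \<Omega> \<Longrightarrow> dist a b \<le> L * dist (\<psi> a) (\<psi> b)"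
    using chart unfolding vol_chart_def by auto
  define \<phi> where "\<phi> = inv_into \<Omega> \<psi>"
  have \<phi>: "\<phi> (\<psi> a) = a" if "a \<in> \<Omega>" for a
    unfolding \<phi>_def using inj that by simp
  have "L-lipschitz_on (\<psi> ` \<Omega>) \<phi>"
  proof (rule lipschitz_onI)
    fix y z assume "y \<in> \<psi> ` \<Omega>" "z \<in> \<psi> ` \<Omega>"
    then show "dist (\<phi> y) (\<phi> z) \<le> L * dist y z" using \<phi> lip by auto
  qed (use L in simp)
  then have cont: "continuous_on (\<psi> ` \<Omega>) \<phi>"
    by (rule lipschitz_on_continuous_on)
  have "\<phi> \<in> measurable (restrict_space borel (\<psi> ` \<Omega>)) borel"
    using cont by (rule borel_measurable_continuous_on_restrict)
  from measurable_sets[OF this C(1)] have "\<phi> -` C \<inter> \<psi> ` \<Omega> \<in> sets borel"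
    using \<Omega> by (simp add: space_restrict_space sets_restrict_space_iff)
  also have "\<phi> -` C \<inter> \<psi> ` \<Omega> = \<psi> ` C"
    using \<phi> C(2) by (auto 4 3)
  finally show ?thesis .
qed

lemma vol_chart_integral:
  assumes chart: "vol_chart \<nu> M \<Omega> \<psi> J L" and M: "compact M" and C: "C \<in> sets borel" "C \<subseteq> \<Omega>"
    and g [measurable]: "g \<in> borel_measurable borel"
  shows "(\<integral>\<^sup>+x\<in>\<psi> ` C. g x \<partial>\<nu>) = (\<integral>\<^sup>+a\<in>C. g (\<psi> a) * ennreal (J a) \<partial>lborel)"
proof -
  note inj = vol_chart_inj[OF chart]
  have [measurable]: "\<psi> ` C \<in> sets borel"
    by (rule vol_chart_image_borel[OF chart M C])
  have "(\<integral>\<^sup>+x\<in>\<psi> ` C. g x \<partial>\<nu>) = (\<integral>\<^sup>+x\<in>\<psi> ` \<Omega>. (g x * indicator (\<psi> ` C) x) \<partial>\<nu>)"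
    using C(2) by (intro nn_integral_cong) (auto simp: indicator_def)
  also have "\<dots> = (\<integral>\<^sup>+a\<in>\<Omega>. (g (\<psi> a) * indicator (\<psi> ` C) (\<psi> a)) * ennreal (J a) \<partial>lborel)"
    using chart unfolding vol_chart_def by simp
  also have "\<dots> = (\<integral>\<^sup>+a\<in>C. g (\<psi> a) * ennreal (J a) \<partial>lborel)"
  proof (rule nn_integral_cong)
    fix a
    have "\<psi> a \<in> \<psi> ` C \<longleftrightarrow> a \<in> C" if "a \<in> \<Omega>"
      using inj_on_image_mem_iff[OF inj that C(2)] .
    then show "g (\<psi> a) * indicator (\<psi> ` C) (\<psi> a) * ennreal (J a) * indicator \<Omega> a =
        g (\<psi> a) * ennreal (J a) * indicator C a"
      using C(2) by (auto simp: indicator_def)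
  qed
  finally show ?thesis .
qed

text \<open>The part of \<open>\<Omega>\<close> mapped into the ball has diameter at most 2 L r, so
  it lies in a ball of that radius around any of its own points. Such a point serves as centre
  because x may lie off the manifold.\<close>

lemma vol_chart_emeasure_le:
  fixes \<psi> :: "'b::euclidean_space \<Rightarrow> 'a::euclidean_space"
  assumes chart: "vol_chart \<nu> M \<Omega> \<psi> J L" and "sets \<nu> = sets borel" and M: "compact M"
    and r: "0 < r"
  shows "emeasure \<nu> (\<psi> ` \<Omega> \<inter> cball x r) \<le> ennreal (L * (unit_ball_vol DIM('b) * (L * 2) ^ DIM('b)) * r ^ DIM('b))"
proof -
  have \<Omega>: "open \<Omega>" "0 < L" and [measurable]: "\<psi> \<in> borel_measurable borel"
    and expand: "\<And>a b. a \<in> \<Omega> \<Longrightarrow> b \<in> \<Omega> \<Longrightarrow> dist a b \<le> L * dist (\<psi> a) (\<psi> b)"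
    and JL: "\<And>a. a \<in> \<Omega> \<Longrightarrow> J a \<le> L"
    using chart unfolding vol_chart_def by auto
  have [measurable]: "\<Omega> \<in> sets borel" using \<Omega>(1) by simp
  have [measurable]: "\<psi> ` \<Omega> \<in> sets borel"
    by (rule vol_chart_image_borel[OF chart M]) auto
  have "emeasure \<nu> (\<psi> ` \<Omega> \<inter> cball x r) = (\<integral>\<^sup>+y\<in>\<psi> ` \<Omega>. indicator (cball x r) y \<partial>\<nu>)"
  proof -
    have "\<psi> ` \<Omega> \<inter> cball x r \<in> sets \<nu>" using assms(2) by simp
    then have "emeasure \<nu> (\<psi> ` \<Omega> \<inter> cball x r) = (\<integral>\<^sup>+y. indicator (\<psi> ` \<Omega> \<inter> cball x r) y \<partial>\<nu>)"
      by (rule nn_integral_indicator[symmetric])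
    then show ?thesis by (simp add: indicator_inter_arith mult.commute)
  qed
  also have "\<dots> = (\<integral>\<^sup>+a\<in>\<Omega>. indicator (cball x r) (\<psi> a) * ennreal (J a) \<partial>lborel)"
    by (rule vol_chart_integral[OF chart M]) (auto intro!: borel_measurable_indicator)
  also have "\<dots> \<le> (\<integral>\<^sup>+a. ennreal L * indicator (\<Omega> \<inter> \<psi> -` cball x r) a \<partial>lborel)"
    using JL by (intro nn_integral_mono) (auto simp: indicator_def ennreal_leI)
  also have "\<dots> = ennreal L * emeasure lborel (\<Omega> \<inter> \<psi> -` cball x r)"
    using measurable_sets_borel[of \<psi> borel "cball x r"] by (subst nn_integral_cmult_indicator) auto
  also have "emeasure lborel (\<Omega> \<inter> \<psi> -` cball x r) \<le> ennreal (unit_ball_vol DIM('b) * (L * 2 * r) ^ DIM('b))"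
  proof (cases "\<Omega> \<inter> \<psi> -` cball x r = {}")
    case False
    then obtain a where a: "a \<in> \<Omega>" "dist x (\<psi> a) \<le> r" by auto
    have "\<Omega> \<inter> \<psi> -` cball x r \<subseteq> cball a (L * 2 * r)"
    proof
      fix b assume "b \<in> \<Omega> \<inter> \<psi> -` cball x r"
      then have b: "b \<in> \<Omega>" "dist x (\<psi> b) \<le> r" by auto
      have "dist a b \<le> L * dist (\<psi> a) (\<psi> b)" using expand a b by blast
      also have "\<dots> \<le> L * (2 * r)"
        using \<Omega>(2) a(2) b(2) dist_triangle2[of "\<psi> a" "\<psi> b" x] by (intro mult_left_mono) (auto simp: dist_commute)
      finally show "b \<in> cball a (L * 2 * r)" by (simp add: mult.assoc)
    qed
    then have "emeasure lborel (\<Omega> \<inter> \<psi> -` cball x r) \<le> emeasure lborel (cball a (L * 2 * r))"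
      by (intro emeasure_mono) auto
    also have "\<dots> = ennreal (unit_ball_vol DIM('b) * (L * 2 * r) ^ DIM('b))"
      using \<Omega>(2) r by (intro emeasure_cball) auto
    finally show ?thesis .
  qed simp
  also have "ennreal L * ennreal (unit_ball_vol DIM('b) * (L * 2 * r) ^ DIM('b)) =
      ennreal (L * (unit_ball_vol DIM('b) * (L * 2) ^ DIM('b)) * r ^ DIM('b))"
    using \<Omega>(2) r by (subst ennreal_mult[symmetric]) (auto simp: power_mult_distrib mult_ac)
  finally show ?thesis by (simp add: mult_left_mono)
qed

lemma compact_local_choice:
  assumes M: "compact M" and loc: "\<And>x. x \<in> M \<Longrightarrow> \<exists>U c. open U \<and> x \<in> U \<and> P U c"
  obtains \<D> c where "finite \<D>" "M \<subseteq> \<Union>\<D>" "\<And>U. U \<in> \<D> \<Longrightarrow> open U" "\<And>U. U \<in> \<D> \<Longrightarrow> P U (c U)"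
proof -
  have "M \<subseteq> \<Union>{U. open U \<and> (\<exists>c. P U c)}"
    using loc by blast
  then obtain \<D> where \<D>: "\<D> \<subseteq> {U. open U \<and> (\<exists>c. P U c)}" "finite \<D>" "M \<subseteq> \<Union>\<D>"
    by (rule compactE[OF M]) auto
  have "P U (SOME c. P U c)" if "U \<in> \<D>" for U
    using \<D>(1) that by (auto intro: someI_ex[of "P U"])
  then show ?thesis
    using \<D> by (intro that[of \<D> "\<lambda>U. SOME c. P U c"]) auto
qed

lemma charted_emeasure_cball_le:
  fixes \<nu> :: "'a::euclidean_space measure"
  assumes "charted TYPE('b::euclidean_space) \<nu> M"
  obtains C where "0 < C" "\<And>x r. 0 < r \<Longrightarrow> emeasure \<nu> (cball x r) \<le> ennreal (C * r ^ DIM('b))"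
proof -
  have M: "compact M" "sets \<nu> = sets borel" "emeasure \<nu> (- M) = 0"
    using assms unfolding charted_def by auto
  have borelM: "M \<in> sets borel" using M(1) by (rule borel_compact)
  define P where "P U C \<longleftrightarrow> 0 < C \<and> (\<forall>x r. 0 < r \<longrightarrow> emeasure \<nu> (M \<inter> U \<inter> cball x r) \<le> ennreal (C * r ^ DIM('b)))" for U C
  have loc: "\<exists>U C. open U \<and> x \<in> U \<and> P U C" if x: "x \<in> M" for x
  proof -
    obtain \<Omega> and \<psi> :: "'b \<Rightarrow> 'a" and J L a where
      chart: "vol_chart \<nu> M \<Omega> \<psi> J L" and a: "a \<in> \<Omega>" "\<psi> a = x"
      using assms x unfolding charted_def by blast
    obtain U where U: "open U" "\<psi> ` \<Omega> = M \<inter> U" and L: "0 < L"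
      using chart unfolding vol_chart_def by blast
    let ?C = "L * (unit_ball_vol DIM('b) * (L * 2) ^ DIM('b))"
    have "P U ?C"
      unfolding P_def U(2)[symmetric]
    proof (intro conjI allI impI)
      show "0 < ?C" using L by (simp add: unit_ball_vol_pos)
    qed (rule vol_chart_emeasure_le[OF chart M(2,1)])
    moreover have "x \<in> U" using a U(2) by blast
    ultimately show ?thesis using U(1) by blast
  qed
  obtain F C where F: "finite F" "M \<subseteq> \<Union>F" and opens: "\<And>U. U \<in> F \<Longrightarrow> open U" and C: "\<And>U. U \<in> F \<Longrightarrow> P U (C U)"
    using compact_local_choice[OF M(1), of P] loc by blast
  have Cpos: "0 < C U" if "U \<in> F" for U
    using C[OF that] unfolding P_def by blast
  \<comment> \<open>The summand 1 keeps the constant positive if the cover is empty.\<close>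
  have "emeasure \<nu> (cball x r) \<le> ennreal (((\<Sum>y\<in>F. C y) + 1) * r ^ DIM('b))" if r: "0 < r" for x r
  proof -
    have sub: "cball x r \<subseteq> (\<Union>U\<in>F. M \<inter> U \<inter> cball x r) \<union> - M" using F(2) by auto
    have Un: "(\<Union>U\<in>F. M \<inter> U \<inter> cball x r) \<in> sets \<nu>"
      unfolding M(2) using F(1) opens by (intro sets.finite_UN sets.Int borelM) auto
    have compl: "- M \<in> sets \<nu>"
      unfolding M(2) by (intro borel_comp borelM)
    have "emeasure \<nu> (cball x r) \<le> emeasure \<nu> ((\<Union>U\<in>F. M \<inter> U \<inter> cball x r) \<union> - M)"
      by (intro emeasure_mono sub sets.Un Un compl)
    also have "\<dots> \<le> emeasure \<nu> (\<Union>U\<in>F. M \<inter> U \<inter> cball x r) + emeasure \<nu> (- M)"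
      by (intro emeasure_subadditive Un compl)
    also have "\<dots> = emeasure \<nu> (\<Union>U\<in>F. M \<inter> U \<inter> cball x r)"
      using M(3) by simp
    also have "\<dots> \<le> (\<Sum>U\<in>F. emeasure \<nu> (M \<inter> U \<inter> cball x r))"
      using borelM opens F(1) M(2) by (intro emeasure_subadditive_finite) auto
    also have "\<dots> \<le> (\<Sum>U\<in>F. ennreal (C U * r ^ DIM('b)))"
      using C r unfolding P_def by (intro sum_mono) blast
    also have "\<dots> = ennreal (\<Sum>U\<in>F. C U * r ^ DIM('b))"
      using Cpos r by (intro sum_ennreal mult_nonneg_nonneg) (auto intro: less_imp_le)
    also have "\<dots> \<le> ennreal (((\<Sum>U\<in>F. C U) + 1) * r ^ DIM('b))"
      using r by (intro ennreal_leI) (simp add: sum_distrib_right[symmetric] distrib_right)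
    finally show ?thesis .
  qed
  moreover have "0 < (\<Sum>U\<in>F. C U) + 1"
    using Cpos by (intro add_nonneg_pos sum_nonneg) (auto intro: less_imp_le)
  ultimately show ?thesis using that by blast
qed

lemma charted_emeasure_cball_ge:
  fixes \<nu> :: "'a::euclidean_space measure"
  assumes "charted TYPE('b::euclidean_space) \<nu> M"
  obtains c r0 where "0 < c" "0 < r0"
    "\<And>x r. x \<in> M \<Longrightarrow> 0 < r \<Longrightarrow> r \<le> r0 \<Longrightarrow> ennreal (c * r ^ DIM('b)) \<le> emeasure \<nu> (cball x r)"
proof -
  have M: "compact M" "sets \<nu> = sets borel"
    using assms unfolding charted_def by auto
  \<comment> \<open>One number \<open>c\<close> serves both as lower density and as bound on the
    radius, so that a single choice per open set, followed by a minimum over the cover, gives both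
    constants.\<close>
  define P where "P U c \<longleftrightarrow> 0 < c \<and>
    (\<forall>x r. x \<in> M \<inter> U \<longrightarrow> 0 < r \<longrightarrow> r \<le> c \<longrightarrow> ennreal (c * r ^ DIM('b)) \<le> emeasure \<nu> (cball x r))" for U c
  have loc: "\<exists>U c. open U \<and> x0 \<in> U \<and> P U c" if x0: "x0 \<in> M" for x0
  proof -
    obtain \<Omega> and \<psi> :: "'b \<Rightarrow> 'a" and J L a where
      chart: "vol_chart \<nu> M \<Omega> \<psi> J L" and a: "a \<in> \<Omega>" "\<psi> a = x0"
      using assms x0 unfolding charted_def by blast
    obtain U where U: "open U" "\<psi> ` \<Omega> = M \<inter> U"
      using chart unfolding vol_chart_def by blast
    have \<Omega>: "open \<Omega>" "0 < L" and [measurable]: "\<psi> \<in> borel_measurable borel" "J \<in> borel_measurable borel"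
      and expand: "\<And>a b. a \<in> \<Omega> \<Longrightarrow> b \<in> \<Omega> \<Longrightarrow> dist a b \<le> L * dist (\<psi> a) (\<psi> b)"
      and lip: "\<And>a b. a \<in> \<Omega> \<Longrightarrow> b \<in> \<Omega> \<Longrightarrow> dist (\<psi> a) (\<psi> b) \<le> L * dist a b"
      and JL: "\<And>a. a \<in> \<Omega> \<Longrightarrow> 1 / L \<le> J a"
      using chart unfolding vol_chart_def by auto
    obtain t where t: "0 < t" "ball a t \<subseteq> \<Omega>"
      using \<Omega>(1) a(1) open_contains_ball by blast
    \<comment> \<open>Points of \<open>M\<close> in \<open>V\<close> have parameters within t/2 of
      \<open>a\<close>. If also r/L \<le> t/2, the ball of radius r/L around such a parameter stays
      inside \<open>\<Omega>\<close>, and \<open>\<psi>\<close> maps it into the ball of radius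
      r.\<close>
    define V where "V = U \<inter> ball x0 (t / (2 * L))"
    have V: "open V" "x0 \<in> V"
      using U a t \<Omega>(2) by (auto simp: V_def)
    define c0 where "c0 = 1 / L * (unit_ball_vol DIM('b) * (1 / L) ^ DIM('b))"
    define c where "c = min c0 (L * (t / 2))"
    have "0 < c0" using \<Omega>(2) by (simp add: c0_def unit_ball_vol_pos)
    then have c: "0 < c" "c \<le> c0" "c \<le> L * (t / 2)" "0 < c0"
      unfolding c_def using \<Omega>(2) t(1) by (auto simp only: min_less_iff_conj min.cobounded1 min.cobounded2 intro!: mult_pos_pos half_gt_zero)
    have ge: "ennreal (c * r ^ DIM('b)) \<le> emeasure \<nu> (cball x r)"
      if x: "x \<in> M \<inter> V" and r: "0 < r" "r \<le> c" for x r
    proof -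
      obtain b where b: "b \<in> \<Omega>" "\<psi> b = x"
      proof -
        have "x \<in> \<psi> ` \<Omega>" using x unfolding U(2) by (simp add: V_def)
        then show ?thesis using that by blast
      qed
      have "dist a b \<le> L * dist x0 x" using expand[OF a(1) b(1)] a b by simp
      also have "\<dots> < L * (t / (2 * L))" using x \<Omega>(2) by (intro mult_strict_left_mono) (auto simp: V_def)
      also have "\<dots> = t / 2" using \<Omega>(2) by simp
      finally have ab: "dist a b < t / 2" .
      have rt: "r / L \<le> t / 2" using r(2) c(3) \<Omega>(2) by (simp add: field_simps)
      have sub: "ball b (r / L) \<subseteq> \<Omega>"
      proof
        fix z assume "z \<in> ball b (r / L)"
        then have "dist b z < r / L" by simp
        then have "dist a z < t" using ab rt dist_triangle[of a z b] by linarith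
        then show "z \<in> \<Omega>" using t(2) by (simp add: subset_iff)
      qed
      have sub2: "\<psi> ` ball b (r / L) \<subseteq> cball x r"
      proof (rule image_subsetI)
        fix z assume z: "z \<in> ball b (r / L)"
        then have "z \<in> \<Omega>" by (rule subsetD[OF sub])
        then have "dist (\<psi> b) (\<psi> z) \<le> L * dist b z" by (rule lip[OF b(1)])
        also have "\<dots> \<le> L * (r / L)" using z \<Omega>(2) by (intro mult_left_mono) auto
        finally show "\<psi> z \<in> cball x r" using b(2) \<Omega>(2) by simp
      qed
      have "ennreal (c * r ^ DIM('b)) \<le> ennreal (c0 * r ^ DIM('b))"
        using c r by (intro ennreal_leI mult_right_mono) auto
      also have "\<dots> = ennreal (1 / L) * ennreal (unit_ball_vol DIM('b) * (r / L) ^ DIM('b))"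
        using \<Omega>(2) r by (subst ennreal_mult[symmetric]) (auto simp: c0_def power_divide)
      also have "ennreal (unit_ball_vol DIM('b) * (r / L) ^ DIM('b)) = emeasure lborel (ball b (r / L))"
        using \<Omega>(2) r by (intro emeasure_ball[symmetric]) auto
      also have "ennreal (1 / L) * emeasure lborel (ball b (r / L)) = (\<integral>\<^sup>+z. ennreal (1 / L) * indicator (ball b (r / L)) z \<partial>lborel)"
        by (rule nn_integral_cmult_indicator[symmetric]) simp
      also have "\<dots> \<le> (\<integral>\<^sup>+z\<in>ball b (r / L). 1 * ennreal (J z) \<partial>lborel)"
      proof (rule nn_integral_mono)
        fix z
        show "ennreal (1 / L) * indicator (ball b (r / L)) z \<le> 1 * ennreal (J z) * indicator (ball b (r / L)) z"
        proof (cases "z \<in> ball b (r / L)")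
          case True
          then show ?thesis using JL[OF subsetD[OF sub True]] by (simp add: ennreal_leI del: mem_ball)
        qed (simp del: mem_ball)
      qed
      also have "\<dots> = (\<integral>\<^sup>+y\<in>\<psi> ` ball b (r / L). 1 \<partial>\<nu>)"
        using vol_chart_integral[OF chart M(1) _ sub, of "\<lambda>_. 1"] by simp
      also have "\<dots> = emeasure \<nu> (\<psi> ` ball b (r / L))"
      proof -
        have "\<psi> ` ball b (r / L) \<in> sets \<nu>"
          unfolding M(2) by (rule vol_chart_image_borel[OF chart M(1) _ sub]) simp
        then show ?thesis by simp
      qed
      also have "\<dots> \<le> emeasure \<nu> (cball x r)"
        using M(2) by (intro emeasure_mono sub2) simp
      finally show ?thesis .
    qed
    have "P V c"
      unfolding P_def
    proof (intro conjI allI impI)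
      fix x r assume "x \<in> M \<inter> V" "0 < r" "r \<le> c"
      then show "ennreal (c * r ^ DIM('b)) \<le> emeasure \<nu> (cball x r)" by (rule ge)
    qed (rule c(1))
    with V show ?thesis by (intro exI[of _ V] exI[of _ c] conjI)
  qed
  obtain F C where F: "finite F" "M \<subseteq> \<Union>F" and C: "\<forall>U\<in>F. P U (C U)"
    by (rule compact_local_choice[OF M(1), of P, OF loc]) (assumption, blast)
  \<comment> \<open>The element 1 keeps the minimum defined for an empty cover.\<close>
  define c where "c = Min (insert 1 (C ` F))"
  have Cpos: "0 < C U" if "U \<in> F" for U
    using C that unfolding P_def by blast
  have "0 < c" unfolding c_def using F(1) Cpos by (subst Min_gr_iff) auto
  moreover have "c \<le> C U" if "U \<in> F" for U
    unfolding c_def using F(1) that by (intro Min_le) auto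
  ultimately have c: "0 < c" "\<And>U. U \<in> F \<Longrightarrow> c \<le> C U" by auto
  have "ennreal (c * r ^ DIM('b)) \<le> emeasure \<nu> (cball x r)" if "x \<in> M" "0 < r" "r \<le> c" for x r
  proof -
    obtain U where U: "U \<in> F" "x \<in> U" using F(2) \<open>x \<in> M\<close> by blast
    have "ennreal (c * r ^ DIM('b)) \<le> ennreal (C U * r ^ DIM('b))"
      using c(2)[OF U(1)] that by (intro ennreal_leI mult_right_mono) auto
    also have "\<dots> \<le> emeasure \<nu> (cball x r)"
      using that U(2) c(2)[OF U(1)] C U(1) unfolding P_def by auto
    finally show ?thesis .
  qed
  then show ?thesis using that c(1) by blast
qed

section \<open>Pointwise limits of rescaled kernel integrals\<close>

text \<open>For t > 0 the level set lies in the frontier of the convex sublevel set, since scaling h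
  by 1 + s with s > 0 leaves the latter, and frontiers of convex sets are negligible. For t \<le> 0
  injectivity leaves at most the origin.\<close>

lemma negligible_norm_level_set:
  fixes D :: "'b::euclidean_space \<Rightarrow> 'a::euclidean_space"
  assumes D: "linear D" "inj D"
  shows "negligible {h. norm (D h) = t}"
proof (cases "t \<le> 0")
  case True
  have "h = 0" if "norm (D h) = t" for h
  proof -
    have "D h = D 0" using that True linear_0[OF D(1)] by (metis norm_le_zero_iff)
    then show ?thesis using D(2) by (simp add: inj_def)
  qed
  then have "{h. norm (D h) = t} \<subseteq> {0}" by blast
  then show ?thesis using negligible_subset negligible_sing by blast
next
  case False
  define S where "S = {h. norm (D h) \<le> t}"
  have "convex S"
    unfolding S_def using convex_linear_vimage[OF D(1) convex_cball[of 0 t]] by (simp add: vimage_def)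
  have "h \<in> frontier S" if h: "norm (D h) = t" for h
  proof -
    have "h \<notin> interior S"
    proof
      assume "h \<in> interior S"
      then obtain e where e: "0 < e" "ball h e \<subseteq> S"
        unfolding mem_interior by blast
      have "h \<noteq> 0" using h False linear_0[OF D(1)] by auto
      define s where "s = e / (2 * norm h)"
      have s: "0 < s" "s * norm h < e" using e \<open>h \<noteq> 0\<close> by (auto simp: s_def)
      have "dist h (h + s *\<^sub>R h) < e" using s by (simp add: dist_norm)
      then have "norm (D (h + s *\<^sub>R h)) \<le> t" using e(2) unfolding S_def by auto
      moreover have "D (h + s *\<^sub>R h) = (1 + s) *\<^sub>R D h"
        by (simp add: linear_add[OF D(1)] linear_cmul[OF D(1)] scaleR_add_left)
      ultimately have "(1 + s) * t \<le> t" using h s by simp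
      moreover have "0 < s * t" using s(1) False by simp
      ultimately show False by (simp add: distrib_right)
    qed
    moreover have "h \<in> closure S" using h by (intro subsetD[OF closure_subset]) (simp add: S_def)
    ultimately show ?thesis by (simp add: frontier_def)
  qed
  then have "{h. norm (D h) = t} \<subseteq> frontier S" by blast
  then show ?thesis
    using negligible_convex_frontier[OF \<open>convex S\<close>] negligible_subset by blast
qed

text \<open>A monotone function has countably many discontinuities, and each of them is met on a
  null level set only.\<close>

lemma AE_isCont_norm_linear:
  fixes D :: "'b::euclidean_space \<Rightarrow> 'a::euclidean_space" and \<eta> :: "real \<Rightarrow> real"
  assumes D: "linear D" "inj D" and \<eta>: "antimono \<eta>"
  shows "AE h in lborel. isCont \<eta> (norm (D h))"
proof -
  have "mono (\<lambda>t. - \<eta> t)" using \<eta> by (auto simp: mono_def antimono_def)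
  then have "countable {t. \<not> isCont (\<lambda>t. - \<eta> t) t}" by (rule mono_ctble_discont)
  moreover have "isCont (\<lambda>t. - \<eta> t) t \<longleftrightarrow> isCont \<eta> t" for t
    using continuous_minus[of "at t" "\<lambda>t. - \<eta> t"] continuous_minus[of "at t" \<eta>] by auto
  ultimately have ctble: "countable {t. \<not> isCont \<eta> t}" by simp
  have cont: "continuous_on UNIV (\<lambda>h. norm (D h))"
    using D(1) linear_continuous_on[of D] by (auto intro!: continuous_intros simp: linear_conv_bounded_linear)
  have "(\<Union>t\<in>{t. \<not> isCont \<eta> t}. {h. norm (D h) = t}) \<in> null_sets lborel"
  proof (rule null_sets_UN'[OF ctble])
    fix t assume "t \<in> {t. \<not> isCont \<eta> t}"
    have "{h. norm (D h) = t} = (\<lambda>h. norm (D h)) -` {t}" by auto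
    then have "closed {h. norm (D h) = t}"
      using cont by (simp add: closed_vimage)
    moreover have "{h. norm (D h) = t} \<in> null_sets lebesgue"
      using negligible_norm_level_set[OF D] by (simp add: negligible_iff_null_sets)
    ultimately show "{h. norm (D h) = t} \<in> null_sets lborel"
      by (auto simp: null_sets_def intro: borel_closed)
  qed
  then have "AE h in lborel. h \<notin> (\<Union>t\<in>{t. \<not> isCont \<eta> t}. {h. norm (D h) = t})"
    by (rule AE_not_in)
  then show ?thesis by eventually_elim auto
qed

text \<open>The share of the kernel convolution contributed by one manifold, once \<open>p\<close>
  is the weighted density there. Being \<open>ennreal\<close>-valued, it can be estimated before it
  is known to be finite.\<close>

definition kint :: "'a::metric_space measure \<Rightarrow> (real \<Rightarrow> real) \<Rightarrow> ('a \<Rightarrow> real) \<Rightarrow> real \<Rightarrow> 'a \<Rightarrow> ennreal" where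
  "kint \<nu> \<eta> p e x = (\<integral>\<^sup>+z. ennreal (\<eta> (dist x z / e) * p z) \<partial>\<nu>)"

lemma antimono_borel:
  fixes \<eta> :: "real \<Rightarrow> real"
  assumes "antimono \<eta>"
  shows "\<eta> \<in> borel_measurable borel"
proof -
  have "mono (\<lambda>t. - \<eta> t)" using assms by (auto simp: mono_def antimono_def)
  then have "(\<lambda>t. - (- \<eta> t)) \<in> borel_measurable borel"
    by (intro borel_measurable_uminus borel_measurable_mono)
  then show ?thesis by simp
qed

lemma has_derivative_directional_seq:
  fixes \<psi> :: "'b::real_normed_vector \<Rightarrow> 'a::real_normed_vector"
  assumes D: "(\<psi> has_derivative D) (at a)" and \<epsilon>: "\<And>n. 0 < \<epsilon> n" "\<epsilon> \<longlonglongrightarrow> 0"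
  shows "(\<lambda>n. (\<psi> (a + \<epsilon> n *\<^sub>R h) - \<psi> a) /\<^sub>R \<epsilon> n) \<longlonglongrightarrow> D h"
proof -
  have "((\<lambda>t. a + t *\<^sub>R h) has_derivative (\<lambda>t. t *\<^sub>R h)) (at 0)"
    by (auto intro!: derivative_eq_intros)
  moreover have "(\<psi> has_derivative D) (at (a + 0 *\<^sub>R h))" using D by simp
  ultimately have "((\<lambda>t. \<psi> (a + t *\<^sub>R h)) has_derivative (\<lambda>t. D (t *\<^sub>R h))) (at 0)"
    by (rule has_derivative_compose)
  moreover have "D (t *\<^sub>R h) = t *\<^sub>R D h" for t
    using linear_cmul[OF has_derivative_linear[OF D]] .
  ultimately have "((\<lambda>t. \<psi> (a + t *\<^sub>R h)) has_derivative (\<lambda>t. t *\<^sub>R D h)) (at 0)"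
    by simp
  then have lim: "((\<lambda>t. (\<psi> (a + t *\<^sub>R h) - \<psi> a - t *\<^sub>R D h) /\<^sub>R \<bar>t\<bar>) \<longlongrightarrow> 0) (at 0)"
    by (simp add: has_derivative_at_within)
  have at0: "filterlim \<epsilon> (at 0) sequentially"
    using \<epsilon> by (intro filterlim_atI) (auto intro!: always_eventually simp: less_imp_neq[symmetric])
  have "(\<lambda>n. (\<psi> (a + \<epsilon> n *\<^sub>R h) - \<psi> a - \<epsilon> n *\<^sub>R D h) /\<^sub>R \<bar>\<epsilon> n\<bar>) \<longlonglongrightarrow> 0"
    by (rule filterlim_compose[OF lim at0])
  moreover have "(\<psi> (a + \<epsilon> n *\<^sub>R h) - \<psi> a - \<epsilon> n *\<^sub>R D h) /\<^sub>R \<bar>\<epsilon> n\<bar> =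
      (\<psi> (a + \<epsilon> n *\<^sub>R h) - \<psi> a) /\<^sub>R \<epsilon> n - D h" for n
    using \<epsilon>(1)[of n] by (simp add: scaleR_diff_right)
  ultimately show ?thesis
    by (simp add: LIM_zero_iff)
qed

text \<open>Blow-up: with b = a + \<epsilon> h the integrand tends to \<eta>(|D h|) p(\<psi> a) J(a)
  wherever \<eta> is continuous at |D h|, hence a.e. As \<eta> vanishes beyond 1 and |h| is at most
  L times the rescaled distance, all integrands live on the ball of radius L, and dominated
  convergence applies.\<close>

lemma vol_chart_kint_limit:
  fixes \<psi> :: "'b::euclidean_space \<Rightarrow> 'a::euclidean_space"
  assumes chart: "vol_chart \<nu> M \<Omega> \<psi> J L" and M: "compact M" "sets \<nu> = sets borel" "emeasure \<nu> (- M) = 0"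
    and a: "a \<in> \<Omega>"
    and \<eta>: "antimono \<eta>" "\<And>t. 0 \<le> \<eta> t" "\<And>t. 1 < t \<Longrightarrow> \<eta> t = 0"
    and p [measurable]: "p \<in> borel_measurable borel" and pcont: "continuous_on M p"
    and pC: "\<And>x. x \<in> M \<Longrightarrow> 0 \<le> p x \<and> p x \<le> C"
    and \<epsilon>: "\<And>n. 0 < \<epsilon> n" "\<epsilon> \<longlonglongrightarrow> 0"
  shows "\<exists>l. (\<lambda>n. ennreal ((1 / \<epsilon> n) ^ DIM('b)) * kint \<nu> \<eta> p (\<epsilon> n) (\<psi> a)) \<longlonglongrightarrow> ennreal l"
proof -
  obtain U where U: "open U" "\<psi> ` \<Omega> = M \<inter> U"
    using chart unfolding vol_chart_def by blast
  have \<Omega>: "open \<Omega>" "0 < L" and [measurable]: "\<psi> \<in> borel_measurable borel" "J \<in> borel_measurable borel"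
    and expand: "\<And>b c. b \<in> \<Omega> \<Longrightarrow> c \<in> \<Omega> \<Longrightarrow> dist b c \<le> L * dist (\<psi> b) (\<psi> c)"
    and JL: "\<And>b. b \<in> \<Omega> \<Longrightarrow> 1 / L \<le> J b" "\<And>b. b \<in> \<Omega> \<Longrightarrow> J b \<le> L" and Jcont: "continuous_on \<Omega> J"
    using chart unfolding vol_chart_def by auto
  have [measurable]: "\<Omega> \<in> sets borel" using \<Omega>(1) by simp
  have [measurable]: "\<eta> \<in> borel_measurable borel" using \<eta>(1) by (rule antimono_borel)
  have J0: "0 \<le> J b" if "b \<in> \<Omega>" for b
    using JL(1)[OF that] \<Omega>(2) by (meson divide_nonneg_pos order_trans zero_le_one)
  have inM: "\<psi> b \<in> M" "\<psi> b \<in> U" if "b \<in> \<Omega>" for b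
    using that U(2) by blast+
  have C0: "0 \<le> C" using pC inM(1)[OF a] by (meson order_trans)
  obtain D where D: "(\<psi> has_derivative D) (at a)"
    using chart a unfolding vol_chart_def by blast
  have linD: "linear D" using D by (rule has_derivative_linear)
  have ball_seq: "(\<lambda>n. a + \<epsilon> n *\<^sub>R h) \<longlonglongrightarrow> a" for h
  proof -
    have "(\<lambda>n. a + \<epsilon> n *\<^sub>R h) \<longlonglongrightarrow> a + 0 *\<^sub>R h" by (intro tendsto_intros \<epsilon>)
    then show ?thesis by simp
  qed
  have ev\<Omega>: "\<forall>\<^sub>F n in sequentially. a + \<epsilon> n *\<^sub>R h \<in> \<Omega>" for h
    using topological_tendstoD[OF ball_seq \<Omega>(1) a] .
  define q where "q n h = (\<psi> (a + \<epsilon> n *\<^sub>R h) - \<psi> a) /\<^sub>R \<epsilon> n" for n h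
  have q: "(\<lambda>n. q n h) \<longlonglongrightarrow> D h" for h
    unfolding q_def by (rule has_derivative_directional_seq[OF D \<epsilon>])
  have normq: "dist (\<psi> a) (\<psi> (a + \<epsilon> n *\<^sub>R h)) / \<epsilon> n = norm (q n h)" for n h
    using \<epsilon>(1)[of n] by (simp add: q_def dist_norm norm_minus_commute divide_inverse mult.commute)
  have h_le: "norm h \<le> L * norm (q n h)" if "a + \<epsilon> n *\<^sub>R h \<in> \<Omega>" for n h
  proof -
    have "dist a (a + \<epsilon> n *\<^sub>R h) \<le> L * dist (\<psi> a) (\<psi> (a + \<epsilon> n *\<^sub>R h))" using expand a that by blast
    then have "\<epsilon> n * norm h \<le> \<epsilon> n * (L * norm (q n h))"
      using \<epsilon>(1)[of n] normq[of n h] by (simp add: dist_norm field_simps)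
    then show ?thesis using \<epsilon>(1)[of n] by simp
  qed
  \<comment> \<open>The lower Lipschitz bound survives in the limit and makes \<open>D\<close>
    injective.\<close>
  have h_le_D: "norm h \<le> L * norm (D h)" for h
  proof (rule LIMSEQ_le_const)
    show "(\<lambda>n. L * norm (q n h)) \<longlonglongrightarrow> L * norm (D h)" by (intro tendsto_intros q)
    show "\<exists>N. \<forall>n\<ge>N. norm h \<le> L * norm (q n h)"
      using ev\<Omega>[of h] h_le unfolding eventually_sequentially by blast
  qed
  have injD: "inj D"
  proof (rule injI)
    fix x y assume "D x = D y"
    then have "D (x - y) = 0" by (simp add: linear_diff[OF linD])
    then have "norm (x - y) \<le> 0" using h_le_D[of "x - y"] by simp
    then show "x = y" by simp
  qed
  define H where "H n h = ennreal (\<eta> (norm (q n h)) * p (\<psi> (a + \<epsilon> n *\<^sub>R h))) * ennreal (J (a + \<epsilon> n *\<^sub>R h)) * indicator \<Omega> (a + \<epsilon> n *\<^sub>R h)" for n h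
  have [measurable]: "H n \<in> borel_measurable borel" for n
    unfolding H_def q_def by measurable
  define H0 where "H0 h = ennreal (\<eta> (norm (D h)) * p (\<psi> a)) * ennreal (J a)" for h
  have contD: "continuous_on UNIV D"
    using linD linear_continuous_on by (auto simp: linear_conv_bounded_linear)
  have [measurable]: "D \<in> borel_measurable borel"
    using contD by (rule borel_measurable_continuous_onI)
  have [measurable]: "H0 \<in> borel_measurable borel"
    unfolding H0_def by measurable
  have lim: "AE h in lborel. (\<lambda>n. H n h) \<longlonglongrightarrow> H0 h"
    using AE_isCont_norm_linear[OF linD injD \<eta>(1)]
  proof eventually_elim
    case (elim h)
    have 1: "(\<lambda>n. \<eta> (norm (q n h))) \<longlonglongrightarrow> \<eta> (norm (D h))"
      by (rule isCont_tendsto_compose[OF elim]) (intro tendsto_intros q)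
    have "isCont \<psi> a" using D has_derivative_continuous by blast
    then have "(\<lambda>n. \<psi> (a + \<epsilon> n *\<^sub>R h)) \<longlonglongrightarrow> \<psi> a"
      by (rule isCont_tendsto_compose[OF _ ball_seq])
    then have 2: "(\<lambda>n. p (\<psi> (a + \<epsilon> n *\<^sub>R h))) \<longlonglongrightarrow> p (\<psi> a)"
      by (rule continuous_on_tendsto_compose[OF pcont])
        (use inM a ev\<Omega>[of h] in \<open>auto elim: eventually_mono\<close>)
    have 3: "(\<lambda>n. J (a + \<epsilon> n *\<^sub>R h)) \<longlonglongrightarrow> J a"
      by (rule continuous_on_tendsto_compose[OF Jcont ball_seq a ev\<Omega>])
    have "(\<lambda>n. ennreal (\<eta> (norm (q n h)) * p (\<psi> (a + \<epsilon> n *\<^sub>R h)) * J (a + \<epsilon> n *\<^sub>R h)))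
       \<longlonglongrightarrow> ennreal (\<eta> (norm (D h)) * p (\<psi> a) * J a)"
      by (intro tendsto_ennrealI tendsto_mult 1 2 3)
    moreover have "\<forall>\<^sub>F n in sequentially. ennreal (\<eta> (norm (q n h)) * p (\<psi> (a + \<epsilon> n *\<^sub>R h)) * J (a + \<epsilon> n *\<^sub>R h)) = H n h"
      using ev\<Omega>[of h]
    proof eventually_elim
      case (elim n)
      then show ?case
        using J0[OF elim] \<eta>(2) pC inM[OF elim] by (simp add: H_def ennreal_mult)
    qed
    moreover have "ennreal (\<eta> (norm (D h)) * p (\<psi> a) * J a) = H0 h"
      using J0[OF a] \<eta>(2) pC inM[OF a] by (simp add: H0_def ennreal_mult)
    ultimately show ?case by (simp add: Lim_transform_eventually)
  qed
  have bound: "H n h \<le> ennreal (\<eta> 0 * C * L) * indicator (cball 0 L) h" for n h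
  proof (cases "a + \<epsilon> n *\<^sub>R h \<in> \<Omega> \<and> norm (q n h) \<le> 1")
    case True
    have "norm h \<le> L * norm (q n h)" using h_le True by blast
    also have "\<dots> \<le> L" using True \<Omega>(2) by simp
    finally have "h \<in> cball 0 L" by simp
    have "\<eta> (norm (q n h)) * p (\<psi> (a + \<epsilon> n *\<^sub>R h)) * J (a + \<epsilon> n *\<^sub>R h) \<le> \<eta> 0 * C * L"
      using True \<eta>(2) antimonoD[OF \<eta>(1), of 0 "norm (q n h)"] pC inM JL J0 C0
      by (intro mult_mono mult_nonneg_nonneg) auto
    moreover have "H n h = ennreal (\<eta> (norm (q n h)) * p (\<psi> (a + \<epsilon> n *\<^sub>R h)) * J (a + \<epsilon> n *\<^sub>R h))"
      using True J0 \<eta>(2) pC inM by (simp add: H_def ennreal_mult)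
    ultimately show ?thesis using \<open>h \<in> cball 0 L\<close> by (simp add: ennreal_leI)
  next
    case False
    then have "H n h = 0" using \<eta>(3)[of "norm (q n h)"] by (auto simp: H_def indicator_def)
    then show ?thesis by simp
  qed
  have boundint: "(\<integral>\<^sup>+h. ennreal (\<eta> 0 * C * L) * indicator (cball 0 L) (h::'b) \<partial>lborel) < \<infinity>"
    using emeasure_bounded_finite[OF bounded_cball[of "0 :: 'b" L]]
    by (subst nn_integral_cmult_indicator) (auto simp: ennreal_mult_less_top)
  have [measurable]: "cball (0::'b) L \<in> sets borel" by simp
  have dom_meas: "(\<lambda>h::'b. ennreal (\<eta> 0 * C * L) * indicator (cball 0 L) h) \<in> borel_measurable borel"
    by measurable
  have conv: "(\<lambda>n. \<integral>\<^sup>+h. H n h \<partial>lborel) \<longlonglongrightarrow> (\<integral>\<^sup>+h. H0 h \<partial>lborel)"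
    by (rule nn_integral_dominated_convergence[OF _ _ _ _ boundint lim])
      (use bound dom_meas in auto)
  have "(\<integral>\<^sup>+h. H0 h \<partial>lborel) \<le> (\<integral>\<^sup>+h. ennreal (\<eta> 0 * C * L) * indicator (cball 0 L) (h::'b) \<partial>lborel)"
  proof (rule tendsto_upperbound[OF conv])
    show "\<forall>\<^sub>F n in sequentially. (\<integral>\<^sup>+h. H n h \<partial>lborel) \<le> (\<integral>\<^sup>+h. ennreal (\<eta> 0 * C * L) * indicator (cball 0 L) (h::'b) \<partial>lborel)"
      by (intro always_eventually allI nn_integral_mono bound)
  qed simp
  then have "(\<integral>\<^sup>+h. H0 h \<partial>lborel) < \<infinity>" using boundint by (rule le_less_trans)
  then obtain l where l: "(\<integral>\<^sup>+h. H0 h \<partial>lborel) = ennreal l"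
    by (cases "\<integral>\<^sup>+h. H0 h \<partial>lborel") auto
  obtain \<delta> where \<delta>: "0 < \<delta>" "ball (\<psi> a) \<delta> \<subseteq> U"
    using U(1) inM(2)[OF a] open_contains_ball by blast
  have aeM: "AE z in \<nu>. z \<in> M"
    using M borel_compact[OF M(1)] by (intro AE_I[of _ _ "- M"]) auto
  \<comment> \<open>For \<epsilon> n < \<delta> the kernel centred at \<psi> a sees only the part of
    \<open>M\<close> inside \<open>U\<close>, which the chart covers.\<close>
  have eq: "ennreal ((1 / \<epsilon> n) ^ DIM('b)) * kint \<nu> \<eta> p (\<epsilon> n) (\<psi> a) = (\<integral>\<^sup>+h. H n h \<partial>lborel)" if n: "\<epsilon> n < \<delta>" for n
  proof -
    have "kint \<nu> \<eta> p (\<epsilon> n) (\<psi> a) = (\<integral>\<^sup>+z\<in>\<psi> ` \<Omega>. ennreal (\<eta> (dist (\<psi> a) z / \<epsilon> n) * p z) \<partial>\<nu>)"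
      unfolding kint_def
    proof (rule nn_integral_cong_AE, use aeM in eventually_elim)
      case (elim z)
      show ?case
      proof (cases "z \<in> U")
        case True
        then show ?thesis using elim U(2) by simp
      next
        case False
        then have "\<delta> \<le> dist (\<psi> a) z" using \<delta>(2) by (meson mem_ball not_le subsetD)
        then have "1 < dist (\<psi> a) z / \<epsilon> n" using n \<epsilon>(1)[of n] by simp
        then show ?thesis using \<eta>(3) by simp
      qed
    qed
    also have "\<dots> = (\<integral>\<^sup>+b\<in>\<Omega>. ennreal (\<eta> (dist (\<psi> a) (\<psi> b) / \<epsilon> n) * p (\<psi> b)) * ennreal (J b) \<partial>lborel)"
      by (rule vol_chart_integral[OF chart M(1)]) auto
    finally have "ennreal ((1 / \<epsilon> n) ^ DIM('b)) * kint \<nu> \<eta> p (\<epsilon> n) (\<psi> a) =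
        ennreal ((1 / \<epsilon> n) ^ DIM('b)) * (\<integral>\<^sup>+b\<in>\<Omega>. ennreal (\<eta> (dist (\<psi> a) (\<psi> b) / \<epsilon> n) * p (\<psi> b)) * ennreal (J b) \<partial>lborel)"
      by simp
    also have "\<dots> = (\<integral>\<^sup>+h. ennreal (\<eta> (dist (\<psi> a) (\<psi> (a + \<epsilon> n *\<^sub>R h)) / \<epsilon> n) * p (\<psi> (a + \<epsilon> n *\<^sub>R h))) * ennreal (J (a + \<epsilon> n *\<^sub>R h)) * indicator \<Omega> (a + \<epsilon> n *\<^sub>R h) \<partial>lborel)"
      by (rule nn_integral_lborel_scale[symmetric]) (use \<epsilon>(1) in auto)
    also have "\<dots> = (\<integral>\<^sup>+h. H n h \<partial>lborel)"
      by (simp add: H_def normq)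
    finally show ?thesis .
  qed
  have "\<forall>\<^sub>F n in sequentially. (\<integral>\<^sup>+h. H n h \<partial>lborel) = ennreal ((1 / \<epsilon> n) ^ DIM('b)) * kint \<nu> \<eta> p (\<epsilon> n) (\<psi> a)"
    using order_tendstoD(2)[OF \<epsilon>(2) \<delta>(1)] by eventually_elim (simp add: eq)
  then have "(\<lambda>n. ennreal ((1 / \<epsilon> n) ^ DIM('b)) * kint \<nu> \<eta> p (\<epsilon> n) (\<psi> a)) \<longlonglongrightarrow> ennreal l"
    using conv unfolding l by (rule Lim_transform_eventually[rotated])
  then show ?thesis by blast
qed

text \<open>The point x ranges over the whole space because the share of one manifold is also
  evaluated on the other. Off the compact set \<open>M\<close> there is a positive distance to it,
  and the integral vanishes once \<epsilon> is smaller.\<close>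

lemma charted_kint_limit:
  fixes \<nu> :: "'a::euclidean_space measure"
  assumes charted: "charted TYPE('b::euclidean_space) \<nu> M"
    and \<eta>: "antimono \<eta>" "\<And>t. 0 \<le> \<eta> t" "\<And>t. 1 < t \<Longrightarrow> \<eta> t = 0"
    and p: "p \<in> borel_measurable borel" "continuous_on M p"
    and pC: "\<And>x. x \<in> M \<Longrightarrow> 0 \<le> p x \<and> p x \<le> C"
    and \<epsilon>: "\<And>n. 0 < \<epsilon> n" "\<epsilon> \<longlonglongrightarrow> 0"
  shows "\<exists>l. (\<lambda>n. ennreal ((1 / \<epsilon> n) ^ DIM('b)) * kint \<nu> \<eta> p (\<epsilon> n) x) \<longlonglongrightarrow> ennreal l"
proof (cases "x \<in> M")
  case True
  then obtain \<Omega> and \<psi> :: "'b \<Rightarrow> 'a" and J L a where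
    chart: "vol_chart \<nu> M \<Omega> \<psi> J L" and a: "a \<in> \<Omega>" "\<psi> a = x"
    using charted unfolding charted_def by blast
  have "compact M" "sets \<nu> = sets borel" "emeasure \<nu> (- M) = 0"
    using charted unfolding charted_def by auto
  from vol_chart_kint_limit[OF chart this a(1) \<eta> p pC \<epsilon>] show ?thesis
    using a(2) by simp
next
  case False
  have M: "compact M" "sets \<nu> = sets borel" "emeasure \<nu> (- M) = 0"
    using charted unfolding charted_def by auto
  have aeM: "AE z in \<nu>. z \<in> M"
    by (rule charted_AE[OF charted])
  have "open (- M)" using M(1) compact_imp_closed by auto
  then obtain \<delta> where \<delta>: "0 < \<delta>" "ball x \<delta> \<subseteq> - M"
    using False by (meson ComplI open_contains_ball)
  have "kint \<nu> \<eta> p (\<epsilon> n) x = 0" if "\<epsilon> n < \<delta>" for n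
  proof -
    have "AE z in \<nu>. ennreal (\<eta> (dist x z / \<epsilon> n) * p z) = 0"
      using aeM
    proof eventually_elim
      case (elim z)
      then have "\<delta> \<le> dist x z" using \<delta>(2) by (meson ComplD mem_ball not_le subsetD)
      then have "1 < dist x z / \<epsilon> n" using that \<epsilon>(1)[of n] by simp
      then show ?case using \<eta>(3) by simp
    qed
    then have "kint \<nu> \<eta> p (\<epsilon> n) x = (\<integral>\<^sup>+z. 0 \<partial>\<nu>)"
      unfolding kint_def by (rule nn_integral_cong_AE)
    then show ?thesis by simp
  qed
  then have "\<forall>\<^sub>F n in sequentially. ennreal ((1 / \<epsilon> n) ^ DIM('b)) * kint \<nu> \<eta> p (\<epsilon> n) x = 0"
    using order_tendstoD(2)[OF \<epsilon>(2) \<delta>(1)] by (auto elim!: eventually_mono)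
  then have "(\<lambda>n. ennreal ((1 / \<epsilon> n) ^ DIM('b)) * kint \<nu> \<eta> p (\<epsilon> n) x) \<longlonglongrightarrow> ennreal 0"
    by (simp add: tendsto_eventually)
  then show ?thesis by blast
qed

section \<open>Nonlocal Rellich compactness\<close>

lemma approximable_empty: "approximable M f {}"
  unfolding approximable_def by (intro allI impI exI[of _ "{}"]) auto

lemma approximable_Un:
  assumes "approximable M f K1" "approximable M f K2"
  shows "approximable M f (K1 \<union> K2)"
  unfolding approximable_def
proof (intro allI impI)
  fix e :: real assume "0 < e"
  then have "0 < e / 2" by simp
  define S where "S \<A> n c = (\<Sum>A\<in>\<A>. \<integral>\<^sup>+x. ennreal ((f n x - c A)\<^sup>2) * indicator A x \<partial>M)" 
    for \<A> n and c :: "'a set \<Rightarrow> real"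
  obtain \<A>1 where 1: "finite \<A>1" "\<A>1 \<subseteq> sets M" "K1 \<subseteq> \<Union>\<A>1" "\<forall>\<^sub>F n in sequentially. \<exists>c. S \<A>1 n c \<le> ennreal (e / 2)"
    using assms(1)[unfolded approximable_def, rule_format, OF \<open>0 < e / 2\<close>, folded S_def]
    by (elim exE conjE) (rule that, assumption+)
  obtain \<A>2 where 2: "finite \<A>2" "\<A>2 \<subseteq> sets M" "K2 \<subseteq> \<Union>\<A>2" "\<forall>\<^sub>F n in sequentially. \<exists>c. S \<A>2 n c \<le> ennreal (e / 2)"
    using assms(2)[unfolded approximable_def, rule_format, OF \<open>0 < e / 2\<close>, folded S_def]
    by (elim exE conjE) (rule that, assumption+)
  have "\<forall>\<^sub>F n in sequentially. \<exists>c. S (\<A>1 \<union> \<A>2) n c \<le> ennreal e"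
    using 1(4) 2(4)
  proof eventually_elim
    case (elim n)
    then obtain c1 c2 where c: "S \<A>1 n c1 \<le> ennreal (e / 2)" "S \<A>2 n c2 \<le> ennreal (e / 2)" by blast
    \<comment> \<open>A set occurring in both families keeps the constant of the first; the second
      family is then charged on \<open>\<A>2 - \<A>1\<close> only.\<close>
    define c where "c A = (if A \<in> \<A>1 then c1 A else c2 A)" for A
    have "S (\<A>1 \<union> \<A>2) n c = S \<A>1 n c + S (\<A>2 - \<A>1) n c"
      unfolding S_def using 1(1) 2(1) by (subst sum.union_disjoint[symmetric]) (auto simp: Un_Diff_cancel)
    also have "S \<A>1 n c = S \<A>1 n c1"
      unfolding S_def c_def by (intro sum.cong) auto
    also have "S (\<A>2 - \<A>1) n c = S (\<A>2 - \<A>1) n c2"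
      unfolding S_def c_def by (intro sum.cong) auto
    also have "S (\<A>2 - \<A>1) n c2 \<le> S \<A>2 n c2"
      unfolding S_def using 2(1) by (intro sum_mono2) auto
    also have "S \<A>1 n c1 + S \<A>2 n c2 \<le> ennreal (e / 2) + ennreal (e / 2)"
      by (intro add_mono c)
    also have "\<dots> = ennreal (e / 2 + e / 2)"
      using \<open>0 < e\<close> by (intro ennreal_plus[symmetric]) auto
    finally show ?case by (intro exI[of _ c]) (simp add: add_left_mono)
  qed
  then show "\<exists>\<A>. finite \<A> \<and> \<A> \<subseteq> sets M \<and> K1 \<union> K2 \<subseteq> \<Union>\<A> \<and>
      (\<forall>\<^sub>F n in sequentially. \<exists>c :: 'a set \<Rightarrow> real.
         (\<Sum>A\<in>\<A>. \<integral>\<^sup>+x. ennreal ((f n x - c A)\<^sup>2) * indicator A x \<partial>M) \<le> ennreal e)"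
    using 1(1-3) 2(1-3) unfolding S_def by (intro exI[of _ "\<A>1 \<union> \<A>2"]) auto
qed

lemma approximable_compact:
  fixes K :: "'a::topological_space set"
  assumes K: "compact K" and loc: "\<And>x. x \<in> K \<Longrightarrow> \<exists>U. open U \<and> x \<in> U \<and> approximable M f (K \<inter> U)"
  shows "approximable M f K"
proof -
  have "K \<subseteq> \<Union>{U. open U \<and> approximable M f (K \<inter> U)}"
    using loc by blast
  then obtain \<D> where \<D>: "\<D> \<subseteq> {U. open U \<and> approximable M f (K \<inter> U)}" "finite \<D>" "K \<subseteq> \<Union>\<D>"
    by (rule compactE[OF K]) auto
  have "approximable M f (K \<inter> \<Union>\<D>)"
    using \<D>(2,1)
  proof (induction \<D> rule: finite_induct)
    case empty
    then show ?case by (simp add: approximable_empty)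
  next
    case (insert U \<D>)
    then have "approximable M f ((K \<inter> U) \<union> (K \<inter> \<Union>\<D>))"
      by (intro approximable_Un) auto
    then show ?case by (simp add: Int_Un_distrib)
  qed
  moreover have "K \<inter> \<Union>\<D> = K" using \<D>(3) by blast
  ultimately show ?thesis by simp
qed

text \<open>Distance at most r/L in the chart implies distance at most r on the manifold. As the
  density is at least 1/L, each of the two integrations costs one factor \<open>L\<close>.\<close>

lemma vol_chart_osc_le:
  fixes \<psi> :: "'b::euclidean_space \<Rightarrow> 'a::euclidean_space"
  assumes chart: "vol_chart \<nu> M \<Omega> \<psi> J L" and M: "compact M" "sets \<nu> = sets borel" "finite_measure \<nu>"
    and [measurable]: "f \<in> borel_measurable borel"
    and Q [measurable]: "Q \<in> sets borel" and Q\<Omega>: "Q \<subseteq> \<Omega>"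
  shows "osc lborel Q (\<lambda>b. f (\<psi> b)) (r / L) \<le> ennreal (L\<^sup>2) * osc \<nu> UNIV f r"
proof -
  interpret finite_measure \<nu> by fact
  have L: "0 < L" and [measurable]: "\<psi> \<in> borel_measurable borel" "J \<in> borel_measurable borel"
    and lip: "\<And>b c. b \<in> \<Omega> \<Longrightarrow> c \<in> \<Omega> \<Longrightarrow> dist (\<psi> b) (\<psi> c) \<le> L * dist b c"
    and JL: "\<And>b. b \<in> \<Omega> \<Longrightarrow> 1 / L \<le> J b"
    using chart unfolding vol_chart_def by auto
  define g where "g x y = ennreal ((f x - f y)\<^sup>2) * indicator {..r} (dist x y)" for x y
  have [measurable]: "(\<lambda>z. g (s z) (t z)) \<in> borel_measurable N"
    if [measurable]: "s \<in> borel_measurable N" "t \<in> borel_measurable N" for s t and N :: "'c measure"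
    unfolding g_def by measurable
  have [measurable_cong]: "sets \<nu> = sets borel" by fact
  have \<psi>Q [measurable]: "\<psi> ` Q \<in> sets borel"
    by (rule vol_chart_image_borel[OF chart M(1) Q Q\<Omega>])
  have LJ: "1 \<le> ennreal L * ennreal (J b)" if "b \<in> Q" for b
  proof -
    have "b \<in> \<Omega>" using that Q\<Omega> by blast
    then have "1 \<le> L * J b" using JL[of b] L by (simp add: field_simps)
    moreover have "0 \<le> J b" using JL[OF \<open>b \<in> \<Omega>\<close>] L by (meson divide_nonneg_pos order_trans zero_le_one)
    ultimately show ?thesis using L by (simp add: ennreal_mult[symmetric])
  qed
  have transfer: "(\<integral>\<^sup>+b\<in>Q. h (\<psi> b) \<partial>lborel) \<le> ennreal L * (\<integral>\<^sup>+x\<in>\<psi> ` Q. h x \<partial>\<nu>)"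
    if [measurable]: "h \<in> borel_measurable borel" for h
  proof -
    have "(\<integral>\<^sup>+b\<in>Q. h (\<psi> b) \<partial>lborel) \<le> (\<integral>\<^sup>+b. ennreal L * (h (\<psi> b) * ennreal (J b) * indicator Q b) \<partial>lborel)"
    proof (rule nn_integral_mono)
      fix b
      show "h (\<psi> b) * indicator Q b \<le> ennreal L * (h (\<psi> b) * ennreal (J b) * indicator Q b)"
      proof (cases "b \<in> Q")
        case True
        have "h (\<psi> b) * 1 \<le> h (\<psi> b) * (ennreal L * ennreal (J b))"
          by (intro mult_left_mono LJ True) simp
        then show ?thesis using True by (simp add: mult_ac)
      qed simp
    qed
    also have "\<dots> = ennreal L * (\<integral>\<^sup>+b\<in>Q. h (\<psi> b) * ennreal (J b) \<partial>lborel)"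
      by (rule nn_integral_cmult) measurable
    also have "(\<integral>\<^sup>+b\<in>Q. h (\<psi> b) * ennreal (J b) \<partial>lborel) = (\<integral>\<^sup>+x\<in>\<psi> ` Q. h x \<partial>\<nu>)"
      by (rule vol_chart_integral[OF chart M(1) Q Q\<Omega> that, symmetric])
    finally show ?thesis .
  qed
  have "osc lborel Q (\<lambda>b. f (\<psi> b)) (r / L) \<le> (\<integral>\<^sup>+b\<in>Q. (\<integral>\<^sup>+c\<in>Q. g (\<psi> b) (\<psi> c) \<partial>lborel) \<partial>lborel)"
    unfolding osc_def
  proof (rule nn_integral_mono)
    fix b
    show "(\<integral>\<^sup>+c. ennreal ((f (\<psi> b) - f (\<psi> c))\<^sup>2) * (indicator Q b * indicator Q c * indicator {..r / L} (dist b c)) \<partial>lborel)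
      \<le> (\<integral>\<^sup>+c\<in>Q. g (\<psi> b) (\<psi> c) \<partial>lborel) * indicator Q b"
    proof (cases "b \<in> Q")
      case True
      have "(\<integral>\<^sup>+c. ennreal ((f (\<psi> b) - f (\<psi> c))\<^sup>2) * (indicator Q b * indicator Q c * indicator {..r / L} (dist b c)) \<partial>lborel)
        \<le> (\<integral>\<^sup>+c\<in>Q. g (\<psi> b) (\<psi> c) \<partial>lborel)"
      proof (rule nn_integral_mono)
        fix c
        show "ennreal ((f (\<psi> b) - f (\<psi> c))\<^sup>2) * (indicator Q b * indicator Q c * indicator {..r / L} (dist b c))
          \<le> g (\<psi> b) (\<psi> c) * indicator Q c"
        proof (cases "c \<in> Q \<and> dist b c \<le> r / L")
          case close: True
          have "dist (\<psi> b) (\<psi> c) \<le> L * dist b c" using lip True close Q\<Omega> by blast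
          also have "\<dots> \<le> L * (r / L)" using close L by (intro mult_left_mono) auto
          finally have "dist (\<psi> b) (\<psi> c) \<le> r" using L by simp
          then show ?thesis using True close by (simp add: g_def)
        next
          case False
          then have "indicator Q c = (0 :: ennreal) \<or> indicator {..r / L} (dist b c) = (0 :: ennreal)"
            by (auto simp: indicator_def)
          then show ?thesis by (elim disjE) simp_all
        qed
      qed
      then show ?thesis using True by simp
    qed simp
  qed
  also have "\<dots> \<le> (\<integral>\<^sup>+b\<in>Q. (ennreal L * (\<integral>\<^sup>+y\<in>\<psi> ` Q. g (\<psi> b) y \<partial>\<nu>)) \<partial>lborel)"
    by (intro nn_integral_mono mult_right_mono transfer) (simp_all, measurable)
  also have "\<dots> \<le> ennreal L * (\<integral>\<^sup>+x\<in>\<psi> ` Q. ennreal L * (\<integral>\<^sup>+y\<in>\<psi> ` Q. g x y \<partial>\<nu>) \<partial>\<nu>)"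
    by (rule transfer) measurable
  also have "\<dots> \<le> ennreal L * (\<integral>\<^sup>+x. ennreal L * (\<integral>\<^sup>+y. g x y \<partial>\<nu>) \<partial>\<nu>)"
  proof (intro mult_left_mono nn_integral_mono)
    fix x
    have "(\<integral>\<^sup>+y\<in>\<psi> ` Q. g x y \<partial>\<nu>) \<le> (\<integral>\<^sup>+y. g x y \<partial>\<nu>)"
      by (intro nn_integral_mono) (simp add: indicator_def)
    then have "ennreal L * (\<integral>\<^sup>+y\<in>\<psi> ` Q. g x y \<partial>\<nu>) \<le> ennreal L * (\<integral>\<^sup>+y. g x y \<partial>\<nu>)"
      by (intro mult_left_mono) auto
    then show "ennreal L * (\<integral>\<^sup>+y\<in>\<psi> ` Q. g x y \<partial>\<nu>) * indicator (\<psi> ` Q) x \<le> ennreal L * (\<integral>\<^sup>+y. g x y \<partial>\<nu>)"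
      by (cases "x \<in> \<psi> ` Q") auto
  qed simp
  also have "(\<integral>\<^sup>+x. ennreal L * (\<integral>\<^sup>+y. g x y \<partial>\<nu>) \<partial>\<nu>) = ennreal L * (\<integral>\<^sup>+x. (\<integral>\<^sup>+y. g x y \<partial>\<nu>) \<partial>\<nu>)"
    by (rule nn_integral_cmult) measurable
  also have "(\<integral>\<^sup>+x. (\<integral>\<^sup>+y. g x y \<partial>\<nu>) \<partial>\<nu>) = osc \<nu> UNIV f r"
    by (simp add: osc_def g_def)
  finally show ?thesis
    using L by (simp add: power2_eq_square ennreal_mult mult.assoc)
qed

text \<open>Near each point a cube in a chart is cut into m^d cells. The power \<rho>^(d+2) in the
  Poincare constant, with \<rho> = r0 \<epsilon> / L, cancels against the hypothesis on
  \<open>osc\<close>; the remaining error K/m^2 does not depend on n.\<close>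

lemma charted_approximable:
  fixes \<nu> :: "'a::euclidean_space measure"
  assumes charted: "charted TYPE('b::euclidean_space) \<nu> M"
    and f [measurable]: "\<And>n. f n \<in> borel_measurable borel"
    and \<epsilon>: "\<And>n. 0 < \<epsilon> n" "\<epsilon> \<longlonglongrightarrow> 0" and r0: "0 < r0" and E: "0 \<le> E"
    and osc: "\<And>n. osc \<nu> UNIV (f n) (r0 * \<epsilon> n) \<le> ennreal (E * \<epsilon> n ^ (DIM('b) + 2))"
  shows "approximable \<nu> f M"
proof (rule approximable_compact)
  have M: "compact M" "sets \<nu> = sets borel" "finite_measure \<nu>"
    using charted unfolding charted_def by auto
  show "compact M" by fact
  fix x0 assume "x0 \<in> M"
  then obtain \<Omega> and \<psi> :: "'b \<Rightarrow> 'a" and J L a where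
    chart: "vol_chart \<nu> M \<Omega> \<psi> J L" and a: "a \<in> \<Omega>" "\<psi> a = x0"
    using charted unfolding charted_def by blast
  obtain U where U: "open U" "\<psi> ` \<Omega> = M \<inter> U"
    using chart unfolding vol_chart_def by blast
  have \<Omega>: "open \<Omega>" and L: "0 < L" and [measurable]: "\<psi> \<in> borel_measurable borel"  "J \<in> borel_measurable borel"
    and expand: "\<And>b c. b \<in> \<Omega> \<Longrightarrow> c \<in> \<Omega> \<Longrightarrow> dist b c \<le> L * dist (\<psi> b) (\<psi> c)"
    and JL: "\<And>b. b \<in> \<Omega> \<Longrightarrow> J b \<le> L"
    using chart unfolding vol_chart_def by auto
  note inj = vol_chart_inj[OF chart]
  let ?d = "DIM('b)"
  obtain t where t: "0 < t" "cball a t \<subseteq> \<Omega>"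
    using \<Omega> a(1) open_contains_cball by blast
  \<comment> \<open>Points of a cube of side s are at distance at most s d = t, so the cube centred
    at \<open>a\<close> stays inside \<open>\<Omega>\<close>.\<close>
  define s where "s = t / ?d"
  have s: "0 < s" "s * ?d = t" using t(1) by (auto simp: s_def)
  define l where "l = a - (s / 2) *\<^sub>R One"
  define Q where "Q = hcube l s"
  have lb: "l \<bullet> b = a \<bullet> b - s / 2" if "b \<in> Basis" for b
    using that by (simp add: l_def inner_simps)
  have aQ: "a \<in> Q" using s by (simp add: Q_def hcube_def lb)
  have Q\<Omega>: "Q \<subseteq> \<Omega>"
  proof
    fix b assume "b \<in> Q"
    then have "dist a b \<le> t" using dist_hcube_le[of a l s b] aQ s(2) by (simp add: Q_def)
    then show "b \<in> \<Omega>" using t(2) by auto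
  qed
  have ballQ: "b \<in> Q" if "dist a b < s / 2" for b
    unfolding Q_def hcube_def
  proof (intro CollectI ballI)
    fix i :: 'b assume i: "i \<in> Basis"
    have "\<bar>(b - a) \<bullet> i\<bar> \<le> norm (b - a)" using Basis_le_norm[OF i] by blast
    also have "\<dots> < s / 2" using that by (simp add: dist_norm norm_minus_commute)
    finally have "\<bar>b \<bullet> i - a \<bullet> i\<bar> < s / 2" by (simp only: inner_diff_left)
    then show "l \<bullet> i \<le> b \<bullet> i \<and> b \<bullet> i < l \<bullet> i + s"
      unfolding lb[OF i] by (intro conjI) linarith+
  qed
  \<comment> \<open>The expansion bound puts the parameters of points of \<open>M \<inter> V\<close>
    within s/2 of \<open>a\<close>, hence inside the cube.\<close>
  define V where "V = U \<inter> ball x0 (s / (2 * L))"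
  have V: "open V" "x0 \<in> V" using U a L s by (auto simp: V_def)
  have MV: "M \<inter> V \<subseteq> \<psi> ` Q"
  proof
    fix x assume x: "x \<in> M \<inter> V"
    then have "x \<in> \<psi> ` \<Omega>" unfolding U(2) by (simp add: V_def)
    then obtain b where b: "b \<in> \<Omega>" "x = \<psi> b" by blast
    have "dist a b \<le> L * dist x0 x" using expand[OF a(1) b(1)] a b by simp
    also have "\<dots> < L * (s / (2 * L))" using x L by (intro mult_strict_left_mono) (auto simp: V_def)
    also have "\<dots> = s / 2" using L by simp
    finally show "x \<in> \<psi> ` Q" using ballQ b(2) by blast
  qed
  \<comment> \<open>All constants independent of m and n: one factor L from the upper bound on the
    density, L^2 and E from the oscillation, and (L/r0)^(d+2) from the quotient of \<epsilon> and
    \<rho>.\<close>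
  define K where "K = L * ((2 * real ?d) ^ (?d + 2) * s\<^sup>2 * (L / r0) ^ (?d + 2) * L\<^sup>2 * E)"
  have K0: "0 \<le> K" unfolding K_def using L r0 E by (intro mult_nonneg_nonneg) auto
  have "approximable \<nu> f (M \<inter> V)"
    unfolding approximable_def
  proof (intro allI impI)
    fix e :: real assume e: "0 < e"
    obtain m0 :: nat where m0: "K / e < real m0" using reals_Archimedean2 by blast
    define m where "m = Suc m0"
    have m: "0 < m" by (simp add: m_def)
    have "K / e \<le> real m" using m0 by (simp add: m_def)
    also have "\<dots> \<le> real m * real m" using m by (intro mult_le_cancel_left1[THEN iffD2]) (simp add: m_def)
    finally have "K / (real m)\<^sup>2 \<le> e" using e m by (simp add: field_simps power2_eq_square)
    define cl where "cl k = cell l s m k" for k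
    have clQ: "cl k \<subseteq> Q" if "k \<in> cells m" for k
      unfolding cl_def Q_def hcube_eq_Union_cells[OF s(1) m, of l] using that by blast
    have cl_borel [measurable]: "cl k \<in> sets borel" for k
      unfolding cl_def cell_def by (rule borel_hcube)
    have cl_ne: "cl k \<noteq> {}" for k
    proof -
      have "l + (\<Sum>b\<in>Basis. (real (k b) * (s / m)) *\<^sub>R b) \<in> cl k"
        unfolding cl_def cell_def hcube_def using s m by simp
      then show ?thesis by blast
    qed
    have inj_cl: "inj_on (\<lambda>k. \<psi> ` cl k) (cells m)"
    proof (rule inj_onI)
      fix k k' assume k: "k \<in> cells m" "k' \<in> cells m" "\<psi> ` cl k = \<psi> ` cl k'"
      then have "cl k = cl k'"
        using inj_on_image_eq_iff[OF inj] clQ Q\<Omega> by (meson order_trans)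
      moreover obtain x where "x \<in> cl k" using cl_ne by blast
      ultimately show "k = k'"
        using cell_disjoint[OF s(1) m k(1,2), of x l] by (simp add: cl_def)
    qed
    have [measurable]: "\<psi> ` cl k \<in> sets borel" if "k \<in> cells m" for k
      by (rule vol_chart_image_borel[OF chart M(1) cl_borel]) (use clQ[OF that] Q\<Omega> in blast)
    define \<A> where "\<A> = (\<lambda>k. \<psi> ` cl k) ` cells m"
    have "\<exists>c. (\<Sum>A\<in>\<A>. \<integral>\<^sup>+x. ennreal ((f n x - c A)\<^sup>2) * indicator A x \<partial>\<nu>) \<le> ennreal e"
      if n: "\<epsilon> n < s / m * ?d * L / r0" for n
    proof -
      \<comment> \<open>The condition on n says that \<rho> does not exceed the diameter bound of a
        cell, as the Poincare inequality demands.\<close>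
      define \<rho> where "\<rho> = r0 * \<epsilon> n / L"
      have "r0 * \<epsilon> n \<le> s / m * ?d * L"
        using n r0 by (subst (asm) pos_less_divide_eq) (simp_all add: mult.commute[of r0])
      then have \<rho>: "0 < \<rho>" "\<rho> \<le> s / m * ?d"
        unfolding \<rho>_def using r0 L \<epsilon>(1)[of n] by (simp_all add: pos_divide_le_eq)
      have "\<exists>c. (\<Sum>k\<in>cells m. \<integral>\<^sup>+b\<in>cell l s m k. ennreal ((f n (\<psi> b) - c k)\<^sup>2) \<partial>lborel) \<le>
        ennreal ((2 * real ?d) ^ (?d + 2) * (s / m)\<^sup>2 / \<rho> ^ (?d + 2)) * osc lborel (hcube l s) (\<lambda>b. f n (\<psi> b)) \<rho>"
        by (rule poincare_cells[OF _ s(1) m \<rho>]) measurable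
      then obtain c where c: "(\<Sum>k\<in>cells m. \<integral>\<^sup>+b\<in>cl k. ennreal ((f n (\<psi> b) - c k)\<^sup>2) \<partial>lborel) \<le>
        ennreal ((2 * real ?d) ^ (?d + 2) * (s / m)\<^sup>2 / \<rho> ^ (?d + 2)) * osc lborel Q (\<lambda>b. f n (\<psi> b)) \<rho>"
        unfolding cl_def Q_def by blast
      \<comment> \<open>The Poincare constants are indexed by multi-indices, whereas
        \<open>approximable\<close> indexes by sets. Cells with different indices have different
        images, so the index can be recovered from the set.\<close>
      define c' where "c' A = c (inv_into (cells m) (\<lambda>k. \<psi> ` cl k) A)" for A
      have c': "c' (\<psi> ` cl k) = c k" if "k \<in> cells m" for k
        unfolding c'_def using inv_into_f_f[OF inj_cl that] by simp
      have "(\<Sum>A\<in>\<A>. \<integral>\<^sup>+x. ennreal ((f n x - c' A)\<^sup>2) * indicator A x \<partial>\<nu>) =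
        (\<Sum>k\<in>cells m. \<integral>\<^sup>+x\<in>\<psi> ` cl k. ennreal ((f n x - c k)\<^sup>2) \<partial>\<nu>)"
        unfolding \<A>_def by (subst sum.reindex[OF inj_cl]) (simp add: c')
      also have "\<dots> \<le> (\<Sum>k\<in>cells m. ennreal L * (\<integral>\<^sup>+b\<in>cl k. ennreal ((f n (\<psi> b) - c k)\<^sup>2) \<partial>lborel))"
      proof (rule sum_mono)
        fix k :: "'b \<Rightarrow> nat" assume k: "k \<in> cells m"
        have cl\<Omega>: "cl k \<subseteq> \<Omega>" using clQ[OF k] Q\<Omega> by blast
        have "(\<integral>\<^sup>+x\<in>\<psi> ` cl k. ennreal ((f n x - c k)\<^sup>2) \<partial>\<nu>) = (\<integral>\<^sup>+b\<in>cl k. ennreal ((f n (\<psi> b) - c k)\<^sup>2) * ennreal (J b) \<partial>lborel)"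
          by (rule vol_chart_integral[OF chart M(1) cl_borel cl\<Omega>]) measurable
        also have "\<dots> \<le> (\<integral>\<^sup>+b. ennreal L * (ennreal ((f n (\<psi> b) - c k)\<^sup>2) * indicator (cl k) b) \<partial>lborel)"
        proof (rule nn_integral_mono)
          fix b
          show "ennreal ((f n (\<psi> b) - c k)\<^sup>2) * ennreal (J b) * indicator (cl k) b \<le> ennreal L * (ennreal ((f n (\<psi> b) - c k)\<^sup>2) * indicator (cl k) b)"
          proof (cases "b \<in> cl k")
            case True
            then have "ennreal (J b) \<le> ennreal L" using JL cl\<Omega> by (blast intro: ennreal_leI)
            then have "ennreal ((f n (\<psi> b) - c k)\<^sup>2) * ennreal (J b) \<le> ennreal ((f n (\<psi> b) - c k)\<^sup>2) * ennreal L"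
              by (rule mult_left_mono) simp
            then show ?thesis using True by (simp add: mult.commute)
          qed simp
        qed
        also have "\<dots> = ennreal L * (\<integral>\<^sup>+b\<in>cl k. ennreal ((f n (\<psi> b) - c k)\<^sup>2) \<partial>lborel)"
          by (rule nn_integral_cmult) measurable
        finally show "(\<integral>\<^sup>+x\<in>\<psi> ` cl k. ennreal ((f n x - c k)\<^sup>2) \<partial>\<nu>) \<le> ennreal L * (\<integral>\<^sup>+b\<in>cl k. ennreal ((f n (\<psi> b) - c k)\<^sup>2) \<partial>lborel)" .
      qed
      also have "\<dots> = ennreal L * (\<Sum>k\<in>cells m. \<integral>\<^sup>+b\<in>cl k. ennreal ((f n (\<psi> b) - c k)\<^sup>2) \<partial>lborel)"
        by (rule sum_distrib_left[symmetric])
      also have "\<dots> \<le> ennreal L * (ennreal ((2 * real ?d) ^ (?d + 2) * (s / m)\<^sup>2 / \<rho> ^ (?d + 2)) * (ennreal (L\<^sup>2) * ennreal (E * \<epsilon> n ^ (?d + 2))))"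
      proof (intro mult_left_mono order_trans[OF c])
        have "osc lborel Q (\<lambda>b. f n (\<psi> b)) (r0 * \<epsilon> n / L) \<le> ennreal (L\<^sup>2) * osc \<nu> UNIV (f n) (r0 * \<epsilon> n)"
          by (rule vol_chart_osc_le[OF chart M f _ Q\<Omega>]) (simp add: Q_def)
        also have "\<dots> \<le> ennreal (L\<^sup>2) * ennreal (E * \<epsilon> n ^ (?d + 2))"
          by (intro mult_left_mono osc) simp
        finally show "osc lborel Q (\<lambda>b. f n (\<psi> b)) \<rho> \<le> ennreal (L\<^sup>2) * ennreal (E * \<epsilon> n ^ (?d + 2))"
          by (simp add: \<rho>_def)
      qed simp_all
      also have "\<dots> = ennreal (L * ((2 * real ?d) ^ (?d + 2) * (s / m)\<^sup>2 / \<rho> ^ (?d + 2) * (L\<^sup>2 * (E * \<epsilon> n ^ (?d + 2)))))"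
        using L \<rho>(1) E \<epsilon>(1)[of n] by (simp add: ennreal_mult[symmetric] del: ennreal_power)
      also have "L * ((2 * real ?d) ^ (?d + 2) * (s / m)\<^sup>2 / \<rho> ^ (?d + 2) * (L\<^sup>2 * (E * \<epsilon> n ^ (?d + 2)))) = K / (real m)\<^sup>2"
      proof -
        have "\<epsilon> n ^ (?d + 2) / \<rho> ^ (?d + 2) = (L / r0) ^ (?d + 2)"
          using \<epsilon>(1)[of n] L r0 by (simp add: \<rho>_def power_divide[symmetric] del: power_add power_Suc)
        then have "L * ((2 * real ?d) ^ (?d + 2) * (s / m)\<^sup>2 * (L\<^sup>2 * E) * (\<epsilon> n ^ (?d + 2) / \<rho> ^ (?d + 2))) = K / (real m)\<^sup>2"
          by (simp only: K_def power_divide times_divide_eq_left times_divide_eq_right mult_ac)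
        then show ?thesis by (simp only: times_divide_eq_left times_divide_eq_right mult_ac)
      qed
      also have "ennreal (K / (real m)\<^sup>2) \<le> ennreal e"
        by (rule ennreal_leI) fact
      finally show ?thesis by blast
    qed
    moreover have "\<forall>\<^sub>F n in sequentially. \<epsilon> n < s / m * ?d * L / r0"
      by (rule order_tendstoD(2)[OF \<epsilon>(2)]) (use s(1) m L r0 in simp)
    ultimately have "\<forall>\<^sub>F n in sequentially. \<exists>c. (\<Sum>A\<in>\<A>. \<integral>\<^sup>+x. ennreal ((f n x - c A)\<^sup>2) * indicator A x \<partial>\<nu>) \<le> ennreal e"
      by (auto elim: eventually_mono)
    moreover have "finite \<A>" unfolding \<A>_def by (intro finite_imageI finite_cells)
    moreover have "\<A> \<subseteq> sets \<nu>" unfolding \<A>_def M(2) by auto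
    moreover have "M \<inter> V \<subseteq> \<Union>\<A>"
    proof -
      have "\<psi> ` Q = \<Union>\<A>"
        unfolding \<A>_def Q_def hcube_eq_Union_cells[OF s(1) m, of l] cl_def by blast
      then show ?thesis using MV by simp
    qed
    ultimately show "\<exists>\<A>. finite \<A> \<and> \<A> \<subseteq> sets \<nu> \<and> M \<inter> V \<subseteq> \<Union>\<A> \<and>
      (\<forall>\<^sub>F n in sequentially. \<exists>c :: 'a set \<Rightarrow> real.
         (\<Sum>A\<in>\<A>. \<integral>\<^sup>+x. ennreal ((f n x - c A)\<^sup>2) * indicator A x \<partial>\<nu>) \<le> ennreal e)"
      by blast
  qed
  then show "\<exists>U. open U \<and> x0 \<in> U \<and> approximable \<nu> f (M \<inter> U)"
    using V by blast
qed

lemma charted_precompact: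
  fixes \<nu> :: "'a::euclidean_space measure"
  assumes charted: "charted TYPE('b::euclidean_space) \<nu> M"
    and f: "\<And>n. f n \<in> borel_measurable borel"
    and B: "\<And>n. sqnorm \<nu> (f n) \<le> ennreal B"
    and \<epsilon>: "\<And>n. 0 < \<epsilon> n" "\<epsilon> \<longlonglongrightarrow> 0" and r0: "0 < r0" and E: "0 \<le> E"
    and osc: "\<And>n. osc \<nu> UNIV (f n) (r0 * \<epsilon> n) \<le> ennreal (E * \<epsilon> n ^ (DIM('b) + 2))"
  shows "\<exists>r. strict_mono (r :: nat \<Rightarrow> nat) \<and> L2_cauchy \<nu> (\<lambda>n. f (r n))"
proof (rule L2_precompact)
  have M: "sets \<nu> = sets borel" "finite_measure \<nu>"
    using charted unfolding charted_def by auto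
  show "f n \<in> borel_measurable \<nu>" for n
    using f by (subst measurable_cong_sets[OF M(1) refl])
  show "finite_measure \<nu>" by fact
  show "sqnorm \<nu> (f n) \<le> ennreal B" for n by fact
  show "approximable \<nu> f M"
    by (rule charted_approximable[OF charted f \<epsilon> r0 E osc])
  show "AE x in \<nu>. x \<in> M"
    by (rule charted_AE[OF charted])
qed

section \<open>Weighted sequences\<close>

lemma L2_cauchy_subseq: "L2_cauchy M f \<Longrightarrow> strict_mono r \<Longrightarrow> L2_cauchy M (\<lambda>n. f (r n))"
  unfolding L2_cauchy_def by (meson order_trans seq_suble)

text \<open>With v the limit of f and S that of s, write s f - S v = s (f - v) + (s - S) v. The
  first term is controlled by the bound on s, the second by dominated convergence with majorant
  (2C)^2 v^2. The hypothesis \<open>diff\<close> makes room for a weight that is replaced by an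
  asymptotically equivalent one.\<close>

lemma L2_cauchy_multiplier:
  fixes s f u :: "nat \<Rightarrow> 'a \<Rightarrow> real"
  assumes [measurable]: "\<And>n. f n \<in> borel_measurable M" "\<And>n. u n \<in> borel_measurable M" "\<And>n. s n \<in> borel_measurable M"
    and f: "L2_cauchy M f" "\<And>n. sqnorm M (f n) < \<infinity>"
    and bound: "\<And>n. AE x in M. \<bar>s n x\<bar> \<le> C"
    and conv: "AE x in M. convergent (\<lambda>n. s n x)"
    and diff: "(\<lambda>n. sqnorm M (\<lambda>x. u n x - s n x * f n x)) \<longlonglongrightarrow> 0"
  shows "L2_cauchy M u"
proof -
  obtain v where [measurable]: "v \<in> borel_measurable M" and v: "(\<lambda>n. sqnorm M (\<lambda>x. f n x - v x)) \<longlonglongrightarrow> 0"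
    using L2_complete[OF _ f(1)] by auto
  have "\<forall>\<^sub>F n in sequentially. sqnorm M (\<lambda>x. f n x - v x) < 1"
    by (rule order_tendstoD(2)[OF v]) simp
  then obtain n0 where n0: "sqnorm M (\<lambda>x. f n0 x - v x) < 1"
    unfolding eventually_sequentially by blast
  have vfin: "sqnorm M v < \<infinity>"
  proof -
    have "sqnorm M v \<le> 2 * sqnorm M (\<lambda>x. v x - f n0 x) + 2 * sqnorm M (f n0)"
      by (rule sqnorm_le_diff) auto
    also have "\<dots> < \<infinity>"
      using n0 f(2)[of n0] unfolding sqnorm_minus_commute[of M v] by (auto simp: ennreal_mult_less_top order_less_trans)
    finally show ?thesis .
  qed
  define S where "S x = lim (\<lambda>n. s n x)" for x
  have [measurable]: "S \<in> borel_measurable M" unfolding S_def by measurable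
  have AEbound: "AE x in M. \<forall>n. \<bar>s n x\<bar> \<le> C" using bound by (simp add: AE_all_countable)
  have tail: "(\<lambda>n. \<integral>\<^sup>+x. ennreal ((s n x * v x - S x * v x)\<^sup>2) \<partial>M) \<longlonglongrightarrow> (\<integral>\<^sup>+x. 0 \<partial>M)"
  proof (rule nn_integral_dominated_convergence[where w = "\<lambda>x. ennreal ((2 * C)\<^sup>2) * ennreal ((v x)\<^sup>2)"])
    show "(\<integral>\<^sup>+x. ennreal ((2 * C)\<^sup>2) * ennreal ((v x)\<^sup>2) \<partial>M) < \<infinity>"
      using vfin by (subst nn_integral_cmult) (auto simp: sqnorm_def[symmetric] ennreal_mult_less_top)
    have S: "(\<lambda>n. s n x) \<longlonglongrightarrow> S x" if "convergent (\<lambda>n. s n x)" for x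
      using that by (simp add: S_def convergent_LIMSEQ_iff)
    show "AE x in M. (\<lambda>n. ennreal ((s n x * v x - S x * v x)\<^sup>2)) \<longlonglongrightarrow> 0"
      using conv
    proof eventually_elim
      case (elim x)
      have "(\<lambda>n. ennreal ((s n x * v x - S x * v x)\<^sup>2)) \<longlonglongrightarrow> ennreal ((S x * v x - S x * v x)\<^sup>2)"
        by (intro tendsto_ennrealI tendsto_intros S elim)
      then show ?case by simp
    qed
    fix n
    show "AE x in M. ennreal ((s n x * v x - S x * v x)\<^sup>2) \<le> ennreal ((2 * C)\<^sup>2) * ennreal ((v x)\<^sup>2)"
      using conv AEbound
    proof eventually_elim
      case (elim x)
      have "\<bar>S x\<bar> \<le> C"
        by (rule LIMSEQ_le_const2[OF tendsto_rabs[OF S[OF elim(1)]]]) (use elim(2) in auto)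
      then have "\<bar>s n x - S x\<bar> \<le> 2 * C"
        using elim(2)[rule_format, of n] by linarith
      then have "(s n x - S x)\<^sup>2 \<le> (2 * C)\<^sup>2"
        using power_mono[of "\<bar>s n x - S x\<bar>" "2 * C" 2] by simp
      then have "(s n x - S x)\<^sup>2 * (v x)\<^sup>2 \<le> (2 * C)\<^sup>2 * (v x)\<^sup>2"
        by (rule mult_right_mono) simp
      then show ?case
        by (simp add: ennreal_mult[symmetric] power_mult_distrib[symmetric] left_diff_distrib ennreal_leI)
    qed
  qed auto
  have main: "sqnorm M (\<lambda>x. u n x - S x * v x) \<le>
      2 * sqnorm M (\<lambda>x. u n x - s n x * f n x) + 2 * (2 * (ennreal (C\<^sup>2) * sqnorm M (\<lambda>x. f n x - v x)) +
      2 * (\<integral>\<^sup>+x. ennreal ((s n x * v x - S x * v x)\<^sup>2) \<partial>M))" for n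
  proof -
    have "sqnorm M (\<lambda>x. u n x - S x * v x) \<le> 2 * sqnorm M (\<lambda>x. u n x - s n x * f n x) + 2 * sqnorm M (\<lambda>x. s n x * f n x - S x * v x)"
      by (rule sqnorm_diff_le) auto
    moreover have "sqnorm M (\<lambda>x. s n x * f n x - S x * v x) \<le> 2 * sqnorm M (\<lambda>x. s n x * f n x - s n x * v x) + 2 * sqnorm M (\<lambda>x. s n x * v x - S x * v x)"
      by (rule sqnorm_diff_le) auto
    moreover have "sqnorm M (\<lambda>x. s n x * f n x - s n x * v x) \<le> ennreal (C\<^sup>2) * sqnorm M (\<lambda>x. f n x - v x)"
    proof -
      have "sqnorm M (\<lambda>x. s n x * f n x - s n x * v x) \<le> (\<integral>\<^sup>+x. ennreal (C\<^sup>2) * ennreal ((f n x - v x)\<^sup>2) \<partial>M)"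
        unfolding sqnorm_def
      proof (rule nn_integral_mono_AE, use bound[of n] in eventually_elim)
        case (elim x)
        then have "(s n x)\<^sup>2 \<le> C\<^sup>2" by (simp add: abs_le_square_iff[symmetric])
        then have "(s n x)\<^sup>2 * (f n x - v x)\<^sup>2 \<le> C\<^sup>2 * (f n x - v x)\<^sup>2"
          by (rule mult_right_mono) simp
        then show ?case
          by (simp add: ennreal_mult[symmetric] power_mult_distrib[symmetric] right_diff_distrib ennreal_leI)
      qed
      also have "\<dots> = ennreal (C\<^sup>2) * sqnorm M (\<lambda>x. f n x - v x)"
        unfolding sqnorm_def by (rule nn_integral_cmult) measurable
      finally show ?thesis .
    qed
    ultimately show ?thesis
      unfolding sqnorm_def[of M "\<lambda>x. s n x * v x - S x * v x", symmetric]
      by (meson add_mono mult_left_mono order_refl order_trans zero_le)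
  qed
  have "(\<lambda>n. 2 * sqnorm M (\<lambda>x. u n x - s n x * f n x) + 2 * (2 * (ennreal (C\<^sup>2) * sqnorm M (\<lambda>x. f n x - v x)) +
      2 * (\<integral>\<^sup>+x. ennreal ((s n x * v x - S x * v x)\<^sup>2) \<partial>M))) \<longlonglongrightarrow> 2 * 0 + 2 * (2 * (ennreal (C\<^sup>2) * 0) + 2 * (\<integral>\<^sup>+x. 0 \<partial>M))"
    by (intro tendsto_add tendsto_mult_ennreal tendsto_const diff v tail) auto
  then have lim: "(\<lambda>n. 2 * sqnorm M (\<lambda>x. u n x - s n x * f n x) + 2 * (2 * (ennreal (C\<^sup>2) * sqnorm M (\<lambda>x. f n x - v x)) +
      2 * (\<integral>\<^sup>+x. ennreal ((s n x * v x - S x * v x)\<^sup>2) \<partial>M))) \<longlonglongrightarrow> 0"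
    by simp
  have "(\<lambda>n. sqnorm M (\<lambda>x. u n x - S x * v x)) \<longlonglongrightarrow> 0"
    by (rule tendsto_sandwich[OF _ _ tendsto_const lim]) (use main in \<open>auto intro!: always_eventually\<close>)
  then show ?thesis
    by (intro L2_cauchy_of_tendsto[where v = "\<lambda>x. S x * v x"]) auto
qed

text \<open>The rescaling f = \<epsilon>^(d/2) w turns the bounds on \<open>w\<close> into those of
  \<open>charted_precompact\<close>, and sqrt \<kappa> w = sqrt (\<kappa> / \<epsilon>^d) f has a
  bounded convergent multiplier. The weight \<open>\<kappa>\<close> is tied to \<open>u\<close> and
  \<open>w\<close> by \<open>diff\<close> alone, so it can differ from the weight by which
  \<open>w\<close> arose from \<open>u\<close>.\<close>

lemma charted_weighted_precompact:
  fixes \<nu> :: "'a::euclidean_space measure"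
  assumes charted: "charted TYPE('b::euclidean_space) \<nu> M"
    and [measurable]: "\<And>n. w n \<in> borel_measurable borel" "\<And>n. \<kappa> n \<in> borel_measurable borel" "\<And>n. u n \<in> borel_measurable borel"
    and \<epsilon>: "\<And>n. 0 < \<epsilon> n" "\<epsilon> \<longlonglongrightarrow> 0" and r0: "0 < r0" and E: "0 \<le> E"
    and osc: "\<And>n. osc \<nu> UNIV (w n) (r0 * \<epsilon> n) \<le> ennreal (E * (\<epsilon> n)\<^sup>2)"
    and B: "\<And>n. ennreal (\<epsilon> n ^ DIM('b)) * sqnorm \<nu> (w n) \<le> ennreal B"
    and \<kappa>: "\<And>n x. x \<in> M \<Longrightarrow> 0 \<le> \<kappa> n x \<and> \<kappa> n x \<le> C * \<epsilon> n ^ DIM('b)"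
    and conv: "\<And>x. x \<in> M \<Longrightarrow> convergent (\<lambda>n. \<kappa> n x / \<epsilon> n ^ DIM('b))"
    and diff: "(\<lambda>n. sqnorm \<nu> (\<lambda>x. u n x - sqrt (\<kappa> n x) * w n x)) \<longlonglongrightarrow> 0"
  shows "\<exists>r. strict_mono (r :: nat \<Rightarrow> nat) \<and> L2_cauchy \<nu> (\<lambda>n. u (r n))"
proof -
  let ?d = "DIM('b)"
  have M: "compact M" "sets \<nu> = sets borel" "finite_measure \<nu>" "emeasure \<nu> (- M) = 0"
    using charted unfolding charted_def by auto
  have aeM: "AE z in \<nu>. z \<in> M"
    by (rule charted_AE[OF charted])
  interpret finite_measure \<nu> by fact
  have [measurable_cong]: "sets \<nu> = sets borel" by fact
  define f where "f n x = sqrt (\<epsilon> n ^ ?d) * w n x" for n x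
  have [measurable]: "f n \<in> borel_measurable borel" for n unfolding f_def by measurable
  have pos: "0 < \<epsilon> n ^ ?d" for n using \<epsilon>(1) by simp
  have sq_f: "sqnorm \<nu> (f n) = ennreal (\<epsilon> n ^ ?d) * sqnorm \<nu> (w n)" for n
    unfolding sqnorm_def f_def using pos[of n]
    by (simp add: power_mult_distrib ennreal_mult nn_integral_cmult del: ennreal_power)
  have osc_f: "osc \<nu> UNIV (f n) (r0 * \<epsilon> n) \<le> ennreal (E * \<epsilon> n ^ (?d + 2))" for n
  proof -
    have "osc \<nu> UNIV (f n) (r0 * \<epsilon> n) = ennreal (\<epsilon> n ^ ?d) * osc \<nu> UNIV (w n) (r0 * \<epsilon> n)"
    proof -
      have "(f n x - f n y)\<^sup>2 = \<epsilon> n ^ ?d * (w n x - w n y)\<^sup>2" for x y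
        using pos[of n] unfolding f_def right_diff_distrib[symmetric] by (simp add: power_mult_distrib)
      then show ?thesis
        unfolding osc_def using pos[of n]
        by (simp add: ennreal_mult nn_integral_cmult mult.assoc del: ennreal_power)
    qed
    also have "\<dots> \<le> ennreal (\<epsilon> n ^ ?d) * ennreal (E * (\<epsilon> n)\<^sup>2)"
      by (intro mult_left_mono osc) simp
    also have "\<dots> = ennreal (E * \<epsilon> n ^ (?d + 2))"
      using pos[of n] E by (simp add: ennreal_mult[symmetric] power_add power2_eq_square mult_ac del: ennreal_power)
    finally show ?thesis .
  qed
  obtain r :: "nat \<Rightarrow> nat" where r: "strict_mono r" "L2_cauchy \<nu> (\<lambda>n. f (r n))"
    using charted_precompact[OF charted _ _ \<epsilon> r0 E osc_f, of B] B unfolding sq_f by auto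
  define s where "s n x = sqrt (\<kappa> n x / \<epsilon> n ^ ?d)" for n x
  have [measurable]: "s n \<in> borel_measurable borel" for n unfolding s_def by measurable
  have "L2_cauchy \<nu> (\<lambda>n. u (r n))"
  proof (rule L2_cauchy_multiplier)
    show "L2_cauchy \<nu> (\<lambda>n. f (r n))" by fact
    show "sqnorm \<nu> (f (r n)) < \<infinity>" for n
      using B[of "r n"] unfolding sq_f by (simp add: order_le_less_trans)
    show "AE x in \<nu>. \<bar>s (r n) x\<bar> \<le> sqrt C" for n
      using aeM
    proof eventually_elim
      case (elim x)
      have "\<kappa> (r n) x / \<epsilon> (r n) ^ ?d \<le> C" using \<kappa>[OF elim, of "r n"] pos[of "r n"] by (simp add: field_simps)
      then show ?case using \<kappa>[OF elim, of "r n"] pos[of "r n"] by (simp add: s_def)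
    qed
    show "AE x in \<nu>. convergent (\<lambda>n. s (r n) x)"
      using aeM
    proof eventually_elim
      case (elim x)
      obtain l where l: "(\<lambda>n. \<kappa> n x / \<epsilon> n ^ ?d) \<longlonglongrightarrow> l" using conv[OF elim] unfolding convergent_def by blast
      have "(\<lambda>n. s n x) \<longlonglongrightarrow> sqrt l" unfolding s_def by (intro tendsto_real_sqrt l)
      from LIMSEQ_subseq_LIMSEQ[OF this r(1)] show ?case by (auto simp: convergent_def o_def)
    qed
    have "s n x * f n x = sqrt (\<kappa> n x) * w n x" for n x
      using \<epsilon>(1)[of n] by (simp add: s_def f_def real_sqrt_divide)
    then show "(\<lambda>n. sqnorm \<nu> (\<lambda>x. u (r n) x - s (r n) x * f (r n) x)) \<longlonglongrightarrow> 0"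
      using LIMSEQ_subseq_LIMSEQ[OF diff r(1)] by (simp add: o_def)
  qed measurable
  then show ?thesis using r(1) by blast
qed

lemma charted_kint_le:
  fixes \<nu> :: "'a::euclidean_space measure"
  assumes charted: "charted TYPE('b::euclidean_space) \<nu> M"
    and \<eta>: "antimono \<eta>" "\<And>t. 0 \<le> \<eta> t" "\<And>t. 1 < t \<Longrightarrow> \<eta> t = 0"
    and pC: "\<And>x. x \<in> M \<Longrightarrow> 0 \<le> p x \<and> p x \<le> C" and C: "0 \<le> C"
  shows "\<exists>C'>0. \<forall>e>0. \<forall>x. kint \<nu> \<eta> p e x \<le> ennreal (C' * e ^ DIM('b))"
proof -
  have M: "compact M" "sets \<nu> = sets borel" "emeasure \<nu> (- M) = 0"
    using charted unfolding charted_def by auto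
  have aeM: "AE z in \<nu>. z \<in> M"
    by (rule charted_AE[OF charted])
  obtain C1 where C1: "0 < C1" "\<And>x r. 0 < r \<Longrightarrow> emeasure \<nu> (cball x r) \<le> ennreal (C1 * r ^ DIM('b))"
    using charted_emeasure_cball_le[OF charted] by metis
  \<comment> \<open>The summand 1 keeps the constant positive even if \<open>C\<close> is 0.\<close>
  have "kint \<nu> \<eta> p e x \<le> ennreal ((\<eta> 0 * C + 1) * C1 * e ^ DIM('b))" if e: "0 < e" for e x
  proof -
    have "kint \<nu> \<eta> p e x \<le> (\<integral>\<^sup>+z. ennreal (\<eta> 0 * C + 1) * indicator (cball x e) z \<partial>\<nu>)"
      unfolding kint_def
    proof (rule nn_integral_mono_AE, use aeM in eventually_elim)
      case (elim z)
      show ?case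
      proof (cases "dist x z \<le> e")
        case True
        have "\<eta> (dist x z / e) * p z \<le> \<eta> 0 * C"
          using \<eta>(2) pC[OF elim] e antimonoD[OF \<eta>(1), of 0 "dist x z / e"] by (intro mult_mono) auto
        then have "\<eta> (dist x z / e) * p z \<le> \<eta> 0 * C + 1" by simp
        then show ?thesis using True by (simp add: ennreal_leI del: ennreal_plus)
      next
        case False
        then have "1 < dist x z / e" using e by simp
        then show ?thesis using \<eta>(3) by simp
      qed
    qed
    also have "\<dots> = ennreal (\<eta> 0 * C + 1) * emeasure \<nu> (cball x e)"
      using M(2) by (intro nn_integral_cmult_indicator) simp
    also have "\<dots> \<le> ennreal (\<eta> 0 * C + 1) * ennreal (C1 * e ^ DIM('b))"
      by (intro mult_left_mono C1(2) e) simp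
    also have "\<dots> = ennreal ((\<eta> 0 * C + 1) * C1 * e ^ DIM('b))"
      using \<eta>(2)[of 0] C C1(1) e by (subst ennreal_mult[symmetric]) (auto simp: mult.assoc)
    finally show ?thesis .
  qed
  moreover have "0 < (\<eta> 0 * C + 1) * C1"
    using \<eta>(2)[of 0] C C1(1) by (intro mult_pos_pos add_nonneg_pos) auto
  ultimately show ?thesis by blast
qed

text \<open>Keeping only the points within distance r0 e of x, where \<eta> is at least h, reduces
  the bound to the measure of a ball.\<close>

lemma charted_kint_ge:
  fixes \<nu> :: "'a::euclidean_space measure"
  assumes charted: "charted TYPE('b::euclidean_space) \<nu> M"
    and \<eta>: "\<And>t. 0 \<le> t \<Longrightarrow> t \<le> r0 \<Longrightarrow> h \<le> \<eta> t" and h: "0 < h" and r0: "0 < r0"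
    and pc: "\<And>x. x \<in> M \<Longrightarrow> c \<le> p x" and c: "0 < c"
  shows "\<exists>c'>0. \<exists>\<delta>>0. \<forall>e x. 0 < e \<longrightarrow> e \<le> \<delta> \<longrightarrow> x \<in> M \<longrightarrow> ennreal (c' * e ^ DIM('b)) \<le> kint \<nu> \<eta> p e x"
proof -
  have M: "compact M" "sets \<nu> = sets borel" "emeasure \<nu> (- M) = 0"
    using charted unfolding charted_def by auto
  have aeM: "AE z in \<nu>. z \<in> M"
    by (rule charted_AE[OF charted])
  obtain c1 r1 where c1: "0 < c1" "0 < r1"
    "\<And>x r. x \<in> M \<Longrightarrow> 0 < r \<Longrightarrow> r \<le> r1 \<Longrightarrow> ennreal (c1 * r ^ DIM('b)) \<le> emeasure \<nu> (cball x r)"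
    using charted_emeasure_cball_ge[OF charted] by metis
  have "ennreal (h * c * (c1 * r0 ^ DIM('b)) * e ^ DIM('b)) \<le> kint \<nu> \<eta> p e x"
    if e: "0 < e" "e \<le> r1 / r0" and x: "x \<in> M" for e x
  proof -
    have "ennreal (h * c * (c1 * r0 ^ DIM('b)) * e ^ DIM('b)) = ennreal (h * c) * ennreal (c1 * (r0 * e) ^ DIM('b))"
      using h c c1(1) r0 e by (subst ennreal_mult[symmetric]) (auto simp: power_mult_distrib mult_ac)
    also have "\<dots> \<le> ennreal (h * c) * emeasure \<nu> (cball x (r0 * e))"
      using e r0 by (intro mult_left_mono c1(3) x) (auto simp: field_simps)
    also have "\<dots> = (\<integral>\<^sup>+z. ennreal (h * c) * indicator (cball x (r0 * e)) z \<partial>\<nu>)"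
      using M(2) by (intro nn_integral_cmult_indicator[symmetric]) simp
    also have "\<dots> \<le> kint \<nu> \<eta> p e x"
      unfolding kint_def
    proof (rule nn_integral_mono_AE, use aeM in eventually_elim)
      case (elim z)
      show ?case
      proof (cases "dist x z \<le> r0 * e")
        case True
        then have "dist x z / e \<le> r0" using e by (simp add: field_simps)
        then have "h * c \<le> \<eta> (dist x z / e) * p z"
          using \<eta>[of "dist x z / e"] pc[OF elim] h c e by (intro mult_mono) auto
        then show ?thesis using True by (simp add: ennreal_leI)
      qed simp
    qed
    finally show ?thesis .
  qed
  moreover have "0 < h * c * (c1 * r0 ^ DIM('b))" "0 < r1 / r0" using h c c1 r0 by auto
  ultimately show ?thesis by blast
qed

section \<open>Two charted measures\<close>

lemma kint_measurable:
  fixes \<nu> :: "'a::euclidean_space measure"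
  assumes "finite_measure \<nu>" and [measurable_cong]: "sets \<nu> = sets borel"
    and [measurable]: "\<eta> \<in> borel_measurable borel" "p \<in> borel_measurable borel"
  shows "(\<lambda>x. kint \<nu> \<eta> p e x) \<in> borel_measurable borel"
proof -
  interpret finite_measure \<nu> by fact
  show ?thesis unfolding kint_def by measurable
qed

text \<open>The kernel dominates h times the indicator of distances up to r0 e.\<close>

lemma osc_le_energy:
  fixes \<nu> :: "'a::euclidean_space measure"
  assumes "finite_measure \<nu>" and [measurable_cong]: "sets \<nu> = sets borel"
    and [measurable]: "\<eta> \<in> borel_measurable borel" "w \<in> borel_measurable borel"
    and \<eta>: "\<And>t. 0 \<le> t \<Longrightarrow> t \<le> r0 \<Longrightarrow> h \<le> \<eta> t" and h: "0 < h" and e: "0 < e"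
    and energy: "(\<integral>\<^sup>+x. \<integral>\<^sup>+y. ennreal (\<eta> (dist x y / e) * (w x - w y)\<^sup>2) \<partial>\<nu> \<partial>\<nu>) \<le> ennreal (E * e\<^sup>2)" and E: "0 \<le> E"
  shows "osc \<nu> UNIV w (r0 * e) \<le> ennreal (E / h * e\<^sup>2)"
proof -
  interpret finite_measure \<nu> by fact
  have "osc \<nu> UNIV w (r0 * e) \<le> (\<integral>\<^sup>+x. \<integral>\<^sup>+y. ennreal (1 / h) * ennreal (\<eta> (dist x y / e) * (w x - w y)\<^sup>2) \<partial>\<nu> \<partial>\<nu>)"
    unfolding osc_def
  proof (intro nn_integral_mono)
    fix x y
    show "ennreal ((w x - w y)\<^sup>2) * (indicator UNIV x * indicator UNIV y * indicator {..r0 * e} (dist x y))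
      \<le> ennreal (1 / h) * ennreal (\<eta> (dist x y / e) * (w x - w y)\<^sup>2)"
    proof (cases "dist x y \<le> r0 * e")
      case True
      then have "h \<le> \<eta> (dist x y / e)" using e by (intro \<eta>) (auto simp: field_simps)
      then have "1 * (w x - w y)\<^sup>2 \<le> (1 / h * \<eta> (dist x y / e)) * (w x - w y)\<^sup>2"
        using h by (intro mult_right_mono) (auto simp: field_simps)
      then have "ennreal ((w x - w y)\<^sup>2) \<le> ennreal (1 / h * (\<eta> (dist x y / e) * (w x - w y)\<^sup>2))"
        by (intro ennreal_leI) (simp add: mult.assoc)
      also have "\<dots> = ennreal (1 / h) * ennreal (\<eta> (dist x y / e) * (w x - w y)\<^sup>2)"
        using h \<open>h \<le> \<eta> (dist x y / e)\<close> by (intro ennreal_mult) auto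
      finally show ?thesis using True by simp
    qed simp
  qed
  also have "\<dots> = ennreal (1 / h) * (\<integral>\<^sup>+x. \<integral>\<^sup>+y. ennreal (\<eta> (dist x y / e) * (w x - w y)\<^sup>2) \<partial>\<nu> \<partial>\<nu>)"
    by (simp add: nn_integral_cmult)
  also have "\<dots> \<le> ennreal (1 / h) * ennreal (E * e\<^sup>2)"
    by (intro mult_left_mono energy) simp
  also have "\<dots> = ennreal (E / h * e\<^sup>2)"
    using h E by (simp add: ennreal_mult[symmetric])
  finally show ?thesis .
qed

lemma weighted_sqnorm_le:
  fixes \<nu> :: "'a::euclidean_space measure"
  assumes [measurable_cong]: "sets \<nu> = sets borel" and ae: "AE x in \<nu>. x \<in> M"
    and [measurable]: "u \<in> borel_measurable borel" "\<kappa> \<in> borel_measurable borel"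
    and \<kappa>: "\<And>x. x \<in> M \<Longrightarrow> c * b \<le> \<kappa> x" and c: "0 < c" and b: "0 < b"
    and B: "sqnorm \<nu> u \<le> ennreal B" and B0: "0 \<le> B"
  shows "ennreal b * sqnorm \<nu> (\<lambda>x. u x / sqrt (\<kappa> x)) \<le> ennreal (B / c)"
proof -
  have "ennreal b * sqnorm \<nu> (\<lambda>x. u x / sqrt (\<kappa> x)) = (\<integral>\<^sup>+x. ennreal b * ennreal ((u x / sqrt (\<kappa> x))\<^sup>2) \<partial>\<nu>)"
    unfolding sqnorm_def by (rule nn_integral_cmult[symmetric]) measurable
  also have "\<dots> \<le> (\<integral>\<^sup>+x. ennreal (1 / c) * ennreal ((u x)\<^sup>2) \<partial>\<nu>)"
  proof (rule nn_integral_mono_AE, use ae in eventually_elim)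
    case (elim x)
    have pos: "0 < \<kappa> x" using \<kappa>[OF elim] mult_pos_pos[OF c b] by linarith
    have "b / \<kappa> x \<le> 1 / c" using \<kappa>[OF elim] pos c by (simp add: field_simps)
    then have "b / \<kappa> x * (u x)\<^sup>2 \<le> 1 / c * (u x)\<^sup>2" by (rule mult_right_mono) simp
    then have "b * (u x / sqrt (\<kappa> x))\<^sup>2 \<le> 1 / c * (u x)\<^sup>2" using pos by (simp add: power_divide)
    then have "ennreal (b * (u x / sqrt (\<kappa> x))\<^sup>2) \<le> ennreal (1 / c * (u x)\<^sup>2)" by (rule ennreal_leI)
    then show ?case using b c by (subst (asm) (1 2) ennreal_mult) auto
  qed
  also have "\<dots> = ennreal (1 / c) * sqnorm \<nu> u"
    unfolding sqnorm_def by (rule nn_integral_cmult) measurable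
  also have "\<dots> \<le> ennreal (1 / c) * ennreal B"
    by (intro mult_left_mono B) simp
  also have "\<dots> = ennreal (B / c)"
    using c B0 by (simp add: ennreal_mult[symmetric])
  finally show ?thesis .
qed

text \<open>The case of a weight comparable to \<epsilon>^d: \<open>u\<close> is then recovered
  exactly on \<open>M\<close> as sqrt \<kappa> w, and the replacement error is zero.\<close>

lemma charted_total_weight_precompact:
  fixes \<nu> :: "'a::euclidean_space measure"
  assumes charted: "charted TYPE('b::euclidean_space) \<nu> M"
    and [measurable]: "\<And>n. \<kappa> n \<in> borel_measurable borel" "\<And>n. u n \<in> borel_measurable borel" "\<eta> \<in> borel_measurable borel"
    and \<epsilon>: "\<And>n. 0 < \<epsilon> n" "\<epsilon> \<longlonglongrightarrow> 0"
    and \<eta>: "\<And>t. 0 \<le> t \<Longrightarrow> t \<le> r0 \<Longrightarrow> h \<le> \<eta> t" and h: "0 < h" and r0: "0 < r0" and E: "0 \<le> E"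
    and energy: "\<And>n. (\<integral>\<^sup>+x. \<integral>\<^sup>+y. ennreal (\<eta> (dist x y / \<epsilon> n) *
        (u n x / sqrt (\<kappa> n x) - u n y / sqrt (\<kappa> n y))\<^sup>2) \<partial>\<nu> \<partial>\<nu>) \<le> ennreal (E * (\<epsilon> n)\<^sup>2)"
    and B: "\<And>n. sqnorm \<nu> (u n) \<le> ennreal B" and B0: "0 \<le> B" and c: "0 < c"
    and \<kappa>: "\<And>n x. x \<in> M \<Longrightarrow> c * \<epsilon> n ^ DIM('b) \<le> \<kappa> n x \<and> \<kappa> n x \<le> C * \<epsilon> n ^ DIM('b)"
    and conv: "\<And>x. x \<in> M \<Longrightarrow> convergent (\<lambda>n. \<kappa> n x / \<epsilon> n ^ DIM('b))"
  shows "\<exists>r. strict_mono (r :: nat \<Rightarrow> nat) \<and> L2_cauchy \<nu> (\<lambda>n. u (r n))"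
proof -
  have M: "compact M" "sets \<nu> = sets borel" "finite_measure \<nu>" "emeasure \<nu> (- M) = 0"
    using charted unfolding charted_def by auto
  have aeM: "AE z in \<nu>. z \<in> M"
    by (rule charted_AE[OF charted])
  have pos: "0 < \<kappa> n x" if "x \<in> M" for n x
  proof -
    have "0 < c * \<epsilon> n ^ DIM('b)" using c \<epsilon>(1) by simp
    then show ?thesis using \<kappa>[OF that, of n] by linarith
  qed
  define w where "w n x = u n x / sqrt (\<kappa> n x)" for n x
  have [measurable]: "w n \<in> borel_measurable borel" for n unfolding w_def by measurable
  show ?thesis
  proof (rule charted_weighted_precompact[OF charted, where w = w and \<kappa> = \<kappa> and \<epsilon> = \<epsilon> and E = "E / h" and B = "B / c" and C = C])
    show "osc \<nu> UNIV (w n) (r0 * \<epsilon> n) \<le> ennreal (E / h * (\<epsilon> n)\<^sup>2)" for n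
      by (rule osc_le_energy[OF M(3,2) _ _ \<eta> h \<epsilon>(1) _ E]) (use energy[of n] in \<open>simp_all add: w_def\<close>)
    show "ennreal (\<epsilon> n ^ DIM('b)) * sqnorm \<nu> (w n) \<le> ennreal (B / c)" for n
      unfolding w_def by (rule weighted_sqnorm_le[OF M(2) aeM _ _ _ c _ B B0]) (use \<kappa> \<epsilon>(1) in auto)
    show "0 \<le> \<kappa> n x \<and> \<kappa> n x \<le> C * \<epsilon> n ^ DIM('b)" if "x \<in> M" for n x
      using \<kappa>[OF that, of n] pos[OF that, of n] by simp
    have "sqnorm \<nu> (\<lambda>x. u n x - sqrt (\<kappa> n x) * w n x) = (\<integral>\<^sup>+x. 0 \<partial>\<nu>)" for n
      unfolding sqnorm_def
    proof (rule nn_integral_cong_AE, use aeM in eventually_elim)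
      case (elim x)
      show ?case using pos[OF elim, of n] by (simp add: w_def)
    qed
    then show "(\<lambda>n. sqnorm \<nu> (\<lambda>x. u n x - sqrt (\<kappa> n x) * w n x)) \<longlonglongrightarrow> 0" by simp
  qed (use \<epsilon> r0 E h conv in auto)
qed

lemma sqrt_add_diff_square_le:
  fixes a b :: real
  assumes "0 \<le> a" "0 \<le> b"
  shows "(sqrt (a + b) - sqrt b)\<^sup>2 \<le> a"
proof -
  have "sqrt (a + b) \<le> sqrt a + sqrt b" using assms by (rule sqrt_add_le_add_sqrt)
  moreover have "sqrt b \<le> sqrt (a + b)" using assms by simp
  ultimately have "(sqrt (a + b) - sqrt b)\<^sup>2 \<le> (sqrt a)\<^sup>2" by (intro power_mono) auto
  then show ?thesis using assms by simp
qed

text \<open>From w(x)^2 \<le> 2 (w x - w y)^2 + 2 w(y)^2, integrated over y on the first manifold.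
  The first term is the mixed energy. In the second, Tonelli integrates x out first and leaves the
  kernel mass \<open>D\<close> of the second manifold against w^2 on the first, where the norm of w
  is better controlled.\<close>

lemma interaction_le:
  fixes \<nu>1 \<nu>2 :: "'a::euclidean_space measure"
  assumes fin: "finite_measure \<nu>1" "finite_measure \<nu>2"
    and [measurable_cong]: "sets \<nu>1 = sets borel" "sets \<nu>2 = sets borel"
    and [measurable]: "\<eta> \<in> borel_measurable borel" "p \<in> borel_measurable borel" "w \<in> borel_measurable borel"
    and \<eta>0: "\<And>t. 0 \<le> \<eta> t"
    and ae: "AE x in \<nu>1. x \<in> M1" and p: "\<And>x. x \<in> M1 \<Longrightarrow> p x \<le> C" and C: "0 \<le> C"
    and kint2: "\<And>x. kint \<nu>2 \<eta> (\<lambda>_. 1) e x \<le> ennreal D"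
  shows "(\<integral>\<^sup>+x. kint \<nu>1 \<eta> p e x * ennreal ((w x)\<^sup>2) \<partial>\<nu>2) \<le>
    ennreal (2 * C) * ((\<integral>\<^sup>+x. \<integral>\<^sup>+y. ennreal (\<eta> (dist x y / e) * (w x - w y)\<^sup>2) \<partial>\<nu>1 \<partial>\<nu>2) + ennreal D * sqnorm \<nu>1 w)"
proof -
  interpret N1: finite_measure \<nu>1 by fact
  interpret N2: finite_measure \<nu>2 by fact
  interpret pair_sigma_finite \<nu>2 \<nu>1 ..
  define g where "g x y = ennreal (\<eta> (dist x y / e))" for x y :: 'a
  define A where "A x y = ennreal ((w x - w y)\<^sup>2)" for x y :: 'a
  have [measurable]: "(\<lambda>z. g (s z) (t z)) \<in> borel_measurable N" "(\<lambda>z. A (s z) (t z)) \<in> borel_measurable N"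
    if [measurable]: "s \<in> borel_measurable N" "t \<in> borel_measurable N" for s t and N :: "'c measure"
    unfolding g_def A_def by measurable
  have "(\<integral>\<^sup>+x. kint \<nu>1 \<eta> p e x * ennreal ((w x)\<^sup>2) \<partial>\<nu>2) =
      (\<integral>\<^sup>+x. \<integral>\<^sup>+y. ennreal (\<eta> (dist x y / e) * p y) * ennreal ((w x)\<^sup>2) \<partial>\<nu>1 \<partial>\<nu>2)"
    unfolding kint_def by (intro nn_integral_cong nn_integral_multc[symmetric]) measurable
  also have "\<dots> \<le> (\<integral>\<^sup>+x. \<integral>\<^sup>+y. ennreal (2 * C) * (g x y * A x y + g x y * ennreal ((w y)\<^sup>2)) \<partial>\<nu>1 \<partial>\<nu>2)"
  proof (rule nn_integral_mono)
    fix x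
    show "(\<integral>\<^sup>+y. ennreal (\<eta> (dist x y / e) * p y) * ennreal ((w x)\<^sup>2) \<partial>\<nu>1) \<le>
      (\<integral>\<^sup>+y. ennreal (2 * C) * (g x y * A x y + g x y * ennreal ((w y)\<^sup>2)) \<partial>\<nu>1)"
    proof (rule nn_integral_mono_AE, use ae in eventually_elim)
      case (elim y)
      have "ennreal (\<eta> (dist x y / e) * p y) \<le> ennreal (\<eta> (dist x y / e) * C)"
        using \<eta>0 p[OF elim] by (intro ennreal_leI mult_left_mono) auto
      also have "\<dots> = g x y * ennreal C" unfolding g_def using \<eta>0 C by (intro ennreal_mult) auto
      finally have "ennreal (\<eta> (dist x y / e) * p y) * ennreal ((w x)\<^sup>2) \<le>
        (g x y * ennreal C) * (2 * A x y + 2 * ennreal ((w y)\<^sup>2))"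
        using ennreal_square_diff_le[of "w x" 0 "w y"] unfolding A_def by (intro mult_mono) auto
      also have "\<dots> = ennreal (2 * C) * (g x y * A x y + g x y * ennreal ((w y)\<^sup>2))"
        using C by (simp add: ennreal_mult distrib_left mult_ac)
      finally show ?case .
    qed
  qed
  also have "\<dots> = ennreal (2 * C) * ((\<integral>\<^sup>+x. \<integral>\<^sup>+y. g x y * A x y \<partial>\<nu>1 \<partial>\<nu>2) + (\<integral>\<^sup>+x. \<integral>\<^sup>+y. g x y * ennreal ((w y)\<^sup>2) \<partial>\<nu>1 \<partial>\<nu>2))"
    by (simp add: nn_integral_cmult nn_integral_add)
  also have "(\<integral>\<^sup>+x. \<integral>\<^sup>+y. g x y * A x y \<partial>\<nu>1 \<partial>\<nu>2) = (\<integral>\<^sup>+x. \<integral>\<^sup>+y. ennreal (\<eta> (dist x y / e) * (w x - w y)\<^sup>2) \<partial>\<nu>1 \<partial>\<nu>2)"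
    unfolding g_def A_def using \<eta>0 by (simp add: ennreal_mult)
  also have "(\<integral>\<^sup>+x. \<integral>\<^sup>+y. g x y * ennreal ((w y)\<^sup>2) \<partial>\<nu>1 \<partial>\<nu>2) = (\<integral>\<^sup>+y. \<integral>\<^sup>+x. g x y * ennreal ((w y)\<^sup>2) \<partial>\<nu>2 \<partial>\<nu>1)"
    by (rule Fubini'[symmetric]) measurable
  also have "\<dots> = (\<integral>\<^sup>+y. kint \<nu>2 \<eta> (\<lambda>_. 1) e y * ennreal ((w y)\<^sup>2) \<partial>\<nu>1)"
    unfolding kint_def g_def by (simp add: nn_integral_multc dist_commute)
  also have "\<dots> \<le> (\<integral>\<^sup>+y. ennreal D * ennreal ((w y)\<^sup>2) \<partial>\<nu>1)"
    by (intro nn_integral_mono mult_right_mono kint2) simp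
  also have "\<dots> = ennreal D * sqnorm \<nu>1 w"
    unfolding sqnorm_def by (rule nn_integral_cmult) measurable
  finally show ?thesis by (simp add: mult_left_mono add_left_mono)
qed

lemma convergent_of_ennreal_scaled:
  assumes lim: "\<exists>l. (\<lambda>n. ennreal (a n) * k n) \<longlonglongrightarrow> ennreal l" and a: "\<And>n. 0 \<le> a n"
  shows "convergent (\<lambda>n. a n * enn2real (k n))"
proof -
  obtain l where l: "(\<lambda>n. ennreal (a n) * k n) \<longlonglongrightarrow> ennreal l" using lim by blast
  \<comment> \<open>\<open>ennreal\<close> truncates negative reals, so \<open>max 0 l\<close> is
    the real limit to be used.\<close>
  have "ennreal l = ennreal (max 0 l)" by (simp add: max_def ennreal_neg)
  then have "(\<lambda>n. ennreal (a n) * k n) \<longlonglongrightarrow> ennreal (max 0 l)" using l by simp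
  then have "(\<lambda>n. enn2real (ennreal (a n) * k n)) \<longlonglongrightarrow> max 0 l"
    by (rule tendsto_enn2real) simp
  then show ?thesis using a by (auto simp: convergent_def enn2real_mult)
qed

text \<open>Here \<epsilon> n \<le> 1 and the lower bounds hold for every n; dropping finitely many
  terms arranges this later. Since \<epsilon>^d2 \<le> \<epsilon>^d1, the total weight
  \<open>K\<close> has exact order \<epsilon>^d1 on the first manifold. The two conclusions yield
  separate subsequences, to be merged later.\<close>

lemma two_manifolds_precompact_aux:
  fixes \<nu>1 \<nu>2 :: "'a::euclidean_space measure"
  assumes ch1: "charted TYPE('b1::euclidean_space) \<nu>1 M1" and ch2: "charted TYPE('b2::euclidean_space) \<nu>2 M2"
    and dims: "DIM('b1) \<le> DIM('b2)"
    and \<eta>: "antimono \<eta>" "\<And>t. 0 \<le> \<eta> t" "\<And>t. 1 < t \<Longrightarrow> \<eta> t = 0"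
    and \<eta>h: "\<And>t. 0 \<le> t \<Longrightarrow> t \<le> r0 \<Longrightarrow> h \<le> \<eta> t" and h: "0 < h" and r0: "0 < r0"
    and p [measurable]: "p1 \<in> borel_measurable borel" "p2 \<in> borel_measurable borel"
    and pcont: "continuous_on M1 p1" "continuous_on M2 p2"
    and p1: "\<And>x. x \<in> M1 \<Longrightarrow> 0 \<le> p1 x \<and> p1 x \<le> C" and p2: "\<And>x. x \<in> M2 \<Longrightarrow> 0 \<le> p2 x \<and> p2 x \<le> C" and C: "0 \<le> C"
    and \<epsilon>: "\<And>n. 0 < \<epsilon> n" "\<epsilon> \<longlonglongrightarrow> 0" "\<And>n. \<epsilon> n \<le> 1"
    and u [measurable]: "\<And>n. u n \<in> borel_measurable borel"
    and K: "\<And>n x. K n x = enn2real (kint \<nu>1 \<eta> p1 (\<epsilon> n) x) + enn2real (kint \<nu>2 \<eta> p2 (\<epsilon> n) x)"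
    and w: "\<And>n x. w n x = u n x / sqrt (K n x)"
    and c: "0 < c"
    and low1: "\<And>n x. x \<in> M1 \<Longrightarrow> ennreal (c * \<epsilon> n ^ DIM('b1)) \<le> kint \<nu>1 \<eta> p1 (\<epsilon> n) x"
    and low2: "\<And>n x. x \<in> M2 \<Longrightarrow> ennreal (c * \<epsilon> n ^ DIM('b2)) \<le> kint \<nu>2 \<eta> p2 (\<epsilon> n) x"
    and E: "0 \<le> E"
    and en11: "\<And>n. (\<integral>\<^sup>+x. \<integral>\<^sup>+y. ennreal (\<eta> (dist x y / \<epsilon> n) * (w n x - w n y)\<^sup>2) \<partial>\<nu>1 \<partial>\<nu>1) \<le> ennreal (E * (\<epsilon> n)\<^sup>2)"
    and en22: "\<And>n. (\<integral>\<^sup>+x. \<integral>\<^sup>+y. ennreal (\<eta> (dist x y / \<epsilon> n) * (w n x - w n y)\<^sup>2) \<partial>\<nu>2 \<partial>\<nu>2) \<le> ennreal (E * (\<epsilon> n)\<^sup>2)"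
    and en21: "\<And>n. (\<integral>\<^sup>+x. \<integral>\<^sup>+y. ennreal (\<eta> (dist x y / \<epsilon> n) * (w n x - w n y)\<^sup>2) \<partial>\<nu>1 \<partial>\<nu>2) \<le> ennreal (E * (\<epsilon> n)\<^sup>2)"
    and B: "\<And>n. sqnorm \<nu>1 (u n) \<le> ennreal B" "\<And>n. sqnorm \<nu>2 (u n) \<le> ennreal B" and B0: "0 \<le> B"
  shows "\<exists>r. strict_mono (r :: nat \<Rightarrow> nat) \<and> L2_cauchy \<nu>1 (\<lambda>n. u (r n))"
    and "\<exists>r. strict_mono (r :: nat \<Rightarrow> nat) \<and> L2_cauchy \<nu>2 (\<lambda>n. u (r n))"
proof -
  let ?d1 = "DIM('b1)" and ?d2 = "DIM('b2)"
  have M1: "compact M1" "sets \<nu>1 = sets borel" "finite_measure \<nu>1" "emeasure \<nu>1 (- M1) = 0"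
    using ch1 unfolding charted_def by auto
  have M2: "compact M2" "sets \<nu>2 = sets borel" "finite_measure \<nu>2" "emeasure \<nu>2 (- M2) = 0"
    using ch2 unfolding charted_def by auto
  have ae1: "AE z in \<nu>1. z \<in> M1"
    by (rule charted_AE[OF ch1])
  have ae2: "AE z in \<nu>2. z \<in> M2"
    by (rule charted_AE[OF ch2])
  have \<eta>_meas [measurable]: "\<eta> \<in> borel_measurable borel" using \<eta>(1) by (rule antimono_borel)
  have [measurable]: "(\<lambda>x. kint \<nu>1 \<eta> p1 e x) \<in> borel_measurable borel" "(\<lambda>x. kint \<nu>2 \<eta> p2 e x) \<in> borel_measurable borel" for e
    using kint_measurable[OF M1(3,2) \<eta>_meas p(1)] kint_measurable[OF M2(3,2) \<eta>_meas p(2)] by auto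
  define K1 where "K1 n x = enn2real (kint \<nu>1 \<eta> p1 (\<epsilon> n) x)" for n x
  define K2 where "K2 n x = enn2real (kint \<nu>2 \<eta> p2 (\<epsilon> n) x)" for n x
  have K12: "K n x = K1 n x + K2 n x" for n x by (simp add: K K1_def K2_def)
  have nonneg: "0 \<le> K1 n x" "0 \<le> K2 n x" for n x by (auto simp: K1_def K2_def)
  have K_eq: "K n = (\<lambda>x. K1 n x + K2 n x)" and w_eq: "w n = (\<lambda>x. u n x / sqrt (K n x))" for n
    by (rule ext, rule K12) (rule ext, rule w)
  have [measurable]: "K1 n \<in> borel_measurable borel" "K2 n \<in> borel_measurable borel" for n
    unfolding K1_def K2_def by measurable
  have [measurable]: "K n \<in> borel_measurable borel" for n
    unfolding K_eq by measurable
  have [measurable]: "w n \<in> borel_measurable borel" for n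
    unfolding w_eq by measurable
  have "\<exists>C'>0. \<forall>e>0. \<forall>x. kint \<nu>1 \<eta> p1 e x \<le> ennreal (C' * e ^ ?d1)"
    by (rule charted_kint_le[OF ch1]) (use \<eta> p1 C in auto)
  then obtain C1 where C1: "0 < C1" and "\<forall>e>0. \<forall>x. kint \<nu>1 \<eta> p1 e x \<le> ennreal (C1 * e ^ ?d1)"
    by blast
  then have up1: "kint \<nu>1 \<eta> p1 e x \<le> ennreal (C1 * e ^ ?d1)" if "0 < e" for e x
    using that by blast
  have "\<exists>C'>0. \<forall>e>0. \<forall>x. kint \<nu>2 \<eta> p2 e x \<le> ennreal (C' * e ^ ?d2)"
    by (rule charted_kint_le[OF ch2]) (use \<eta> p2 C in auto)
  then obtain C2 where C2: "0 < C2" and "\<forall>e>0. \<forall>x. kint \<nu>2 \<eta> p2 e x \<le> ennreal (C2 * e ^ ?d2)"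
    by blast
  then have up2: "kint \<nu>2 \<eta> p2 e x \<le> ennreal (C2 * e ^ ?d2)" if "0 < e" for e x
    using that by blast
  have "\<exists>C'>0. \<forall>e>0. \<forall>x. kint \<nu>2 \<eta> (\<lambda>_. 1) e x \<le> ennreal (C' * e ^ ?d2)"
    by (rule charted_kint_le[OF ch2, where C = 1]) (use \<eta> in auto)
  then obtain C3 where C3: "0 < C3" and "\<forall>e>0. \<forall>x. kint \<nu>2 \<eta> (\<lambda>_. 1) e x \<le> ennreal (C3 * e ^ ?d2)"
    by blast
  then have up3: "kint \<nu>2 \<eta> (\<lambda>_. 1) e x \<le> ennreal (C3 * e ^ ?d2)" if "0 < e" for e x
    using that by blast
  have pos1: "0 < \<epsilon> n ^ ?d1" and pos2: "0 < \<epsilon> n ^ ?d2" and le12: "\<epsilon> n ^ ?d2 \<le> \<epsilon> n ^ ?d1" for n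
    using \<epsilon>(1)[of n] \<epsilon>(3)[of n] dims by (auto intro: power_decreasing)
  have fin1: "kint \<nu>1 \<eta> p1 (\<epsilon> n) x = ennreal (K1 n x)" for n x
    unfolding K1_def using up1[OF \<epsilon>(1), of n x] by (intro ennreal_enn2real[symmetric]) (simp add: order_le_less_trans)
  have fin2: "kint \<nu>2 \<eta> p2 (\<epsilon> n) x = ennreal (K2 n x)" for n x
    unfolding K2_def using up2[OF \<epsilon>(1), of n x] by (intro ennreal_enn2real[symmetric]) (simp add: order_le_less_trans)
  have K1_le: "K1 n x \<le> C1 * \<epsilon> n ^ ?d1" and K2_le: "K2 n x \<le> C2 * \<epsilon> n ^ ?d2" for n x
    using up1[OF \<epsilon>(1), of n x] up2[OF \<epsilon>(1), of n x] C1 C2 pos1[of n] pos2[of n] unfolding fin1 fin2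
    by (auto simp: ennreal_le_iff)
  have K1_ge: "c * \<epsilon> n ^ ?d1 \<le> K1 n x" if "x \<in> M1" for n x
    using low1[OF that, of n] nonneg(1) unfolding fin1 by (simp add: ennreal_le_iff)
  have K2_ge: "c * \<epsilon> n ^ ?d2 \<le> K2 n x" if "x \<in> M2" for n x
    using low2[OF that, of n] nonneg(2) unfolding fin2 by (simp add: ennreal_le_iff)
  have conv1: "convergent (\<lambda>n. K1 n x / \<epsilon> n ^ ?d1)" for x
  proof -
    have "convergent (\<lambda>n. (1 / \<epsilon> n) ^ ?d1 * enn2real (kint \<nu>1 \<eta> p1 (\<epsilon> n) x))"
    proof (rule convergent_of_ennreal_scaled)
      show "\<exists>l. (\<lambda>n. ennreal ((1 / \<epsilon> n) ^ ?d1) * kint \<nu>1 \<eta> p1 (\<epsilon> n) x) \<longlonglongrightarrow> ennreal l"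
        by (rule charted_kint_limit[OF ch1]) (use \<eta> p pcont p1 \<epsilon> in auto)
      show "0 \<le> (1 / \<epsilon> n) ^ ?d1" for n using \<epsilon>(1)[of n] by simp
    qed
    then show ?thesis by (simp add: K1_def power_divide)
  qed
  have conv2: "convergent (\<lambda>n. K2 n x / \<epsilon> n ^ ?d2)" for x
  proof -
    have "convergent (\<lambda>n. (1 / \<epsilon> n) ^ ?d2 * enn2real (kint \<nu>2 \<eta> p2 (\<epsilon> n) x))"
    proof (rule convergent_of_ennreal_scaled)
      show "\<exists>l. (\<lambda>n. ennreal ((1 / \<epsilon> n) ^ ?d2) * kint \<nu>2 \<eta> p2 (\<epsilon> n) x) \<longlonglongrightarrow> ennreal l"
        by (rule charted_kint_limit[OF ch2]) (use \<eta> p pcont p2 \<epsilon> in auto)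
      show "0 \<le> (1 / \<epsilon> n) ^ ?d2" for n using \<epsilon>(1)[of n] by simp
    qed
    then show ?thesis by (simp add: K2_def power_divide)
  qed
  \<comment> \<open>Relative to \<epsilon>^d1 the second share carries the extra factor
    \<epsilon>^(d2 - d1), which tends to 0 or is constantly 1.\<close>
  have conv21: "convergent (\<lambda>n. K2 n x / \<epsilon> n ^ ?d1)" for x
  proof -
    have "convergent (\<lambda>n. \<epsilon> n ^ (?d2 - ?d1))"
      using tendsto_power[OF \<epsilon>(2), of "?d2 - ?d1"] by (rule convergentI)
    then have "convergent (\<lambda>n. \<epsilon> n ^ (?d2 - ?d1) * (K2 n x / \<epsilon> n ^ ?d2))"
      using conv2 by (rule convergent_mult)
    moreover have "\<epsilon> n ^ (?d2 - ?d1) * (K2 n x / \<epsilon> n ^ ?d2) = K2 n x / \<epsilon> n ^ ?d1" for n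
      using \<epsilon>(1)[of n] dims by (simp add: power_diff)
    ultimately show ?thesis by simp
  qed
  have conv: "convergent (\<lambda>n. K n x / \<epsilon> n ^ ?d1)" for x
    using convergent_add[OF conv1 conv21] by (simp add: K12 add_divide_distrib)
  have K_le: "K n x \<le> (C1 + C2) * \<epsilon> n ^ ?d1" for n x
  proof -
    have "C2 * \<epsilon> n ^ ?d2 \<le> C2 * \<epsilon> n ^ ?d1" using le12[of n] C2 by (intro mult_left_mono) auto
    then show ?thesis unfolding K12 distrib_right using K1_le[of n x] K2_le[of n x] by linarith
  qed
  show "\<exists>r. strict_mono (r :: nat \<Rightarrow> nat) \<and> L2_cauchy \<nu>1 (\<lambda>n. u (r n))"
  proof (rule charted_total_weight_precompact[OF ch1, where \<kappa> = K and \<eta> = \<eta> and \<epsilon> = \<epsilon> and ?r0.0 = r0 and h = h and E = E and B = B and c = c and C = "C1 + C2"])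
    show "c * \<epsilon> n ^ ?d1 \<le> K n x \<and> K n x \<le> (C1 + C2) * \<epsilon> n ^ ?d1" if "x \<in> M1" for n x
      using K1_ge[OF that, of n] nonneg(2)[of n x] K_le[of n x] by (simp add: K12)
    show "(\<integral>\<^sup>+x. \<integral>\<^sup>+y. ennreal (\<eta> (dist x y / \<epsilon> n) * (u n x / sqrt (K n x) - u n y / sqrt (K n y))\<^sup>2) \<partial>\<nu>1 \<partial>\<nu>1) \<le> ennreal (E * (\<epsilon> n)\<^sup>2)" for n
      using en11[of n] by (simp add: w)
  qed (use \<epsilon> \<eta>h h r0 E B B0 c conv in auto)
  show "\<exists>r. strict_mono (r :: nat \<Rightarrow> nat) \<and> L2_cauchy \<nu>2 (\<lambda>n. u (r n))"
  proof (cases "?d1 = ?d2")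
    case True
    show ?thesis
    proof (rule charted_total_weight_precompact[OF ch2, where \<kappa> = K and \<eta> = \<eta> and \<epsilon> = \<epsilon> and ?r0.0 = r0 and h = h and E = E and B = B and c = c and C = "C1 + C2"])
      show "c * \<epsilon> n ^ ?d2 \<le> K n x \<and> K n x \<le> (C1 + C2) * \<epsilon> n ^ ?d2" if "x \<in> M2" for n x
        using K2_ge[OF that, of n] nonneg(1)[of n x] K_le[of n x] unfolding True by (simp add: K12)
      show "(\<integral>\<^sup>+x. \<integral>\<^sup>+y. ennreal (\<eta> (dist x y / \<epsilon> n) * (u n x / sqrt (K n x) - u n y / sqrt (K n y))\<^sup>2) \<partial>\<nu>2 \<partial>\<nu>2) \<le> ennreal (E * (\<epsilon> n)\<^sup>2)" for n
        using en22[of n] by (simp add: w)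
      show "convergent (\<lambda>n. K n x / \<epsilon> n ^ ?d2)" for x
        using conv[of x] unfolding True .
    qed (use \<epsilon> \<eta>h h r0 E B B0 c in auto)
  next
    case False
    then have less: "Suc ?d1 \<le> ?d2" using dims by simp
    have sq1: "ennreal (\<epsilon> n ^ ?d1) * sqnorm \<nu>1 (w n) \<le> ennreal (B / c)" for n
      unfolding w_eq using K1_ge nonneg(2)[of n] pos1[of n]
      by (intro weighted_sqnorm_le[OF M1(2) ae1 _ _ _ c _ B(1) B0]) (auto simp: K12 add_increasing2)
    have sq2: "ennreal (\<epsilon> n ^ ?d2) * sqnorm \<nu>2 (w n) \<le> ennreal (B / c)" for n
      unfolding w_eq using K2_ge nonneg(1)[of n] pos2[of n]
      by (intro weighted_sqnorm_le[OF M2(2) ae2 _ _ _ c _ B(2) B0]) (auto simp: K12 add_increasing)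
    \<comment> \<open>On the second manifold u = sqrt (K1 + K2) w, so the difference from sqrt K2 w
      is at most sqrt K1 |w| by subadditivity of the square root. The integral of its square is the
      quantity bounded by \<open>interaction_le\<close>.\<close>
    have diff_le: "sqnorm \<nu>2 (\<lambda>x. u n x - sqrt (K2 n x) * w n x) \<le> ennreal (2 * C * (E * (\<epsilon> n)\<^sup>2 + C3 * (B / c) * \<epsilon> n))" for n
    proof -
      have "sqnorm \<nu>2 (\<lambda>x. u n x - sqrt (K2 n x) * w n x) \<le> (\<integral>\<^sup>+x. kint \<nu>1 \<eta> p1 (\<epsilon> n) x * ennreal ((w n x)\<^sup>2) \<partial>\<nu>2)"
        unfolding sqnorm_def
      proof (rule nn_integral_mono_AE, use ae2 in eventually_elim)
        case (elim x)
        have "0 < c * \<epsilon> n ^ ?d2" using c pos2 by simp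
        then have "0 < K n x" using K2_ge[OF elim, of n] nonneg(1)[of n x] unfolding K12 by linarith
        then have "u n x = sqrt (K1 n x + K2 n x) * w n x" by (simp add: w K12)
        then have "(u n x - sqrt (K2 n x) * w n x)\<^sup>2 = (sqrt (K1 n x + K2 n x) - sqrt (K2 n x))\<^sup>2 * (w n x)\<^sup>2"
          by (simp only: left_diff_distrib[symmetric] power_mult_distrib)
        also have "\<dots> \<le> K1 n x * (w n x)\<^sup>2"
          by (intro mult_right_mono sqrt_add_diff_square_le nonneg) simp
        finally show ?case
          unfolding fin1 using nonneg(1)[of n x] by (simp add: ennreal_mult[symmetric] ennreal_leI)
      qed
      also have "\<dots> \<le> ennreal (2 * C) * ((\<integral>\<^sup>+x. \<integral>\<^sup>+y. ennreal (\<eta> (dist x y / \<epsilon> n) * (w n x - w n y)\<^sup>2) \<partial>\<nu>1 \<partial>\<nu>2)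
          + ennreal (C3 * \<epsilon> n ^ ?d2) * sqnorm \<nu>1 (w n))"
        using p1 by (intro interaction_le[OF M1(3) M2(3) M1(2) M2(2) _ _ _ \<eta>(2) ae1 _ C up3[OF \<epsilon>(1)]]) auto
      also have "\<dots> \<le> ennreal (2 * C) * (ennreal (E * (\<epsilon> n)\<^sup>2) + ennreal (C3 * (B / c) * \<epsilon> n))"
      proof (intro mult_left_mono add_mono en21)
        \<comment> \<open>The strict gap in dimension leaves one spare factor \<epsilon> after
          \<epsilon>^d1 is spent on the norm of \<open>w\<close>.\<close>
        have "\<epsilon> n ^ ?d2 \<le> \<epsilon> n ^ Suc ?d1"
          using \<epsilon>(1)[of n] \<epsilon>(3)[of n] less by (intro power_decreasing) auto
        then have "C3 * \<epsilon> n ^ ?d2 \<le> (C3 * \<epsilon> n) * \<epsilon> n ^ ?d1"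
          using C3 by (simp add: mult.assoc mult_left_mono)
        then have "ennreal (C3 * \<epsilon> n ^ ?d2) \<le> ennreal (C3 * \<epsilon> n) * ennreal (\<epsilon> n ^ ?d1)"
          using C3 \<epsilon>(1)[of n] by (subst ennreal_mult[symmetric]) (auto intro: ennreal_leI)
        then have "ennreal (C3 * \<epsilon> n ^ ?d2) * sqnorm \<nu>1 (w n) \<le> (ennreal (C3 * \<epsilon> n) * ennreal (\<epsilon> n ^ ?d1)) * sqnorm \<nu>1 (w n)"
          by (rule mult_right_mono) simp
        also have "\<dots> \<le> ennreal (C3 * \<epsilon> n) * ennreal (B / c)"
          unfolding mult.assoc by (intro mult_left_mono sq1) simp
        also have "\<dots> = ennreal (C3 * (B / c) * \<epsilon> n)"
          using C3 \<epsilon>(1)[of n] B0 c by (subst ennreal_mult[symmetric]) (auto simp: mult_ac)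
        finally show "ennreal (C3 * \<epsilon> n ^ ?d2) * sqnorm \<nu>1 (w n) \<le> ennreal (C3 * (B / c) * \<epsilon> n)" .
      qed simp
      also have "\<dots> = ennreal (2 * C * (E * (\<epsilon> n)\<^sup>2 + C3 * (B / c) * \<epsilon> n))"
      proof -
        have "0 \<le> E * (\<epsilon> n)\<^sup>2" "0 \<le> C3 * (B / c) * \<epsilon> n"
          using E C3 B0 c \<epsilon>(1)[of n] by auto
        then show ?thesis
          using C by (subst ennreal_plus[symmetric], simp, simp) (intro ennreal_mult[symmetric], auto)
      qed
      finally show ?thesis .
    qed
    show ?thesis
    \<comment> \<open>The weight is \<open>K2\<close> and not \<open>K\<close>: it is bounded by a
      multiple of \<epsilon>^d2 even near the intersection.\<close>
    proof (rule charted_weighted_precompact[OF ch2, where w = w and \<kappa> = K2 and \<epsilon> = \<epsilon> and E = "E / h" and B = "B / c" and C = C2])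
      show "osc \<nu>2 UNIV (w n) (r0 * \<epsilon> n) \<le> ennreal (E / h * (\<epsilon> n)\<^sup>2)" for n
        by (rule osc_le_energy[OF M2(3,2) _ _ \<eta>h h \<epsilon>(1) en22 E]) auto
      have "(\<lambda>n. ennreal (2 * C * (E * (\<epsilon> n)\<^sup>2 + C3 * (B / c) * \<epsilon> n))) \<longlonglongrightarrow> ennreal (2 * C * (E * 0\<^sup>2 + C3 * (B / c) * 0))"
        by (intro tendsto_ennrealI tendsto_intros \<epsilon>(2))
      then have lim: "(\<lambda>n. ennreal (2 * C * (E * (\<epsilon> n)\<^sup>2 + C3 * (B / c) * \<epsilon> n))) \<longlonglongrightarrow> 0" by simp
      show "(\<lambda>n. sqnorm \<nu>2 (\<lambda>x. u n x - sqrt (K2 n x) * w n x)) \<longlonglongrightarrow> 0"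
        by (rule tendsto_sandwich[OF _ _ tendsto_const lim]) (use diff_le in \<open>auto intro!: always_eventually\<close>)
    qed (use \<epsilon> h r0 E sq2 nonneg K2_le conv2 in auto)
  qed
qed

text \<open>Functions Borel on the ambient space restrict to measurable functions for all three
  measures, so the formula for sets extends by the standard induction over nonnegative Borel
  functions.\<close>

lemma nn_integral_union_measure:
  assumes N1: "sets N1 = sets (restrict_space borel (space N1))"
    and N2: "sets N2 = sets (restrict_space borel (space N2))"
    and g: "g \<in> borel_measurable (borel :: 'a::euclidean_space measure)"
  shows "(\<integral>\<^sup>+x. g x \<partial>union_measure a N1 b N2) =
    ennreal a * (\<integral>\<^sup>+x. g x \<partial>N1) + ennreal b * (\<integral>\<^sup>+x. g x \<partial>N2)"
proof -
  have meas: "f \<in> borel_measurable N1" "f \<in> borel_measurable N2" "f \<in> borel_measurable (union_measure a N1 b N2)"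
    if "f \<in> borel_measurable (borel :: 'a measure)" for f :: "'a \<Rightarrow> ennreal"
    by (subst measurable_cong_sets[OF N1 refl], rule measurable_restrict_space1[OF that])
      (subst measurable_cong_sets[OF N2 refl], rule measurable_restrict_space1[OF that],
       subst measurable_cong_sets[OF sets_union_measure refl], rule measurable_restrict_space1[OF that])
  show ?thesis
    using g
  proof (induction rule: borel_measurable_induct)
    case (cong f g)
    then show ?case by (metis ext UNIV_I space_borel)
  next
    case (set A)
    let ?S = "space N1 \<union> space N2"
    have "A \<inter> space N1 \<in> sets N1"
      unfolding N1 using set by (subst sets_restrict_space) auto
    moreover have "A \<inter> space N2 \<in> sets N2"
      unfolding N2 using set by (subst sets_restrict_space) auto
    moreover have AS: "A \<inter> ?S \<in> sets (restrict_space borel ?S)"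
      using set by (subst sets_restrict_space) auto
    moreover have "(\<integral>\<^sup>+x. indicator A x \<partial>N) = emeasure N (A \<inter> space N)" if "A \<inter> space N \<in> sets N" for N
    proof -
      have "(\<integral>\<^sup>+x. indicator A x \<partial>N) = (\<integral>\<^sup>+x. indicator (A \<inter> space N) x \<partial>N)"
        by (intro nn_integral_cong) (auto simp: indicator_def)
      also have "\<dots> = emeasure N (A \<inter> space N)" using that by (rule nn_integral_indicator)
      finally show ?thesis .
    qed
    ultimately show ?case
      using emeasure_union_measure[OF N1 N2 AS, of a b]
      by (simp add: sets_union_measure space_union_measure Int_assoc Int_absorb1)
  next
    case (mult f c)
    then show ?case
      using meas[OF \<open>f \<in> borel_measurable borel\<close>] by (simp add: nn_integral_cmult distrib_left mult.left_commute)
  next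
    case (add f g)
    then show ?case
      using meas[OF \<open>f \<in> borel_measurable borel\<close>] meas[OF \<open>g \<in> borel_measurable borel\<close>] by (simp add: nn_integral_add distrib_left ac_simps)
  next
    case (seq F)
    have "(\<integral>\<^sup>+x. (SUP i. F i) x \<partial>N) = (SUP i. \<integral>\<^sup>+x. F i x \<partial>N)" if "\<And>i. F i \<in> borel_measurable N" for N
      using that \<open>incseq F\<close> by (simp add: nn_integral_monotone_convergence_SUP image_comp SUP_apply)
    then have "(\<integral>\<^sup>+x. (SUP i. F i) x \<partial>union_measure a N1 b N2) = (SUP i. \<integral>\<^sup>+x. F i x \<partial>union_measure a N1 b N2)"
      "(\<integral>\<^sup>+x. (SUP i. F i) x \<partial>N1) = (SUP i. \<integral>\<^sup>+x. F i x \<partial>N1)" "(\<integral>\<^sup>+x. (SUP i. F i) x \<partial>N2) = (SUP i. \<integral>\<^sup>+x. F i x \<partial>N2)"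
      using meas[OF seq.hyps(1)] by blast+
    moreover have "incseq (\<lambda>i. \<integral>\<^sup>+x. F i x \<partial>N)" for N
      using \<open>incseq F\<close> by (auto simp: incseq_def le_fun_def intro!: nn_integral_mono)
    then have "incseq (\<lambda>i. ennreal c * \<integral>\<^sup>+x. F i x \<partial>N)" for N c
      by (auto simp: incseq_def intro!: mult_left_mono)
    ultimately show ?case
      using seq.IH by (simp add: SUP_mult_left_ennreal ennreal_SUP_add)
  qed
qed

text \<open>As \<rho> is controlled on \<open>M\<close> only, it is cut off to 0 outside before it
  serves as a Borel density on the ambient space.\<close>

lemma weighted_density_borel:
  fixes V :: "'a::euclidean_space measure"
  assumes V: "space V = M" "sets V = sets (restrict_space borel M)" and M: "M \<in> sets borel"
    and \<rho>: "continuous_on M \<rho>" and a: "0 \<le> a" and nonneg: "\<And>x. x \<in> M \<Longrightarrow> 0 \<le> \<rho> x"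
    and g: "g \<in> borel_measurable borel"
  shows "ennreal a * (\<integral>\<^sup>+x. g x \<partial>density V (\<lambda>x. ennreal (\<rho> x))) =
    (\<integral>\<^sup>+x. ennreal (a * (if x \<in> M then \<rho> x else 0)) * g x \<partial>distr V borel (\<lambda>x. x))"
proof -
  have idV [measurable]: "(\<lambda>x. x) \<in> measurable V borel"
    by (subst measurable_cong_sets[OF V(2) refl]) (simp add: measurable_restrict_space1)
  have gV [measurable]: "g \<in> borel_measurable V"
    using measurable_compose[OF idV g] by simp
  have [measurable]: "\<rho> \<in> borel_measurable V"
    by (subst measurable_cong_sets[OF V(2) refl]) (rule borel_measurable_continuous_on_restrict[OF \<rho>])
  have [measurable]: "(\<lambda>x. if x \<in> M then \<rho> x else 0) \<in> borel_measurable borel"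
    using M \<rho> by (intro borel_measurable_continuous_on_if) auto
  have "ennreal a * (\<integral>\<^sup>+x. g x \<partial>density V (\<lambda>x. ennreal (\<rho> x))) = ennreal a * (\<integral>\<^sup>+x. ennreal (\<rho> x) * g x \<partial>V)"
    by (simp add: nn_integral_density)
  also have "\<dots> = (\<integral>\<^sup>+x. ennreal a * (ennreal (\<rho> x) * g x) \<partial>V)"
    by (rule nn_integral_cmult[symmetric]) measurable
  also have "\<dots> = (\<integral>\<^sup>+x. ennreal (a * (if x \<in> M then \<rho> x else 0)) * g x \<partial>V)"
    using V(1) nonneg a by (intro nn_integral_cong) (simp add: ennreal_mult mult.assoc)
  also have "\<dots> = (\<integral>\<^sup>+x. ennreal (a * (if x \<in> M then \<rho> x else 0)) * g x \<partial>distr V borel (\<lambda>x. x))"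
    using g by (subst nn_integral_distr) auto
  finally show ?thesis .
qed

lemma two_manifolds_precompact:
  fixes \<nu>1 \<nu>2 :: "'a::euclidean_space measure"
  assumes ch1: "charted TYPE('b1::euclidean_space) \<nu>1 M1" and ch2: "charted TYPE('b2::euclidean_space) \<nu>2 M2"
    and dims: "DIM('b1) \<le> DIM('b2)"
    and \<eta>: "antimono \<eta>" "\<And>t. 0 \<le> \<eta> t" "\<And>t. 1 < t \<Longrightarrow> \<eta> t = 0"
    and \<eta>h: "\<And>t. 0 \<le> t \<Longrightarrow> t \<le> r0 \<Longrightarrow> h \<le> \<eta> t" and h: "0 < h" and r0: "0 < r0"
    and p: "p1 \<in> borel_measurable borel" "p2 \<in> borel_measurable borel"
    and pcont: "continuous_on M1 p1" "continuous_on M2 p2"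
    and c: "0 < c"
    and p1: "\<And>x. x \<in> M1 \<Longrightarrow> c \<le> p1 x \<and> p1 x \<le> C" and p2: "\<And>x. x \<in> M2 \<Longrightarrow> c \<le> p2 x \<and> p2 x \<le> C"
    and C: "0 \<le> C"
    and \<epsilon>: "\<And>n. 0 < \<epsilon> n" "\<epsilon> \<longlonglongrightarrow> 0"
    and u: "\<And>n. u n \<in> borel_measurable borel"
    and K: "\<And>n x. K n x = enn2real (kint \<nu>1 \<eta> p1 (\<epsilon> n) x) + enn2real (kint \<nu>2 \<eta> p2 (\<epsilon> n) x)"
    and w: "\<And>n x. w n x = u n x / sqrt (K n x)"
    and E: "0 \<le> E"
    and en: "\<And>\<nu> \<nu>' n. \<nu> \<in> {\<nu>1, \<nu>2} \<Longrightarrow> \<nu>' \<in> {\<nu>1, \<nu>2} \<Longrightarrow>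
      (\<integral>\<^sup>+x. \<integral>\<^sup>+y. ennreal (\<eta> (dist x y / \<epsilon> n) * (w n x - w n y)\<^sup>2) \<partial>\<nu>' \<partial>\<nu>) \<le> ennreal (E * (\<epsilon> n)\<^sup>2)"
    and B: "\<And>n. sqnorm \<nu>1 (u n) \<le> ennreal B" "\<And>n. sqnorm \<nu>2 (u n) \<le> ennreal B" and B0: "0 \<le> B"
  shows "\<exists>r. strict_mono (r :: nat \<Rightarrow> nat) \<and> L2_cauchy \<nu>1 (\<lambda>n. u (r n)) \<and> L2_cauchy \<nu>2 (\<lambda>n. u (r n))"
proof -
  have "\<exists>c'>0. \<exists>\<delta>>0. \<forall>e x. 0 < e \<longrightarrow> e \<le> \<delta> \<longrightarrow> x \<in> M1 \<longrightarrow> ennreal (c' * e ^ DIM('b1)) \<le> kint \<nu>1 \<eta> p1 e x"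
    by (rule charted_kint_ge[OF ch1, where h = h and c = c and ?r0.0 = r0]) (use \<eta>h h r0 p1 c in auto)
  then obtain c1 \<delta>1 where c1: "0 < c1" "0 < \<delta>1" and
    low1: "\<forall>e x. 0 < e \<longrightarrow> e \<le> \<delta>1 \<longrightarrow> x \<in> M1 \<longrightarrow> ennreal (c1 * e ^ DIM('b1)) \<le> kint \<nu>1 \<eta> p1 e x"
    by blast
  have "\<exists>c'>0. \<exists>\<delta>>0. \<forall>e x. 0 < e \<longrightarrow> e \<le> \<delta> \<longrightarrow> x \<in> M2 \<longrightarrow> ennreal (c' * e ^ DIM('b2)) \<le> kint \<nu>2 \<eta> p2 e x"
    by (rule charted_kint_ge[OF ch2, where h = h and c = c and ?r0.0 = r0]) (use \<eta>h h r0 p2 c in auto)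
  then obtain c2 \<delta>2 where c2: "0 < c2" "0 < \<delta>2" and
    low2: "\<forall>e x. 0 < e \<longrightarrow> e \<le> \<delta>2 \<longrightarrow> x \<in> M2 \<longrightarrow> ennreal (c2 * e ^ DIM('b2)) \<le> kint \<nu>2 \<eta> p2 e x"
    by blast
  define \<delta> where "\<delta> = min 1 (min \<delta>1 \<delta>2)"
  have "0 < \<delta>" using c1 c2 by (simp add: \<delta>_def)
  then obtain N where N: "\<And>n. n \<ge> N \<Longrightarrow> \<epsilon> n < \<delta>"
    using order_tendstoD(2)[OF \<epsilon>(2)] unfolding eventually_sequentially by blast
  have small: "\<epsilon> n \<le> 1" "\<epsilon> n \<le> \<delta>1" "\<epsilon> n \<le> \<delta>2" if "n \<ge> N" for n
    using N[OF that] by (auto simp: \<delta>_def)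
  define c' where "c' = min c1 c2"
  have c': "0 < c'" "c' \<le> c1" "c' \<le> c2" using c1 c2 by (auto simp: c'_def)
  have low1': "ennreal (c' * \<epsilon> n ^ DIM('b1)) \<le> kint \<nu>1 \<eta> p1 (\<epsilon> n) x" if "n \<ge> N" "x \<in> M1" for n x
  proof -
    have "ennreal (c' * \<epsilon> n ^ DIM('b1)) \<le> ennreal (c1 * \<epsilon> n ^ DIM('b1))"
      using c' \<epsilon>(1)[of n] by (intro ennreal_leI mult_right_mono) auto
    also have "\<dots> \<le> kint \<nu>1 \<eta> p1 (\<epsilon> n) x" using low1 \<epsilon>(1)[of n] small[OF that(1)] that(2) by blast
    finally show ?thesis .
  qed
  have low2': "ennreal (c' * \<epsilon> n ^ DIM('b2)) \<le> kint \<nu>2 \<eta> p2 (\<epsilon> n) x" if "n \<ge> N" "x \<in> M2" for n x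
  proof -
    have "ennreal (c' * \<epsilon> n ^ DIM('b2)) \<le> ennreal (c2 * \<epsilon> n ^ DIM('b2))"
      using c' \<epsilon>(1)[of n] by (intro ennreal_leI mult_right_mono) auto
    also have "\<dots> \<le> kint \<nu>2 \<eta> p2 (\<epsilon> n) x" using low2 \<epsilon>(1)[of n] small[OF that(1)] that(2) by blast
    finally show ?thesis .
  qed
  have pC: "0 \<le> p1 x \<and> p1 x \<le> C" if "x \<in> M1" for x using p1[OF that] c by linarith
  have pC2: "0 \<le> p2 x \<and> p2 x \<le> C" if "x \<in> M2" for x using p2[OF that] c by linarith
  \<comment> \<open>Formulated along an arbitrary subsequence \<open>q\<close> beyond
    \<open>N\<close>, so that it applies a second time to the subsequence already found for the
    first measure.\<close>
  have sub: "(\<exists>r. strict_mono (r :: nat \<Rightarrow> nat) \<and> L2_cauchy \<nu>1 (\<lambda>n. u (q (r n)))) \<and>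
      (\<exists>r. strict_mono (r :: nat \<Rightarrow> nat) \<and> L2_cauchy \<nu>2 (\<lambda>n. u (q (r n))))"
    if q: "strict_mono q" "\<And>n. N \<le> q n" for q :: "nat \<Rightarrow> nat"
  proof -
    have lim: "(\<lambda>n. \<epsilon> (q n)) \<longlonglongrightarrow> 0"
      using LIMSEQ_subseq_LIMSEQ[OF \<epsilon>(2) q(1)] by (simp add: o_def)
    have small_q: "\<epsilon> (q n) \<le> 1" for n using small(1) q(2) by blast
    have low1_q: "ennreal (c' * \<epsilon> (q n) ^ DIM('b1)) \<le> kint \<nu>1 \<eta> p1 (\<epsilon> (q n)) x" if "x \<in> M1" for n x
      by (rule low1'[OF q(2) that])
    have low2_q: "ennreal (c' * \<epsilon> (q n) ^ DIM('b2)) \<le> kint \<nu>2 \<eta> p2 (\<epsilon> (q n)) x" if "x \<in> M2" for n x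
      by (rule low2'[OF q(2) that])
    have mem: "\<nu>1 \<in> {\<nu>1, \<nu>2}" "\<nu>2 \<in> {\<nu>1, \<nu>2}" by simp_all
    note en11 = en[OF mem(1) mem(1)] and en22 = en[OF mem(2) mem(2)] and en21 = en[OF mem(2) mem(1)]
    note aux = two_manifolds_precompact_aux[OF ch1 ch2 dims, where \<epsilon> = "\<lambda>n. \<epsilon> (q n)" and u = "\<lambda>n. u (q n)"
      and K = "\<lambda>n. K (q n)" and w = "\<lambda>n. w (q n)" and E = E and B = B and c = c' and C = C and h = h and ?r0.0 = r0
      and \<eta> = \<eta> and ?p1.0 = p1 and ?p2.0 = p2]
    show ?thesis
    proof
      show "\<exists>r. strict_mono (r :: nat \<Rightarrow> nat) \<and> L2_cauchy \<nu>1 (\<lambda>n. u (q (r n)))"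
        by (rule aux(1)) (fact \<eta> \<eta>h h r0 p pcont pC pC2 C \<epsilon>(1) lim small_q u K w c'(1) low1_q low2_q E en11 en22 en21 B B0)+
      show "\<exists>r. strict_mono (r :: nat \<Rightarrow> nat) \<and> L2_cauchy \<nu>2 (\<lambda>n. u (q (r n)))"
        by (rule aux(2)) (fact \<eta> \<eta>h h r0 p pcont pC pC2 C \<epsilon>(1) lim small_q u K w c'(1) low1_q low2_q E en11 en22 en21 B B0)+
    qed
  qed
  have shift: "strict_mono (\<lambda>n. n + N)" by (simp add: strict_mono_def)
  obtain r1 :: "nat \<Rightarrow> nat" where r1: "strict_mono r1" "L2_cauchy \<nu>1 (\<lambda>n. u (r1 n + N))"
    using sub[OF shift] by auto
  define q where "q n = r1 n + N" for n
  have q: "strict_mono q" "\<And>n. N \<le> q n" using r1(1) by (auto simp: q_def strict_mono_def)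
  obtain r2 :: "nat \<Rightarrow> nat" where r2: "strict_mono r2" "L2_cauchy \<nu>2 (\<lambda>n. u (q (r2 n)))"
    using sub[OF q] by blast
  have "L2_cauchy \<nu>1 (\<lambda>n. u (q (r2 n)))"
    using L2_cauchy_subseq[OF r1(2) r2(1)] by (simp add: q_def)
  moreover have "strict_mono (\<lambda>n. q (r2 n))"
    using strict_mono_o[OF q(1) r2(1)] by (simp add: o_def)
  ultimately show ?thesis using r2(2) by (intro exI[of _ "\<lambda>n. q (r2 n)"]) simp
qed

lemma antimono_max_zero:
  fixes \<eta> :: "real \<Rightarrow> real"
  assumes "\<And>s t. 0 \<le> s \<Longrightarrow> s \<le> t \<Longrightarrow> \<eta> t \<le> \<eta> s"
  shows "antimono (\<lambda>t. \<eta> (max 0 t))"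
  by (intro antimonoI assms) auto

lemma support_zero_beyond_one:
  fixes \<eta> :: "real \<Rightarrow> real"
  assumes "closure {t \<in> {0..}. \<eta> t \<noteq> 0} = {0..1}" and "1 < t"
  shows "\<eta> t = 0"
proof (rule ccontr)
  assume "\<eta> t \<noteq> 0"
  then have "t \<in> closure {t \<in> {0..}. \<eta> t \<noteq> 0}"
    using assms(2) by (intro subsetD[OF closure_subset]) auto
  then show False using assms by simp
qed

lemma lower_bound_near_zero:
  fixes \<eta> :: "real \<Rightarrow> real"
  assumes "continuous (at 0 within {0..}) \<eta>" and "0 < \<eta> 0"
  obtains r0 where "0 < r0" "\<And>t. 0 \<le> t \<Longrightarrow> t \<le> r0 \<Longrightarrow> \<eta> 0 / 2 \<le> \<eta> t"
proof -
  have "0 < \<eta> 0 / 2" using assms(2) by simp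
  then obtain d where d: "0 < d" "\<And>t. t \<in> {0..} \<Longrightarrow> dist t 0 < d \<Longrightarrow> dist (\<eta> t) (\<eta> 0) < \<eta> 0 / 2"
    using assms(1) unfolding continuous_within_eps_delta by meson
  have "\<eta> 0 / 2 \<le> \<eta> t" if "0 \<le> t" "t \<le> d / 2" for t
  proof -
    have "\<bar>\<eta> t - \<eta> 0\<bar> < \<eta> 0 / 2"
      using d(2)[of t] d(1) that by (simp add: dist_real_def)
    then show ?thesis by linarith
  qed
  then show ?thesis using that[of "d / 2"] d(1) by auto
qed

text \<open>Finiteness is not built into \<open>is_volume_measure\<close>; it comes from the
  probability normalisation, as a density of at least 1/C bounds the volume by C times the
  probability.\<close>

lemma finite_volume_of_density:
  assumes "prob_space (density V (\<lambda>x. ennreal (\<rho> x)))" and \<rho>: "\<rho> \<in> borel_measurable V"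
    and C: "0 < C" and low: "\<And>x. x \<in> space V \<Longrightarrow> 1 / C \<le> \<rho> x"
  shows "finite_measure V"
proof (rule finite_measureI)
  interpret prob_space "density V (\<lambda>x. ennreal (\<rho> x))" by fact
  have "emeasure V (space V) = (\<integral>\<^sup>+x. 1 \<partial>V)" by simp
  also have "\<dots> \<le> (\<integral>\<^sup>+x. ennreal C * ennreal (\<rho> x) \<partial>V)"
  proof (rule nn_integral_mono)
    fix x assume "x \<in> space V"
    then have "1 \<le> C * \<rho> x"
      using low[of x] C by (simp add: field_simps)
    moreover have "0 \<le> \<rho> x" using low[OF \<open>x \<in> space V\<close>] C by (meson divide_nonneg_pos order_trans zero_le_one)
    ultimately show "1 \<le> ennreal C * ennreal (\<rho> x)"
      using C by (simp add: ennreal_mult[symmetric])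
  qed
  also have "\<dots> = ennreal C * (\<integral>\<^sup>+x. ennreal (\<rho> x) \<partial>V)"
    using \<rho> by (intro nn_integral_cmult) simp
  also have "(\<integral>\<^sup>+x. ennreal (\<rho> x) \<partial>V) = 1"
    using emeasure_space_1 \<rho> by (simp add: emeasure_density cong: nn_integral_cong)
  finally show "emeasure V (space V) \<noteq> \<infinity>" by (auto simp: top_unique)
qed

theorem theorem3p1:
  fixes M1 M2 :: "(real^'N) set"
    and d12 :: nat
    and Vol1 Vol2 Vol \<mu>1 \<mu>2 \<mu> :: "(real^'N) measure"
    and \<rho>1 \<rho>2 :: "real^'N \<Rightarrow> real"
    and C\<rho> \<alpha>1 \<alpha>2 :: real
    and \<eta> :: "real \<Rightarrow> real"
    and \<epsilon> :: "nat \<Rightarrow> real"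
    and u :: "nat \<Rightarrow> real^'N \<Rightarrow> real"
  assumes "compact M1" and "smooth_submanifold CARD('d1::finite) M1"
    and "compact M2" and "smooth_submanifold CARD('d2::finite) M2"
    and "1 \<le> CARD('d1)" and "CARD('d1) \<le> CARD('d2)"
    and "smooth_submanifold d12 (M1 \<inter> M2)" and "d12 < CARD('d1)"
    and "\<And>x. x \<in> M1 \<inter> M2 \<Longrightarrow>
           dim (span (tangent_space M1 x \<union> tangent_space M2 x)) = CARD('d1) + CARD('d2) - d12"
    and "is_volume_measure TYPE('d1) M1 Vol1" and "is_volume_measure TYPE('d2) M2 Vol2"
    and "Vol = union_measure 1 Vol1 1 Vol2"
    and "0 < C\<rho>"
    and "\<exists>L. L-lipschitz_on M1 \<rho>1" and "\<And>x. x \<in> M1 \<Longrightarrow> 1 / C\<rho> \<le> \<rho>1 x \<and> \<rho>1 x \<le> C\<rho>"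
    and "\<exists>L. L-lipschitz_on M2 \<rho>2" and "\<And>x. x \<in> M2 \<Longrightarrow> 1 / C\<rho> \<le> \<rho>2 x \<and> \<rho>2 x \<le> C\<rho>"
    and "\<mu>1 = density Vol1 (\<lambda>x. ennreal (\<rho>1 x))" and "prob_space \<mu>1"
    and "\<mu>2 = density Vol2 (\<lambda>x. ennreal (\<rho>2 x))" and "prob_space \<mu>2"
    and "0 < \<alpha>1" and "0 < \<alpha>2" and "\<alpha>1 + \<alpha>2 = 1"
    and "\<mu> = union_measure \<alpha>1 \<mu>1 \<alpha>2 \<mu>2"
    and "\<And>t. 0 \<le> t \<Longrightarrow> 0 \<le> \<eta> t" and "\<And>s t. 0 \<le> s \<Longrightarrow> s \<le> t \<Longrightarrow> \<eta> t \<le> \<eta> s"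
    and "0 < \<eta> 0" and "continuous (at 0 within {0..}) \<eta>"
    and "closure {t \<in> {0..}. \<eta> t \<noteq> 0} = {0..1}"
    and "\<And>n. 0 < \<epsilon> n" and "\<epsilon> \<longlonglongrightarrow> 0"
    and "\<And>n. u n \<in> L2 Vol"
    and "(SUP n. energy \<eta> \<mu> (\<epsilon> n) (u n)) < \<infinity>"
    and "bdd_above (range (\<lambda>n. L2_norm Vol (u n)))"
  shows "\<exists>r v. strict_mono (r :: nat \<Rightarrow> nat) \<and> v \<in> L2 Vol \<and>
           (\<lambda>k. L2_norm Vol (\<lambda>x. u (r k) x - v x)) \<longlonglongrightarrow> 0"
proof -
  note M1 = assms(1,2) and M2 = assms(3,4) and dims = assms(6)
    and vol1 = assms(10) and vol2 = assms(11) and Vol = assms(12) and C\<rho> = assms(13)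
    and lip1 = assms(14) and \<rho>1 = assms(15) and lip2 = assms(16) and \<rho>2 = assms(17)
    and \<mu>1 = assms(18,19) and \<mu>2 = assms(20,21) and \<alpha> = assms(22,23) and \<mu> = assms(25)
    and \<eta>_nonneg = assms(26) and \<eta>_mono = assms(27) and \<eta>_pos = assms(28) and \<eta>_cont = assms(29)
    and \<eta>_supp = assms(30) and \<epsilon> = assms(31,32) and u = assms(33) and energy = assms(34) and norms = assms(35)

  \<comment> \<open>The volume measures transported to the ambient space\<close>
  have space1: "space Vol1 = M1" and sets1: "sets Vol1 = sets (restrict_space borel M1)"
    using vol1 unfolding is_volume_measure_def by auto
  have space2: "space Vol2 = M2" and sets2: "sets Vol2 = sets (restrict_space borel M2)"
    using vol2 unfolding is_volume_measure_def by auto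
  have borel12 [measurable]: "M1 \<in> sets borel" "M2 \<in> sets borel"
    using M1(1) M2(1) by (auto intro: borel_compact)
  have cont\<rho>: "continuous_on M1 \<rho>1" "continuous_on M2 \<rho>2"
    using lip1 lip2 by (auto dest: lipschitz_on_continuous_on)
  have \<rho>1_meas: "\<rho>1 \<in> borel_measurable Vol1"
    by (subst measurable_cong_sets[OF sets1 refl]) (rule borel_measurable_continuous_on_restrict[OF cont\<rho>(1)])
  have \<rho>2_meas: "\<rho>2 \<in> borel_measurable Vol2"
    by (subst measurable_cong_sets[OF sets2 refl]) (rule borel_measurable_continuous_on_restrict[OF cont\<rho>(2)])
  have fin1: "finite_measure Vol1"
    using \<mu>1 \<rho>1 space1 by (intro finite_volume_of_density[OF _ \<rho>1_meas C\<rho>]) auto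
  have fin2: "finite_measure Vol2"
    using \<mu>2 \<rho>2 space2 by (intro finite_volume_of_density[OF _ \<rho>2_meas C\<rho>]) auto
  define \<nu>1 where "\<nu>1 = distr Vol1 borel (\<lambda>x. x)"
  define \<nu>2 where "\<nu>2 = distr Vol2 borel (\<lambda>x. x)"
  have ch1: "charted TYPE(real^'d1) \<nu>1 M1" unfolding \<nu>1_def by (rule charted_volume_measure[OF M1 vol1 fin1])
  have ch2: "charted TYPE(real^'d2) \<nu>2 M2" unfolding \<nu>2_def by (rule charted_volume_measure[OF M2 vol2 fin2])
  have \<nu>_fin: "finite_measure \<nu>1" "finite_measure \<nu>2" and \<nu>_sets [measurable_cong]: "sets \<nu>1 = sets borel" "sets \<nu>2 = sets borel"
    using ch1 ch2 unfolding charted_def by auto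
  interpret N1: finite_measure \<nu>1 by fact
  interpret N2: finite_measure \<nu>2 by fact
  have ae1: "AE x in \<nu>1. x \<in> M1" and ae2: "AE x in \<nu>2. x \<in> M2"
    using charted_AE[OF ch1] charted_AE[OF ch2] .
  have id1: "(\<lambda>x. x) \<in> measurable Vol1 borel"
    by (subst measurable_cong_sets[OF sets1 refl]) (simp add: measurable_restrict_space1)
  have id2: "(\<lambda>x. x) \<in> measurable Vol2 borel"
    by (subst measurable_cong_sets[OF sets2 refl]) (simp add: measurable_restrict_space1)
  have int_\<nu>1: "(\<integral>\<^sup>+x. g x \<partial>\<nu>1) = (\<integral>\<^sup>+x. g x \<partial>Vol1)" if "g \<in> borel_measurable borel" for g
    unfolding \<nu>1_def using that by (intro nn_integral_distr[OF id1]) simp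
  have int_\<nu>2: "(\<integral>\<^sup>+x. g x \<partial>\<nu>2) = (\<integral>\<^sup>+x. g x \<partial>Vol2)" if "g \<in> borel_measurable borel" for g
    unfolding \<nu>2_def using that by (intro nn_integral_distr[OF id2]) simp
  have spaceVol: "space Vol = M1 \<union> M2"
    unfolding Vol space_union_measure space1 space2 ..
  have setsVol: "sets Vol = sets (restrict_space borel (M1 \<union> M2))"
    unfolding Vol sets_union_measure space1 space2 ..
  have int_Vol: "(\<integral>\<^sup>+x. g x \<partial>Vol) = (\<integral>\<^sup>+x. g x \<partial>\<nu>1) + (\<integral>\<^sup>+x. g x \<partial>\<nu>2)" if "g \<in> borel_measurable borel" for g
    unfolding Vol int_\<nu>1[OF that] int_\<nu>2[OF that]
    by (subst nn_integral_union_measure[OF _ _ that]) (simp_all add: sets1 sets2 space1 space2)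

  \<comment> \<open>The weighted densities and integration against \<open>\<mu>\<close>\<close>
  define p1 where "p1 x = \<alpha>1 * (if x \<in> M1 then \<rho>1 x else 0)" for x
  define p2 where "p2 x = \<alpha>2 * (if x \<in> M2 then \<rho>2 x else 0)" for x
  have p_meas [measurable]: "p1 \<in> borel_measurable borel" "p2 \<in> borel_measurable borel"
    unfolding p1_def p2_def using cont\<rho> borel12
    by (intro borel_measurable_times borel_measurable_const borel_measurable_continuous_on_if; simp)+
  have p_cont: "continuous_on M1 p1" "continuous_on M2 p2"
    unfolding p1_def p2_def using cont\<rho>
    by (auto intro!: continuous_on_mult continuous_on_const cong: continuous_on_cong)
  \<comment> \<open>\<open>c\<close> and \<open>C\<close> bound both products of a mixture weight
    and a density from below and above at once.\<close>
  define c where "c = min \<alpha>1 \<alpha>2 / C\<rho>"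
  define C where "C = max \<alpha>1 \<alpha>2 * C\<rho>"
  have c: "0 < c" and C: "0 \<le> C" using \<alpha> C\<rho> by (auto simp: c_def C_def)
  have p1: "c \<le> p1 x \<and> p1 x \<le> C" if "x \<in> M1" for x
  proof
    have "c = min \<alpha>1 \<alpha>2 * (1 / C\<rho>)" by (simp add: c_def)
    also have "\<dots> \<le> \<alpha>1 * \<rho>1 x" using \<rho>1[OF that] \<alpha> C\<rho> by (intro mult_mono) auto
    finally show "c \<le> p1 x" using that by (simp add: p1_def)
    have "0 \<le> \<rho>1 x" using \<rho>1[OF that] C\<rho> by (meson divide_nonneg_pos order_trans zero_le_one)
    then show "p1 x \<le> C" unfolding p1_def C_def using that \<rho>1[OF that] \<alpha> by (simp, intro mult_mono) auto
  qed
  have p2: "c \<le> p2 x \<and> p2 x \<le> C" if "x \<in> M2" for x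
  proof
    have "c = min \<alpha>1 \<alpha>2 * (1 / C\<rho>)" by (simp add: c_def)
    also have "\<dots> \<le> \<alpha>2 * \<rho>2 x" using \<rho>2[OF that] \<alpha> C\<rho> by (intro mult_mono) auto
    finally show "c \<le> p2 x" using that by (simp add: p2_def)
    have "0 \<le> \<rho>2 x" using \<rho>2[OF that] C\<rho> by (meson divide_nonneg_pos order_trans zero_le_one)
    then show "p2 x \<le> C" unfolding p2_def C_def using that \<rho>2[OF that] \<alpha> by (simp, intro mult_mono) auto
  qed
  have \<rho>_nonneg: "x \<in> M1 \<Longrightarrow> 0 \<le> \<rho>1 x" "x \<in> M2 \<Longrightarrow> 0 \<le> \<rho>2 x" for x
    using \<rho>1[of x] \<rho>2[of x] C\<rho> by (meson divide_nonneg_pos order_trans zero_le_one)+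
  have space\<mu>: "space \<mu> = M1 \<union> M2"
    unfolding \<mu> space_union_measure \<mu>1(1) \<mu>2(1) by (simp add: space1 space2)
  have int_\<mu>: "(\<integral>\<^sup>+x. g x \<partial>\<mu>) = (\<integral>\<^sup>+x. ennreal (p1 x) * g x \<partial>\<nu>1) + (\<integral>\<^sup>+x. ennreal (p2 x) * g x \<partial>\<nu>2)"
    if "g \<in> borel_measurable borel" for g
  proof -
    have "(\<integral>\<^sup>+x. g x \<partial>\<mu>) = ennreal \<alpha>1 * (\<integral>\<^sup>+x. g x \<partial>\<mu>1) + ennreal \<alpha>2 * (\<integral>\<^sup>+x. g x \<partial>\<mu>2)"
      unfolding \<mu> by (rule nn_integral_union_measure[OF _ _ that]) (simp_all add: \<mu>1(1) \<mu>2(1) sets1 sets2 space1 space2)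
    also have "ennreal \<alpha>1 * (\<integral>\<^sup>+x. g x \<partial>\<mu>1) = (\<integral>\<^sup>+x. ennreal (p1 x) * g x \<partial>\<nu>1)"
      unfolding \<mu>1(1) p1_def \<nu>1_def using \<alpha>(1) by (intro weighted_density_borel[OF space1 sets1 borel12(1) cont\<rho>(1) _ \<rho>_nonneg(1) that]) auto
    also have "ennreal \<alpha>2 * (\<integral>\<^sup>+x. g x \<partial>\<mu>2) = (\<integral>\<^sup>+x. ennreal (p2 x) * g x \<partial>\<nu>2)"
      unfolding \<mu>2(1) p2_def \<nu>2_def using \<alpha>(2) by (intro weighted_density_borel[OF space2 sets2 borel12(2) cont\<rho>(2) _ \<rho>_nonneg(2) that]) auto
    finally show ?thesis .
  qed

  \<comment> \<open>The hypotheses say nothing about \<open>\<eta>\<close> on negative arguments.\<close>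
  define \<theta> where "\<theta> t = \<eta> (max 0 t)" for t
  have \<theta>: "antimono \<theta>" "\<And>t. 0 \<le> \<theta> t" "\<And>t. 1 < t \<Longrightarrow> \<theta> t = 0"
    unfolding \<theta>_def using antimono_max_zero[of \<eta>, OF \<eta>_mono] \<eta>_nonneg support_zero_beyond_one[OF \<eta>_supp] by auto
  have \<theta>_meas [measurable]: "\<theta> \<in> borel_measurable borel" using \<theta>(1) by (rule antimono_borel)
  have \<theta>_eq: "\<eta> (norm (x - y) / \<epsilon> n) = \<theta> (dist x y / \<epsilon> n)" for x y n
    using \<epsilon>(1)[of n] by (simp add: \<theta>_def dist_norm)
  obtain r0 where r0: "0 < r0" and low: "\<And>t. 0 \<le> t \<Longrightarrow> t \<le> r0 \<Longrightarrow> \<eta> 0 / 2 \<le> \<eta> t"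
    using lower_bound_near_zero[OF \<eta>_cont \<eta>_pos] by blast

  \<comment> \<open>The kernel convolution as a sum of two shares\<close>
  define K where "K n x = enn2real (kint \<nu>1 \<theta> p1 (\<epsilon> n) x) + enn2real (kint \<nu>2 \<theta> p2 (\<epsilon> n) x)" for n x
  have pC1: "0 \<le> p1 x \<and> p1 x \<le> C" if "x \<in> M1" for x using p1[OF that] c by linarith
  have pC2: "0 \<le> p2 x \<and> p2 x \<le> C" if "x \<in> M2" for x using p2[OF that] c by linarith
  have kint_fin: "kint \<nu>1 \<theta> p1 (\<epsilon> n) x < \<infinity>" "kint \<nu>2 \<theta> p2 (\<epsilon> n) x < \<infinity>" for n x
  proof -
    have "\<exists>C'>0. \<forall>e>0. \<forall>x. kint \<nu>1 \<theta> p1 e x \<le> ennreal (C' * e ^ DIM(real^'d1))"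
      by (rule charted_kint_le[OF ch1]) (use \<theta> pC1 C in auto)
    then obtain C' where "kint \<nu>1 \<theta> p1 (\<epsilon> n) x \<le> ennreal C'" using \<epsilon>(1)[of n] by blast
    then show "kint \<nu>1 \<theta> p1 (\<epsilon> n) x < \<infinity>" by (rule order_le_less_trans) simp
    have "\<exists>C'>0. \<forall>e>0. \<forall>x. kint \<nu>2 \<theta> p2 e x \<le> ennreal (C' * e ^ DIM(real^'d2))"
      by (rule charted_kint_le[OF ch2]) (use \<theta> pC2 C in auto)
    then obtain C' where "kint \<nu>2 \<theta> p2 (\<epsilon> n) x \<le> ennreal C'" using \<epsilon>(1)[of n] by blast
    then show "kint \<nu>2 \<theta> p2 (\<epsilon> n) x < \<infinity>" by (rule order_le_less_trans) simp
  qed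
  have idVol: "(\<lambda>x. x) \<in> measurable \<mu> borel"
    by (subst measurable_cong_sets[OF _ refl, of \<mu> "restrict_space borel (M1 \<union> M2)"])
      (simp_all add: \<mu> sets_union_measure \<mu>1(1) \<mu>2(1) space1 space2 measurable_restrict_space1)
  have kernel_conv: "kernel_conv \<eta> \<mu> (\<epsilon> n) x = K n x" for n x
  proof -
    have g: "(\<lambda>z. \<theta> (dist x z / \<epsilon> n)) \<in> borel_measurable borel" by measurable
    have "kernel_conv \<eta> \<mu> (\<epsilon> n) x = enn2real (\<integral>\<^sup>+z. ennreal (\<theta> (dist x z / \<epsilon> n)) \<partial>\<mu>)"
      unfolding kernel_conv_def \<theta>_eq using \<theta>(2) measurable_compose[OF idVol g]
      by (intro integral_eq_nn_integral) auto
    also have "(\<integral>\<^sup>+z. ennreal (\<theta> (dist x z / \<epsilon> n)) \<partial>\<mu>) = kint \<nu>1 \<theta> p1 (\<epsilon> n) x + kint \<nu>2 \<theta> p2 (\<epsilon> n) x"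
    proof -
      have "ennreal (\<theta> t * q) = ennreal q * ennreal (\<theta> t)" for t q
        using ennreal_mult'[OF \<theta>(2)[of t], of q] by (simp only: mult.commute)
      then show ?thesis unfolding kint_def by (subst int_\<mu>) simp_all
    qed
    also have "enn2real \<dots> = K n x"
      unfolding K_def using kint_fin by (intro enn2real_plus) auto
    finally show ?thesis .
  qed

  \<comment> \<open>Extension of the functions by zero and their norms\<close>
  define u' where "u' n x = (if x \<in> M1 \<union> M2 then u n x else 0)" for n x
  have u_meas: "u n \<in> borel_measurable Vol" for n using u[of n] by (simp add: L2_def)
  \<comment> \<open>\<open>u n\<close> is measurable only on the union of the manifolds and
    arbitrary elsewhere; the extension by zero is Borel on the ambient space.\<close>
  have u'_meas [measurable]: "u' n \<in> borel_measurable borel" for n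
  proof -
    have "u n \<in> borel_measurable (restrict_space borel (M1 \<union> M2))"
      using u_meas[of n] unfolding measurable_cong_sets[OF setsVol refl] .
    then have "(\<lambda>x. if x \<in> M1 \<union> M2 then u n x else 0) \<in> borel_measurable borel"
      using borel12 by (subst measurable_If_restrict_space_iff) (simp_all add: Un_def[symmetric] del: Un_iff)
    then show ?thesis by (simp add: u'_def[abs_def])
  qed
  have sq_Vol: "sqnorm Vol (\<lambda>x. u i x - u j x) = sqnorm \<nu>1 (\<lambda>x. u' i x - u' j x) + sqnorm \<nu>2 (\<lambda>x. u' i x - u' j x)" for i j
  proof -
    have "sqnorm Vol (\<lambda>x. u i x - u j x) = (\<integral>\<^sup>+x. ennreal ((u' i x - u' j x)\<^sup>2) \<partial>Vol)"
      unfolding sqnorm_def by (intro nn_integral_cong) (simp add: spaceVol u'_def)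
    also have "\<dots> = sqnorm \<nu>1 (\<lambda>x. u' i x - u' j x) + sqnorm \<nu>2 (\<lambda>x. u' i x - u' j x)"
      unfolding sqnorm_def by (rule int_Vol) measurable
    finally show ?thesis .
  qed
  obtain B0 where B0: "\<And>n. L2_norm Vol (u n) \<le> B0"
    using norms unfolding bdd_above_def by auto
  have sq_u: "sqnorm Vol (u n) = ennreal ((L2_norm Vol (u n))\<^sup>2)" for n
  proof -
    have "integrable Vol (\<lambda>x. (u n x)\<^sup>2)" using u[of n] by (simp add: L2_def)
    then have "sqnorm Vol (u n) = ennreal (\<integral>x. (u n x)\<^sup>2 \<partial>Vol)"
      unfolding sqnorm_def by (intro nn_integral_eq_integral) auto
    then show ?thesis by (simp add: L2_norm_def)
  qed
  have sq_le: "sqnorm \<nu>1 (u' n) + sqnorm \<nu>2 (u' n) \<le> ennreal (B0\<^sup>2)" for n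
  proof -
    have "sqnorm \<nu>1 (u' n) + sqnorm \<nu>2 (u' n) = (\<integral>\<^sup>+x. ennreal ((u' n x)\<^sup>2) \<partial>Vol)"
      unfolding sqnorm_def by (rule int_Vol[symmetric]) measurable
    also have "\<dots> = sqnorm Vol (u n)"
      unfolding sqnorm_def by (intro nn_integral_cong) (simp add: spaceVol u'_def)
    also have "\<dots> \<le> ennreal (B0\<^sup>2)"
      unfolding sq_u using B0[of n] by (intro ennreal_leI power_mono) (auto simp: L2_norm_def)
    finally show ?thesis .
  qed
  have B: "sqnorm \<nu>1 (u' n) \<le> ennreal (B0\<^sup>2)" "sqnorm \<nu>2 (u' n) \<le> ennreal (B0\<^sup>2)" for n
    by (rule order_trans[OF _ sq_le[of n]], simp)+

  \<comment> \<open>Bounds on the four partial energies\<close>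
  define w where "w n x = u' n x / sqrt (K n x)" for n x
  have [measurable]: "(\<lambda>x. kint \<nu>1 \<theta> p1 e x) \<in> borel_measurable borel" "(\<lambda>x. kint \<nu>2 \<theta> p2 e x) \<in> borel_measurable borel" for e
    using kint_measurable[OF \<nu>_fin(1) \<nu>_sets(1) \<theta>_meas p_meas(1)] kint_measurable[OF \<nu>_fin(2) \<nu>_sets(2) \<theta>_meas p_meas(2)] by auto
  have [measurable]: "K n \<in> borel_measurable borel" for n unfolding K_def[abs_def] by measurable
  have [measurable]: "w n \<in> borel_measurable borel" for n unfolding w_def[abs_def] by measurable
  obtain E where E: "0 \<le> E" "\<And>n. energy \<eta> \<mu> (\<epsilon> n) (u n) \<le> ennreal E"
  proof -
    obtain e where e: "(SUP n. energy \<eta> \<mu> (\<epsilon> n) (u n)) = ennreal e" "0 \<le> e"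
      using energy by (cases "SUP n. energy \<eta> \<mu> (\<epsilon> n) (u n)") auto
    have "energy \<eta> \<mu> (\<epsilon> n) (u n) \<le> ennreal e" for n
      unfolding e(1)[symmetric] by (rule SUP_upper) simp
    then show ?thesis using that e(2) by blast
  qed
  define G where "G n x y = ennreal (\<theta> (dist x y / \<epsilon> n) * (w n x - w n y)\<^sup>2)" for n and x y :: "real^'N"
  have [measurable]: "(\<lambda>z. G n (s z) (t z)) \<in> borel_measurable N"
    if [measurable]: "s \<in> borel_measurable N" "t \<in> borel_measurable N" for n s t and N :: "'c measure"
    unfolding G_def by measurable
  have energy_le: "(\<integral>\<^sup>+y. (\<integral>\<^sup>+x. G n x y \<partial>\<mu>) \<partial>\<mu>) \<le> ennreal (E * (\<epsilon> n)\<^sup>2)" for n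
  proof -
    have "(\<integral>\<^sup>+y. (\<integral>\<^sup>+x. ennreal (\<eta> (norm (x - y) / \<epsilon> n) *
        \<bar>u n x / sqrt (kernel_conv \<eta> \<mu> (\<epsilon> n) x) - u n y / sqrt (kernel_conv \<eta> \<mu> (\<epsilon> n) y)\<bar>\<^sup>2) \<partial>\<mu>) \<partial>\<mu>) = (\<integral>\<^sup>+y. (\<integral>\<^sup>+x. G n x y \<partial>\<mu>) \<partial>\<mu>)"
      by (intro nn_integral_cong) (simp add: space\<mu> G_def w_def u'_def kernel_conv \<theta>_eq)
    then have "ennreal (1 / (\<epsilon> n)\<^sup>2) * (\<integral>\<^sup>+y. (\<integral>\<^sup>+x. G n x y \<partial>\<mu>) \<partial>\<mu>) \<le> ennreal E"
      using E(2)[of n] unfolding energy_def by simp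
    then have "ennreal ((\<epsilon> n)\<^sup>2) * (ennreal (1 / (\<epsilon> n)\<^sup>2) * (\<integral>\<^sup>+y. (\<integral>\<^sup>+x. G n x y \<partial>\<mu>) \<partial>\<mu>)) \<le> ennreal ((\<epsilon> n)\<^sup>2) * ennreal E"
      by (rule mult_left_mono) simp
    moreover have "ennreal ((\<epsilon> n)\<^sup>2) * ennreal (1 / (\<epsilon> n)\<^sup>2) = 1"
      using \<epsilon>(1)[of n] by (simp add: ennreal_mult[symmetric] del: ennreal_power)
    moreover have "ennreal ((\<epsilon> n)\<^sup>2) * ennreal E = ennreal (E * (\<epsilon> n)\<^sup>2)"
      using E(1) by (simp add: ennreal_mult[symmetric] mult.commute del: ennreal_power)
    ultimately show ?thesis by (simp add: mult.assoc[symmetric])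
  qed
  have cle1: "ennreal c * (\<integral>\<^sup>+x. g x \<partial>\<nu>1) \<le> (\<integral>\<^sup>+x. g x \<partial>\<mu>)" if g: "g \<in> borel_measurable borel" for g
  proof -
    have "ennreal c * (\<integral>\<^sup>+x. g x \<partial>\<nu>1) = (\<integral>\<^sup>+x. ennreal c * g x \<partial>\<nu>1)"
      using g by (intro nn_integral_cmult[symmetric]) simp
    also have "\<dots> \<le> (\<integral>\<^sup>+x. ennreal (p1 x) * g x \<partial>\<nu>1)"
    proof (rule nn_integral_mono_AE, use ae1 in eventually_elim)
      case (elim x)
      then show ?case using p1[OF elim] by (intro mult_right_mono ennreal_leI) auto
    qed
    also have "\<dots> \<le> (\<integral>\<^sup>+x. g x \<partial>\<mu>)" unfolding int_\<mu>[OF g] by simp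
    finally show ?thesis .
  qed
  have cle2: "ennreal c * (\<integral>\<^sup>+x. g x \<partial>\<nu>2) \<le> (\<integral>\<^sup>+x. g x \<partial>\<mu>)" if g: "g \<in> borel_measurable borel" for g
  proof -
    have "ennreal c * (\<integral>\<^sup>+x. g x \<partial>\<nu>2) = (\<integral>\<^sup>+x. ennreal c * g x \<partial>\<nu>2)"
      using g by (intro nn_integral_cmult[symmetric]) simp
    also have "\<dots> \<le> (\<integral>\<^sup>+x. ennreal (p2 x) * g x \<partial>\<nu>2)"
    proof (rule nn_integral_mono_AE, use ae2 in eventually_elim)
      case (elim x)
      then show ?case using p2[OF elim] by (intro mult_right_mono ennreal_leI) auto
    qed
    also have "\<dots> \<le> (\<integral>\<^sup>+x. g x \<partial>\<mu>)" unfolding int_\<mu>[OF g] by simp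
    finally show ?thesis .
  qed
  have cle: "ennreal c * (\<integral>\<^sup>+x. g x \<partial>\<nu>) \<le> (\<integral>\<^sup>+x. g x \<partial>\<mu>)"
    if "\<nu> \<in> {\<nu>1, \<nu>2}" "g \<in> borel_measurable borel" for \<nu> g
    using that cle1 cle2 by auto
  have G_meas: "(\<lambda>x. \<integral>\<^sup>+y. G n x y \<partial>\<nu>) \<in> borel_measurable borel" if "\<nu> \<in> {\<nu>1, \<nu>2}" for \<nu> n
  proof -
    have "(\<lambda>x. \<integral>\<^sup>+y. G n x y \<partial>\<nu>1) \<in> borel_measurable borel" "(\<lambda>x. \<integral>\<^sup>+y. G n x y \<partial>\<nu>2) \<in> borel_measurable borel"
      by measurable
    then show ?thesis using that by auto
  qed
  have G_sym: "G n x y = G n y x" for n x y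
    by (simp add: G_def dist_commute power2_commute)
  \<comment> \<open>\<open>\<mu>\<close> dominates c times either volume. Using this once in each
    variable bounds every partial energy, mixed ones included, by 1/c^2 times the total.\<close>
  have en: "(\<integral>\<^sup>+x. \<integral>\<^sup>+y. G n x y \<partial>\<nu>' \<partial>\<nu>) \<le> ennreal (E / c\<^sup>2 * (\<epsilon> n)\<^sup>2)" if \<nu>: "\<nu> \<in> {\<nu>1, \<nu>2}" "\<nu>' \<in> {\<nu>1, \<nu>2}" for \<nu> \<nu>' n
  proof -
    have "ennreal c * (ennreal c * (\<integral>\<^sup>+x. \<integral>\<^sup>+y. G n x y \<partial>\<nu>' \<partial>\<nu>)) \<le> ennreal c * (\<integral>\<^sup>+x. \<integral>\<^sup>+y. G n x y \<partial>\<nu>' \<partial>\<mu>)"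
      by (intro mult_left_mono cle[OF \<nu>(1)] G_meas \<nu>(2)) simp
    also have "\<dots> = (\<integral>\<^sup>+x. ennreal c * \<integral>\<^sup>+y. G n x y \<partial>\<nu>' \<partial>\<mu>)"
      by (intro nn_integral_cmult[symmetric] measurable_compose[OF idVol] G_meas \<nu>(2))
    also have "\<dots> \<le> (\<integral>\<^sup>+x. \<integral>\<^sup>+y. G n x y \<partial>\<mu> \<partial>\<mu>)"
      by (intro nn_integral_mono cle[OF \<nu>(2)]) measurable
    also have "\<dots> \<le> ennreal (E * (\<epsilon> n)\<^sup>2)"
      using energy_le[of n] by (simp add: G_sym)
    finally have "ennreal (1 / c\<^sup>2) * (ennreal c * (ennreal c * (\<integral>\<^sup>+x. \<integral>\<^sup>+y. G n x y \<partial>\<nu>' \<partial>\<nu>))) \<le> ennreal (1 / c\<^sup>2) * ennreal (E * (\<epsilon> n)\<^sup>2)"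
      by (rule mult_left_mono) simp
    moreover have "ennreal (1 / c\<^sup>2) * (ennreal c * ennreal c) = 1"
      using c by (simp add: ennreal_mult[symmetric] power2_eq_square del: ennreal_power)
    moreover have "ennreal (1 / c\<^sup>2) * ennreal (E * (\<epsilon> n)\<^sup>2) = ennreal (E / c\<^sup>2 * (\<epsilon> n)\<^sup>2)"
      using E(1) by (simp add: ennreal_mult[symmetric] del: ennreal_power)
    ultimately show ?thesis by (simp add: mult.assoc[symmetric])
  qed

  \<comment> \<open>Extraction of a common subsequence\<close>
  have "\<exists>r. strict_mono (r :: nat \<Rightarrow> nat) \<and> L2_cauchy \<nu>1 (\<lambda>n. u' (r n)) \<and> L2_cauchy \<nu>2 (\<lambda>n. u' (r n))"
  proof (rule two_manifolds_precompact[OF ch1 ch2, where \<eta> = \<theta> and ?r0.0 = r0 and h = "\<eta> 0 / 2" and ?p1.0 = p1 and ?p2.0 = p2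
      and c = c and C = C and \<epsilon> = \<epsilon> and u = u' and K = K and w = w and E = "E / c\<^sup>2" and B = "B0\<^sup>2"])
    show "(\<integral>\<^sup>+x. \<integral>\<^sup>+y. ennreal (\<theta> (dist x y / \<epsilon> n) * (w n x - w n y)\<^sup>2) \<partial>\<nu>' \<partial>\<nu>) \<le> ennreal (E / c\<^sup>2 * (\<epsilon> n)\<^sup>2)"
      if "\<nu> \<in> {\<nu>1, \<nu>2}" "\<nu>' \<in> {\<nu>1, \<nu>2}" for \<nu> \<nu>' n
      using en[OF that, of n] by (simp add: G_def)
    show "\<eta> 0 / 2 \<le> \<theta> t" if "0 \<le> t" "t \<le> r0" for t
      using low[OF that] that(1) by (simp add: \<theta>_def)
  qed (use dims \<theta> \<eta>_pos r0 p_meas p_cont c p1 p2 C \<epsilon> u'_meas B E(1) in \<open>simp_all add: K_def w_def\<close>)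
  then obtain r :: "nat \<Rightarrow> nat" where r: "strict_mono r" "L2_cauchy \<nu>1 (\<lambda>n. u' (r n))" "L2_cauchy \<nu>2 (\<lambda>n. u' (r n))"
    by blast
  \<comment> \<open>Passing to the limit only now, for \<open>Vol\<close> itself, avoids gluing two limits along the intersection.\<close>
  have "L2_cauchy Vol (\<lambda>n. u (r n))"
    unfolding L2_cauchy_def
  proof (intro allI impI)
    fix e :: real assume "0 < e"
    then have e2: "0 < e / 2" by simp
    obtain N1 where N1: "\<And>i j. i \<ge> N1 \<Longrightarrow> j \<ge> N1 \<Longrightarrow> sqnorm \<nu>1 (\<lambda>x. u' (r i) x - u' (r j) x) \<le> ennreal (e / 2)"
      using r(2) e2 unfolding L2_cauchy_def by blast
    obtain N2 where N2: "\<And>i j. i \<ge> N2 \<Longrightarrow> j \<ge> N2 \<Longrightarrow> sqnorm \<nu>2 (\<lambda>x. u' (r i) x - u' (r j) x) \<le> ennreal (e / 2)"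
      using r(3) e2 unfolding L2_cauchy_def by blast
    show "\<exists>N. \<forall>i\<ge>N. \<forall>j\<ge>N. sqnorm Vol (\<lambda>x. u (r i) x - u (r j) x) \<le> ennreal e"
    proof (intro exI[of _ "max N1 N2"] allI impI)
      fix i j assume ij: "max N1 N2 \<le> i" "max N1 N2 \<le> j"
      have "sqnorm Vol (\<lambda>x. u (r i) x - u (r j) x) \<le> ennreal (e / 2) + ennreal (e / 2)"
        unfolding sq_Vol using ij by (intro add_mono N1 N2) auto
      also have "\<dots> = ennreal (e / 2 + e / 2)" using e2 by (intro ennreal_plus[symmetric]) auto
      finally show "sqnorm Vol (\<lambda>x. u (r i) x - u (r j) x) \<le> ennreal e" by simp
    qed
  qed

  \<comment> \<open>The limit in \<open>L2 Vol\<close>\<close>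
  then obtain v where v [measurable]: "v \<in> borel_measurable Vol" and lim: "(\<lambda>n. sqnorm Vol (\<lambda>x. u (r n) x - v x)) \<longlonglongrightarrow> 0"
    using L2_complete[of "\<lambda>n. u (r n)" Vol] u_meas by blast
  have v_L2: "v \<in> L2 Vol"
  proof -
    have "\<forall>\<^sub>F n in sequentially. sqnorm Vol (\<lambda>x. u (r n) x - v x) < 1"
      by (rule order_tendstoD(2)[OF lim]) simp
    then obtain n where n: "sqnorm Vol (\<lambda>x. u (r n) x - v x) < 1"
      unfolding eventually_sequentially by blast
    have "sqnorm Vol v \<le> 2 * sqnorm Vol (\<lambda>x. v x - u (r n) x) + 2 * sqnorm Vol (u (r n))"
      by (rule sqnorm_le_diff[OF v u_meas])
    also have "\<dots> < \<infinity>"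
      using n unfolding sqnorm_minus_commute[of Vol v] sq_u by (auto simp: ennreal_mult_less_top order_less_trans)
    finally have "integrable Vol (\<lambda>x. (v x)\<^sup>2)"
      unfolding sqnorm_def by (intro integrableI_nonneg) auto
    then show ?thesis using v by (simp add: L2_def)
  qed
  have "L2_norm Vol (\<lambda>x. u (r n) x - v x) = sqrt (enn2real (sqnorm Vol (\<lambda>x. u (r n) x - v x)))" for n
    unfolding L2_norm_def sqnorm_def using u_meas v
    by (subst integral_eq_nn_integral) auto
  moreover have "(\<lambda>n. sqrt (enn2real (sqnorm Vol (\<lambda>x. u (r n) x - v x)))) \<longlonglongrightarrow> sqrt 0"
    by (intro tendsto_real_sqrt tendsto_enn2real) (use lim in simp_all)
  ultimately have "(\<lambda>k. L2_norm Vol (\<lambda>x. u (r k) x - v x)) \<longlonglongrightarrow> 0" by simp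
  then show ?thesis using r(1) v_L2 by blast
qed

end
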